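(* Let $A,A_1,B,B_1>0$. There is a threshold $\mu_0>1$, depending only on $A,A_1,B,B_1$, such that the following holds for all $M,m>0$ for which $\mu:=\frac{2M+m}{m}$ satisfies $\mu>\mu_0$, $\mu>1+\frac{A}{4A_1}$, $\mu>1+\frac{B}{16B_1}$ and $(\mu-1)^{4/15}\left(\frac{4A_1}{A}\right)^{2/3}\ne\left(\frac{16B_1}{B}\right)^{2/5}$. Let $h\in\mathbb R$ (and the angular momentum $C\in\mathbb R$) be fixed. Then on the collision manifold $\Delta$ there are the following equilibrium points, written as $(r,v,\theta,w)$: $$Q=(0,\sqrt{2W(0)},0,0),\qquad Q^*=(0,-\sqrt{2W(0)},0,0),$$ $$E_\pm=(0,\sqrt{2W(\theta_w)},\pm\theta_w,0),\qquad E_\pm^*=(0,-\sqrt{2W(\theta_w)},\pm\theta_w,0).$$ Furthermore, for the flow on the energy level, $Q$ is a spiral source with $\dim\mathcal W_u(Q)=3$; $Q^*$ is a spiral sink with $\dim\mathcal W_s(Q^* )=3$; and $E_\pm$, $E^*_\pm$ are saddles with $$\dim\mathcal W_u(E_\pm)=2,\quad \dim\mathcal W_s(E_\pm)=1,\quad \dim\mathcal W_s(E^*_\pm)=2,\quad \dim\mathcal W_u(E^*_\pm)=1.$$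
   Context: Setting (isosceles Schwarzschild three body problem in regularized coordinates). Two equal masses $M$ move in a horizontal plane symmetrically about their midpoint $O$ and a mass $m$ moves on the vertical axis through $O$; $R\ge0$ is the distance between the equal masses, $z$ the height of $m$, $C$ the angular momentum, $h$ the energy. One sets $R=r\sqrt{2/M}\cos\theta$, $z=r\sqrt{\tfrac{2M+m}{2Mm}}\sin\theta$ with $r\ge 0$, $\theta\in[-\pi/2,\pi/2]$. Let $$V(\theta)=\left(\tfrac M2\right)^{1/2}\!\left(\tfrac{A}{\cos\theta}+\tfrac{4A_1}{(\cos^2\theta+\mu\sin^2\theta)^{1/2}}\right),\quad W(\theta)=\left(\tfrac M2\right)^{3/2}\!\left(\tfrac{B}{\cos^3\theta}+\tfrac{16B_1}{(\cos^2\theta+\mu\sin^2\theta)^{3/2}}\right),$$ and $U(\theta)=W(\theta)\cos^3\theta>0$. The regularized equations on $[0,\infty)\times\mathbb R\times[-\pi/2,\pi/2]\times\mathbb R\ni(r,v,\theta,w)$ are $$r'=\tfrac{\cos^3\theta}{\sqrt U}\,rv,\qquad v'=\tfrac{\cos^3\theta}{2\sqrt U}v^2-\sqrt U+r^2(2hr+V)\tfrac{\cos^3\theta}{\sqrt U},\qquad \theta'=w,$$ $$w'=\tfrac{\cos^3\theta}{2\sqrt U}vw+\tfrac{\cos^6\theta}{U}r^2V'(\theta)+\tfrac{U'(\theta)}{U}\left(\cos^3\theta-\tfrac{w^2}{2}\right)-3\sin\theta\cos^2\theta+\tfrac{3\sin\theta\cos^5\theta}{U}\left(v^2-2hr^3-2r^2V\right)+\tfrac{2C^2r\sin\theta\cos^3\theta}{U},$$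 (expressions such as $V\cos^3\theta$, $V'\cos^6\theta$ being extended continuously to $\theta=\pm\pi/2$), considered on the invariant energy level $$2hr^3\cos^6\theta=Uw^2+(v^2\cos^3\theta-2U)\cos^3\theta+(C^2-2rV\cos^2\theta)\,r\cos^4\theta .$$ The triple collision manifold is $\Delta=\{(r,v,\theta,w): r=0,\ w^2+\frac{\cos^6\theta}{U(\theta)}v^2=2\cos^3\theta\}$, the part $r=0$ of every energy level. The angle $\theta_w\in(0,\pi/2)$ is defined by $$\cos\theta_w=\sqrt{\frac{\mu}{(\mu-1)+(\mu-1)^{2/5}(16B_1/B)^{2/5}}};$$ $0,\pm\theta_w$ are the critical points of $W$. $\mathcal W_u$, $\mathcal W_s$ denote unstable and stable manifolds for the flow on the (3-dimensional) energy level. "Spiral" source/sink means that the linearization along the energy level has a pair of non-real complex conjugate eigenvalues, all eigenvalues having positive/negative real part. *)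

theory Defs
  imports "HOL-Analysis.Analysis"
begin

section \<open>Equilibria, linearization, stable and unstable manifolds\<close>

text \<open>
  The phase flow is that of a vector field \<open>X\<close> on an invariant level set \<open>S = {x \<in> P. F x = 0}\<close>
  of a function \<open>F\<close>.  The linearization of \<open>X\<close> along the level at \<open>p\<close> is the derivative of \<open>X\<close>
  at \<open>p\<close> restricted to the tangent space, the kernel of the derivative of \<open>F\<close>.
\<close>

definition tangent_space :: "('a::real_normed_vector \<Rightarrow> real) \<Rightarrow> 'a \<Rightarrow> 'a set" where
  "tangent_space F p = {\<xi>. frechet_derivative F (at p) \<xi> = 0}"

text \<open>
  \<open>\<zeta>\<close> is an eigenvalue of the complexification of the restriction of \<open>X'(p)\<close> to the tangent
  space: \<open>L (a + i b) = \<zeta> (a + i b)\<close> with \<open>a + i b \<noteq> 0\<close>, split into real and imaginary parts.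
\<close>

definition level_eigenvalue ::
  "('a::real_normed_vector \<Rightarrow> 'a) \<Rightarrow> ('a \<Rightarrow> real) \<Rightarrow> 'a \<Rightarrow> complex \<Rightarrow> bool" where
  "level_eigenvalue X F p \<zeta> \<longleftrightarrow>
     (let L = frechet_derivative X (at p) in
      \<exists>a \<in> tangent_space F p. \<exists>b \<in> tangent_space F p. (a, b) \<noteq> (0, 0) \<and>
        L a = Re \<zeta> *\<^sub>R a - Im \<zeta> *\<^sub>R b \<and>
        L b = Im \<zeta> *\<^sub>R a + Re \<zeta> *\<^sub>R b)"

definition spiral_source ::
  "('a::real_normed_vector \<Rightarrow> 'a) \<Rightarrow> ('a \<Rightarrow> real) \<Rightarrow> 'a \<Rightarrow> bool" where
  "spiral_source X F p \<longleftrightarrow>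
     (\<exists>\<zeta>. level_eigenvalue X F p \<zeta> \<and> level_eigenvalue X F p (cnj \<zeta>) \<and> Im \<zeta> \<noteq> 0) \<and>
     (\<forall>\<zeta>. level_eigenvalue X F p \<zeta> \<longrightarrow> Re \<zeta> > 0)"

definition spiral_sink ::
  "('a::real_normed_vector \<Rightarrow> 'a) \<Rightarrow> ('a \<Rightarrow> real) \<Rightarrow> 'a \<Rightarrow> bool" where
  "spiral_sink X F p \<longleftrightarrow>
     (\<exists>\<zeta>. level_eigenvalue X F p \<zeta> \<and> level_eigenvalue X F p (cnj \<zeta>) \<and> Im \<zeta> \<noteq> 0) \<and>
     (\<forall>\<zeta>. level_eigenvalue X F p \<zeta> \<longrightarrow> Re \<zeta> < 0)"

definition saddle ::
  "('a::real_normed_vector \<Rightarrow> 'a) \<Rightarrow> ('a \<Rightarrow> real) \<Rightarrow> 'a \<Rightarrow> bool" where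
  "saddle X F p \<longleftrightarrow>
     (\<forall>\<zeta>. level_eigenvalue X F p \<zeta> \<longrightarrow> Re \<zeta> \<noteq> 0) \<and>
     (\<exists>\<zeta>. level_eigenvalue X F p \<zeta> \<and> Re \<zeta> > 0) \<and>
     (\<exists>\<zeta>. level_eigenvalue X F p \<zeta> \<and> Re \<zeta> < 0)"

definition trajectory ::
  "('a::real_normed_vector \<Rightarrow> 'a) \<Rightarrow> 'a set \<Rightarrow> real set \<Rightarrow> (real \<Rightarrow> 'a) \<Rightarrow> bool" where
  "trajectory X S I \<gamma> \<longleftrightarrow>
     (\<forall>t\<in>I. \<gamma> t \<in> S \<and> (\<gamma> has_vector_derivative X (\<gamma> t)) (at t within I))"

definition unstable_manifold ::
  "('a::real_normed_vector \<Rightarrow> 'a) \<Rightarrow> 'a set \<Rightarrow> 'a \<Rightarrow> 'a set" where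
  "unstable_manifold X S p =
     {x. \<exists>\<gamma>. trajectory X S {..0} \<gamma> \<and> \<gamma> 0 = x \<and> (\<gamma> \<longlongrightarrow> p) at_bot}"

definition stable_manifold ::
  "('a::real_normed_vector \<Rightarrow> 'a) \<Rightarrow> 'a set \<Rightarrow> 'a \<Rightarrow> 'a set" where
  "stable_manifold X S p =
     {x. \<exists>\<gamma>. trajectory X S {0..} \<gamma> \<and> \<gamma> 0 = x \<and> (\<gamma> \<longlongrightarrow> p) at_top}"

text \<open>
  \<open>k\<close>-dimensional topological manifolds, possibly with boundary.  The boundary has to be allowed,
  since the phase space below ends at \<open>r = 0\<close>.  The local models are relatively open subsets of
  \<open>{y \<in> L. 0 \<le> a \<bullet> y}\<close>, which is a closed half-space of the \<open>k\<close>-dimensional space \<open>L\<close>, or all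
  of \<open>L\<close> if \<open>a\<close> is orthogonal to \<open>L\<close>.
\<close>

definition manifold_of_dim :: "nat \<Rightarrow> 'a::euclidean_space set \<Rightarrow> bool" where
  "manifold_of_dim k N \<longleftrightarrow>
     (\<forall>x\<in>N. \<exists>T (L :: 'a set) a G.
        openin (top_of_set N) T \<and> x \<in> T \<and>
        subspace L \<and> dim L = k \<and> openin (top_of_set {y \<in> L. 0 \<le> a \<bullet> y}) G \<and>
        T homeomorphic G)"

text \<open>
  The global unstable manifold is in general only injectively immersed (it may accumulate on
  itself); it consists of the images under the flow of the local one, formed by the orbits that
  remain in a small neighbourhood \<open>N\<close> of \<open>p\<close>, and its dimension is the dimension of the latter.
  Local manifolds are obtained by replacing \<open>S\<close> by \<open>S \<inter> N\<close>.
\<close>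

definition unstable_dim ::
  "('a::euclidean_space \<Rightarrow> 'a) \<Rightarrow> 'a set \<Rightarrow> 'a \<Rightarrow> nat \<Rightarrow> bool" where
  "unstable_dim X S p k \<longleftrightarrow>
     (\<forall>\<epsilon>>0. \<exists>N. open N \<and> p \<in> N \<and> N \<subseteq> ball p \<epsilon> \<and>
        p \<in> unstable_manifold X (S \<inter> N) p \<and>
        manifold_of_dim k (unstable_manifold X (S \<inter> N) p))"

definition stable_dim ::
  "('a::euclidean_space \<Rightarrow> 'a) \<Rightarrow> 'a set \<Rightarrow> 'a \<Rightarrow> nat \<Rightarrow> bool" where
  "stable_dim X S p k \<longleftrightarrow>
     (\<forall>\<epsilon>>0. \<exists>N. open N \<and> p \<in> N \<and> N \<subseteq> ball p \<epsilon> \<and>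
        p \<in> stable_manifold X (S \<inter> N) p \<and>
        manifold_of_dim k (stable_manifold X (S \<inter> N) p))"


section \<open>The regularized isosceles Schwarzschild three body problem\<close>

definition mu :: "real \<Rightarrow> real \<Rightarrow> real" where
  "mu M m = (2 * M + m) / m"

definition potV :: "real \<Rightarrow> real \<Rightarrow> real \<Rightarrow> real \<Rightarrow> real \<Rightarrow> real" where
  "potV A A1 M m \<theta> = sqrt (M / 2) *
     (A / cos \<theta> + 4 * A1 / sqrt ((cos \<theta>)\<^sup>2 + mu M m * (sin \<theta>)\<^sup>2))"

definition potW :: "real \<Rightarrow> real \<Rightarrow> real \<Rightarrow> real \<Rightarrow> real \<Rightarrow> real" where
  "potW B B1 M m \<theta> = (M / 2) powr (3/2) *
     (B / (cos \<theta>) ^ 3 + 16 * B1 / ((cos \<theta>)\<^sup>2 + mu M m * (sin \<theta>)\<^sup>2) powr (3/2))"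

text \<open>The continuous extension of \<open>W(\<theta>) cos\<^sup>3 \<theta>\<close> to \<open>\<theta> = \<plusminus>\<pi>/2\<close>.\<close>

definition potU :: "real \<Rightarrow> real \<Rightarrow> real \<Rightarrow> real \<Rightarrow> real \<Rightarrow> real" where
  "potU B B1 M m \<theta> = (M / 2) powr (3/2) *
     (B + 16 * B1 * (cos \<theta>) ^ 3 / ((cos \<theta>)\<^sup>2 + mu M m * (sin \<theta>)\<^sup>2) powr (3/2))"

lemma potU_eq: "cos \<theta> \<noteq> 0 \<Longrightarrow> potU B B1 M m \<theta> = potW B B1 M m \<theta> * (cos \<theta>) ^ 3"
  by (simp add: potU_def potW_def field_simps)

definition theta_w :: "real \<Rightarrow> real \<Rightarrow> real \<Rightarrow> real \<Rightarrow> real" where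
  "theta_w B B1 M m = arccos (sqrt (mu M m /
     ((mu M m - 1) + (mu M m - 1) powr (2/5) * (16 * B1 / B) powr (2/5))))"

lemma theta_w:
  assumes "M > 0" "m > 0" "B > 0" "B1 > 0" "mu M m > 1 + B / (16 * B1)"
  shows "0 < theta_w B B1 M m" "theta_w B B1 M m < pi / 2"
    and "cos (theta_w B B1 M m) = sqrt (mu M m /
      ((mu M m - 1) + (mu M m - 1) powr (2/5) * (16 * B1 / B) powr (2/5)))"
proof -
  define a where "a = mu M m - 1"
  define b where "b = 16 * B1 / B"
  define x where "x = sqrt (mu M m / (a + a powr (2/5) * b powr (2/5)))"
  have a: "a > 1 / b" "b > 0" using assms by (auto simp: a_def b_def)
  hence "a > 0" using less_trans[of 0 "1/b" a] by simp
  have "1 < a * b" using a by (simp add: field_simps)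
  hence "1 < (a * b) powr (2/5)" by (simp add: gr_one_powr)
  hence "1 < a powr (2/5) * b powr (2/5)" using a \<open>a > 0\<close> by (simp add: powr_mult)
  hence x: "0 < x" "x < 1" using \<open>a > 0\<close> unfolding x_def by (auto simp: a_def)
  have t: "theta_w B B1 M m = arccos x" by (simp add: theta_w_def x_def a_def b_def)
  have "arccos 1 < arccos x" "arccos x < arccos 0"
    using x by (intro arccos_less_arccos; simp)+
  thus "0 < theta_w B B1 M m" "theta_w B B1 M m < pi / 2" using t by simp_all
  have "cos (theta_w B B1 M m) = x"
    using x t by simp
  thus "cos (theta_w B B1 M m) = sqrt (mu M m /
      ((mu M m - 1) + (mu M m - 1) powr (2/5) * (16 * B1 / B) powr (2/5)))"
    by (simp add: x_def a_def b_def)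
qed

text \<open>The points are \<open>(r, v, \<theta>, w)\<close>.\<close>

type_synonym state = "real \<times> real \<times> real \<times> real"

definition phase_space :: "state set" where
  "phase_space = {(r, v, \<theta>, w). 0 \<le> r \<and> - (pi/2) \<le> \<theta> \<and> \<theta> \<le> pi/2}"

text \<open>
  In the next two definitions \<open>V\<close> and \<open>V'\<close> only occur with a factor \<open>cos\<^sup>k \<theta>\<close> whose product with
  them tends to \<open>0\<close> as \<open>\<theta> \<longrightarrow> \<plusminus>\<pi>/2\<close>; at \<open>\<theta> = \<plusminus>\<pi>/2\<close> the factor is \<open>0\<close>, so that the formulas take
  the values of the continuous extension there.
\<close>

definition vector_field ::
  "real \<Rightarrow> real \<Rightarrow> real \<Rightarrow> real \<Rightarrow> real \<Rightarrow> real \<Rightarrow> real \<Rightarrow> real \<Rightarrow> state \<Rightarrow> state" where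
  "vector_field A A1 B B1 M m h C = (\<lambda>(r, v, \<theta>, w).
     let V = potV A A1 M m; U = potU B B1 M m in
     (cos \<theta> ^ 3 / sqrt (U \<theta>) * r * v,
      cos \<theta> ^ 3 / (2 * sqrt (U \<theta>)) * v\<^sup>2 - sqrt (U \<theta>)
        + r\<^sup>2 * (2 * h * r + V \<theta>) * cos \<theta> ^ 3 / sqrt (U \<theta>),
      w,
      cos \<theta> ^ 3 / (2 * sqrt (U \<theta>)) * v * w
        + cos \<theta> ^ 6 / U \<theta> * r\<^sup>2 * deriv V \<theta>
        + deriv U \<theta> / U \<theta> * (cos \<theta> ^ 3 - w\<^sup>2 / 2)
        - 3 * sin \<theta> * (cos \<theta>)\<^sup>2
        + 3 * sin \<theta> * cos \<theta> ^ 5 / U \<theta> * (v\<^sup>2 - 2 * h * r ^ 3 - 2 * r\<^sup>2 * V \<theta>)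
        + 2 * C\<^sup>2 * r * sin \<theta> * cos \<theta> ^ 3 / U \<theta>))"

definition energy_fun ::
  "real \<Rightarrow> real \<Rightarrow> real \<Rightarrow> real \<Rightarrow> real \<Rightarrow> real \<Rightarrow> real \<Rightarrow> real \<Rightarrow> state \<Rightarrow> real" where
  "energy_fun A A1 B B1 M m h C = (\<lambda>(r, v, \<theta>, w).
     let V = potV A A1 M m; U = potU B B1 M m in
     U \<theta> * w\<^sup>2 + (v\<^sup>2 * cos \<theta> ^ 3 - 2 * U \<theta>) * cos \<theta> ^ 3
       + (C\<^sup>2 - 2 * r * V \<theta> * (cos \<theta>)\<^sup>2) * r * cos \<theta> ^ 4
       - 2 * h * r ^ 3 * cos \<theta> ^ 6)"

definition energy_level ::
  "real \<Rightarrow> real \<Rightarrow> real \<Rightarrow> real \<Rightarrow> real \<Rightarrow> real \<Rightarrow> real \<Rightarrow> real \<Rightarrow> state set" where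
  "energy_level A A1 B B1 M m h C =
     {x \<in> phase_space. energy_fun A A1 B B1 M m h C x = 0}"

definition collision_manifold :: "real \<Rightarrow> real \<Rightarrow> real \<Rightarrow> real \<Rightarrow> state set" where
  "collision_manifold B B1 M m =
     {(r, v, \<theta>, w) \<in> phase_space.
        r = 0 \<and> w\<^sup>2 + cos \<theta> ^ 6 / potU B B1 M m \<theta> * v\<^sup>2 = 2 * cos \<theta> ^ 3}"

end

theory Submission
  imports Defs
begin

text \<open>
  Why the classification holds.  On the collision manifold an equilibrium has \<open>w = 0\<close>, and
  \<open>v' = 0\<close>, \<open>w' = 0\<close> become \<open>v\<^sup>2 = 2 W(\<theta>)\<close> and \<open>W'(\<theta>) = 0\<close>.  Apart from a positive factor and
  \<open>sin \<theta> cos \<theta>\<close>, the derivative \<open>W'\<close> is a strictly decreasing function \<open>K\<close> of \<open>cos \<theta>\<close>, which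
  vanishes exactly at \<open>\<plusminus>\<theta>\<^sub>w\<close>; hence the six points (\<open>equilibria\<close>).

  Near such a point \<open>cos \<theta> > 0\<close>, and the energy relation can be solved for \<open>v\<^sup>2 = E(r, \<theta>, w)\<close>, so
  that the level is a graph over \<open>(r, \<theta>, w)\<close> with \<open>r \<ge> 0\<close>.  The linearization along the level is
  \<open>r' = \<lambda> r\<close>, \<open>\<theta>' = w\<close>, \<open>w' = (\<lambda>/2) w + q \<theta> - slope r\<close> with \<open>\<lambda>\<^sup>2 = 2 cos\<^sup>3 \<theta>\<close>, where \<open>\<lambda>\<close> has the sign
  of \<open>v\<close> and \<open>q = cos\<^sup>3 \<theta> W''/W\<close>.  Its eigenvalues are \<open>\<lambda>\<close> and the roots of \<open>\<zeta>\<^sup>2 - (\<lambda>/2) \<zeta> - q\<close>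
  (\<open>eigenvalueD\<close>, \<open>eigenvalueI\<close>).  At \<open>\<plusminus>\<theta>\<^sub>w\<close> the potential \<open>W\<close> has a nondegenerate minimum, so
  \<open>q > 0\<close>, and the two roots are real of opposite sign: a saddle.  At \<open>0\<close> one has \<open>\<lambda>\<^sup>2 = 2\<close>, and
  \<open>q = 3 (B - 16 B1 (\<mu> - 1)) / (B + 16 B1)\<close> drops below \<open>-\<lambda>\<^sup>2/16 = -1/8\<close> once \<open>\<mu>\<close> exceeds a bound
  depending on \<open>B\<close> and \<open>B1\<close>: the roots are then \<open>\<lambda>/4 \<plusminus> i \<beta>\<close> with \<open>\<beta> \<noteq> 0\<close>, a spiral.

  The dimensions of the local invariant manifolds need nonlinear arguments.  A local stable manifold
  theorem with a one-dimensional expanding direction is obtained from cones.  The difference of two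
  trajectories cannot leave the cone around the expanding direction, and it grows exponentially
  there; so over each point of the contracting directions there is at most one bounded trajectory.
  If a trajectory starts high above that point it escapes upwards, far below it downwards.  Both sets
  of initial heights are open and they are disjoint, whence connectedness of the line yields a
  trajectory that does neither (\<open>cone_field.trajectory_in_cone_exists\<close>, \<open>stable_graph\<close>).  This is
  applied to the reduced flow in \<open>(r, \<theta>, w)\<close>, whose half-space \<open>r \<ge> 0\<close> is invariant because \<open>r'\<close> is
  a multiple of \<open>r\<close> (\<open>stable_dim_reduced\<close>).  The reduced flow lifts back to the level since the energy
  is conserved on it (\<open>energy_identity\<close>).  Where \<open>r\<close> is an expanding direction, bounded
  trajectories have \<open>r = 0\<close>, and the one-dimensional stable manifolds of \<open>E\<^sub>\<plusminus>\<close> and unstable manifolds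
  of \<open>E\<^sup>*\<^sub>\<plusminus>\<close> lie in the collision manifold.
\<close>

section \<open>Differential inequalities and global trajectories\<close>

lemma exp_growth:
  fixes f f' :: "real \<Rightarrow> real"
  assumes der: "\<And>t. 0 \<le> t \<Longrightarrow> (f has_real_derivative f' t) (at t within {0..})"
    and ge: "\<And>t. 0 \<le> t \<Longrightarrow> c * f t \<le> f' t"
    and st: "0 \<le> s" "s \<le> t"
  shows "f s * exp (c * (t - s)) \<le> f t"
proof -
  let ?g = "\<lambda>t. f t * exp (- c * t)"
  have "?g s \<le> ?g t"
  proof (rule DERIV_nonneg_imp_increasing_open[OF st(2)])
    fix x assume x: "s < x" "x < t"
    have "at x within {0..} = at x"
      using x st by (intro at_within_interior) auto
    then have "(f has_real_derivative f' x) (at x)"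
      using der[of x] x st by auto
    then have "(?g has_real_derivative f' x * exp (- c * x) + f x * (exp (- c * x) * (- c))) (at x)"
      by (auto intro!: derivative_eq_intros)
    moreover have "0 \<le> exp (- c * x) * (f' x - c * f x)"
      using ge[of x] x st by (intro mult_nonneg_nonneg) auto
    ultimately show "\<exists>y. (?g has_real_derivative y) (at x) \<and> 0 \<le> y"
      by (force simp: algebra_simps)
  next
    have "continuous_on {0..} f"
      using der DERIV_continuous_on by (metis atLeast_iff)
    then have "continuous_on {s..t} f"
      using st by (auto intro: continuous_on_subset)
    then show "continuous_on {s..t} ?g"
      by (intro continuous_intros)
  qed
  then have "f s * exp (- c * s) * exp (c * t) \<le> f t * exp (- c * t) * exp (c * t)"
    by (intro mult_right_mono) auto
  then show ?thesis
    by (simp add: mult.assoc flip: exp_add) (simp add: algebra_simps)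
qed

lemma exp_decay:
  fixes f f' :: "real \<Rightarrow> real"
  assumes der: "\<And>t. 0 \<le> t \<Longrightarrow> (f has_real_derivative f' t) (at t within {0..})"
    and le: "\<And>t. 0 \<le> t \<Longrightarrow> f' t \<le> c * f t"
    and t: "0 \<le> t"
  shows "f t \<le> f 0 * exp (c * t)"
  using exp_growth[of "\<lambda>t. - f t" "\<lambda>t. - f' t" c 0 t] der le t
  by (auto intro!: derivative_eq_intros)

lemma trajectory_continuous_on:
  "trajectory X S I \<gamma> \<Longrightarrow> continuous_on I \<gamma>"
  unfolding trajectory_def continuous_on_eq_continuous_within
  by (blast intro: has_vector_derivative_continuous)

text \<open>
  Picard iteration on the whole half-line.  In the supremum norm with weight \<open>exp (- 2 K t)\<close> the
  integral operator contracts by the factor \<open>1/2\<close>, so that no continuation of local solutions is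
  needed.
\<close>

lemma lipschitz_trajectory_exists:
  fixes Y :: "'a::euclidean_space \<Rightarrow> 'a"
  assumes K: "0 < K" and lip: "\<And>x y. norm (Y x - Y y) \<le> K * norm (x - y)"
    and Y0: "Y 0 = 0"
  shows "\<exists>\<gamma>. trajectory Y UNIV {0..} \<gamma> \<and> \<gamma> 0 = y0"
proof -
  \<comment> \<open>Bounded continuous functions on the real line stand for functions on the half-line;
    the clamp \<open>p\<close> makes the integral operator ignore negative times.\<close>
  define p :: "real \<Rightarrow> real" where "p t = max 0 t" for t
  define f :: "(real \<Rightarrow>\<^sub>C 'a) \<Rightarrow> real \<Rightarrow> 'a" where "f u s = Y (exp (2 * K * s) *\<^sub>R apply_bcontfun u s)" for u s
  define I where "I u t = integral {0..t} (f u)" for u t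
  define Tf where "Tf u t = exp (- 2 * K * p t) *\<^sub>R (y0 + I u (p t))" for u t
  have Yc: "continuous_on S Y" for S
    by (rule lipschitz_on_continuous_on[of K])
       (use K lip in \<open>auto intro!: lipschitz_onI simp: dist_norm\<close>)
  have fc: "continuous_on S (f u)" for u S
    unfolding f_def
    by (intro continuous_on_compose2[OF Yc[of UNIV]] continuous_intros) auto
  have Ider: "(I u has_vector_derivative f u t) (at t within {0..})" if "0 \<le> t" for u t
  proof -
    have "(I u has_vector_derivative f u t) (at t within {0..t+1})"
      unfolding I_def using that by (intro integral_has_vector_derivative fc) auto
    moreover have "at t within {0..t+1} = at t within {0..}"
      by (rule at_within_nhd[of _ "{..<t+1}"]) auto
    ultimately show ?thesis by simp
  qed
  have Ic: "continuous_on {0..} (I u)" for u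
    unfolding continuous_on_eq_continuous_within
    using Ider has_vector_derivative_continuous by fastforce
  have pc: "continuous_on UNIV p"
    unfolding p_def by (intro continuous_intros)
  have Tc: "continuous_on UNIV (Tf u)" for u
    unfolding Tf_def
    by (intro continuous_intros pc continuous_on_compose2[OF Ic pc]) (auto simp: p_def)
  have expint: "((\<lambda>s. K * exp (2 * K * s)) has_integral (exp (2 * K * t) - 1) / 2) {0..t}"
    if "0 \<le> t" for t
  proof -
    have "((\<lambda>s. K * exp (2 * K * s)) has_integral exp (2 * K * t) / 2 - exp (2 * K * 0) / 2) {0..t}"
      using that
      by (intro fundamental_theorem_of_calculus)
         (auto intro!: derivative_eq_intros simp flip: has_real_derivative_iff_has_vector_derivative)
    then show ?thesis by (simp add: diff_divide_distrib)
  qed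
  have ibound: "norm (integral {0..t} g) \<le> b * ((exp (2 * K * t) - 1) / 2)"
    if g: "continuous_on {0..t} g" and t: "0 \<le> t"
      and b: "\<And>s. 0 \<le> s \<Longrightarrow> norm (g s) \<le> K * (exp (2 * K * s) * b)" for g :: "real \<Rightarrow> 'a" and b t
  proof -
    have "((\<lambda>s. b * (K * exp (2 * K * s))) has_integral b * ((exp (2 * K * t) - 1) / 2)) {0..t}"
      by (intro has_integral_mult_right expint t)
    then have i: "(\<lambda>s. b * (K * exp (2 * K * s))) integrable_on {0..t}"
      "integral {0..t} (\<lambda>s. b * (K * exp (2 * K * s))) = b * ((exp (2 * K * t) - 1) / 2)"
      by (auto simp: has_integral_iff)
    have "norm (integral {0..t} g) \<le> integral {0..t} (\<lambda>s. b * (K * exp (2 * K * s)))"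
      by (rule integral_norm_bound_integral[OF integrable_continuous_real[OF g] i(1)])
         (use b in \<open>auto simp: mult_ac\<close>)
    then show ?thesis unfolding i(2) .
  qed
  have Tb: "norm (Tf u t) \<le> norm y0 + norm u" for u t
  proof -
    have "norm (I u (p t)) \<le> norm u * ((exp (2 * K * p t) - 1) / 2)"
      unfolding I_def
    proof (rule ibound[OF fc])
      fix s :: real assume "0 \<le> s"
      have "norm (f u s) \<le> K * norm (exp (2 * K * s) *\<^sub>R apply_bcontfun u s)"
        unfolding f_def using lip[of "exp (2 * K * s) *\<^sub>R apply_bcontfun u s" 0] Y0 by simp
      also have "\<dots> \<le> K * (exp (2 * K * s) * norm u)"
        using K norm_bounded[of u s] by (intro mult_left_mono) auto
      finally show "norm (f u s) \<le> K * (exp (2 * K * s) * norm u)" .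
    qed (auto simp: p_def)
    also have "\<dots> \<le> norm u * exp (2 * K * p t)"
    proof (rule mult_left_mono)
      have "(e - 1) / 2 \<le> e" if "0 < e" for e :: real
        using that by simp
      then show "(exp (2 * K * p t) - 1) / 2 \<le> exp (2 * K * p t)"
        using exp_gt_zero by blast
    qed simp
    finally have "norm (y0 + I u (p t)) \<le> norm y0 * exp (2 * K * p t) + norm u * exp (2 * K * p t)"
      using norm_triangle_ineq[of y0 "I u (p t)"] K
        mult_left_mono[of 1 "exp (2 * K * p t)" "norm y0"] by (simp add: p_def)
    then have "exp (- 2 * K * p t) * norm (y0 + I u (p t))
      \<le> exp (- 2 * K * p t) * (norm y0 * exp (2 * K * p t) + norm u * exp (2 * K * p t))"
      by (intro mult_left_mono) auto
    also have "\<dots> = norm y0 + norm u"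
      by (simp add: algebra_simps flip: exp_add)
    finally show ?thesis by (simp add: Tf_def)
  qed
  define T where "T u = Bcontfun (Tf u)" for u
  have Tap: "apply_bcontfun (T u) = Tf u" for u
    unfolding T_def
    by (rule Bcontfun_inverse) (rule bcontfun_normI[OF Tc Tb])
  have contr: "dist (T u) (T v) \<le> 1/2 * dist u v" for u v
  proof (rule dist_bound)
    fix t
    have "I u (p t) - I v (p t) = integral {0..p t} (\<lambda>s. f u s - f v s)"
      unfolding I_def by (intro integral_diff[symmetric] integrable_continuous_real fc)
    moreover have "norm (integral {0..p t} (\<lambda>s. f u s - f v s)) \<le> dist u v * ((exp (2 * K * p t) - 1) / 2)"
    proof (rule ibound)
      fix s :: real assume "0 \<le> s"
      have "norm (f u s - f v s) \<le> K * (exp (2 * K * s) * norm (apply_bcontfun u s - apply_bcontfun v s))"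
        unfolding f_def using lip by (metis abs_exp_cancel norm_scaleR scaleR_diff_right)
      also have "\<dots> \<le> K * (exp (2 * K * s) * dist u v)"
        using K dist_bounded[of u s v] by (intro mult_left_mono) (auto simp: dist_norm)
      finally show "norm (f u s - f v s) \<le> K * (exp (2 * K * s) * dist u v)" .
    qed (auto simp: p_def intro!: continuous_intros fc)
    ultimately have "norm (I u (p t) - I v (p t)) \<le> dist u v * (exp (2 * K * p t) / 2)"
      using mult_left_mono[of "(exp (2 * K * p t) - 1) / 2" "exp (2 * K * p t) / 2" "dist u v"] by simp
    then have "exp (- 2 * K * p t) * norm (I u (p t) - I v (p t))
      \<le> exp (- 2 * K * p t) * (dist u v * (exp (2 * K * p t) / 2))"
      by (intro mult_left_mono) auto
    also have "\<dots> = 1/2 * dist u v"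
      by (simp flip: exp_add)
    finally have "norm (exp (- 2 * K * p t) *\<^sub>R (I u (p t) - I v (p t))) \<le> 1/2 * dist u v" by simp
    then show "dist (apply_bcontfun (T u) t) (apply_bcontfun (T v) t) \<le> 1/2 * dist u v"
      unfolding Tap Tf_def dist_norm by (simp add: algebra_simps)
  qed
  obtain u where u: "T u = u"
    using banach_fix_type[of "1/2" T] contr by auto
  define \<gamma> where "\<gamma> t = y0 + I u t" for t
  have g: "exp (2 * K * t) *\<^sub>R apply_bcontfun u t = \<gamma> t" if "0 \<le> t" for t
  proof -
    have "apply_bcontfun u t = exp (- 2 * K * t) *\<^sub>R \<gamma> t"
      using that by (subst u[symmetric]) (simp add: Tap Tf_def p_def \<gamma>_def)
    then show ?thesis by (simp flip: exp_add)
  qed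
  have "trajectory Y UNIV {0..} \<gamma>"
    unfolding trajectory_def
  proof (intro ballI conjI)
    fix t :: real assume "t \<in> {0..}"
    then have "(I u has_vector_derivative Y (\<gamma> t)) (at t within {0..})"
      using Ider[of t u] g[of t] by (simp add: f_def)
    then show "(\<gamma> has_vector_derivative Y (\<gamma> t)) (at t within {0..})"
      unfolding \<gamma>_def has_vector_derivative_def by (auto intro!: derivative_eq_intros)
  qed auto
  moreover have "\<gamma> 0 = y0" by (simp add: \<gamma>_def I_def)
  ultimately show ?thesis by blast
qed

text \<open>
  The Gronwall estimate for the difference of two trajectories, applied to its squared norm.
\<close>

lemma lipschitz_trajectory_dependence:
  fixes Y :: "'a::real_inner \<Rightarrow> 'a"
  assumes lip: "\<And>x y. norm (Y x - Y y) \<le> K * norm (x - y)"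
    and g: "trajectory Y S {0..} \<gamma>" and d: "trajectory Y S' {0..} \<delta>" and t: "0 \<le> t"
  shows "norm (\<gamma> t - \<delta> t) \<le> norm (\<gamma> 0 - \<delta> 0) * exp (K * t)"
proof -
  let ?D = "\<lambda>t. \<gamma> t - \<delta> t"
  let ?E = "\<lambda>t. Y (\<gamma> t) - Y (\<delta> t)"
  have "(?D has_vector_derivative ?E t) (at t within {0..})" if "0 \<le> t" for t
    using g d that unfolding trajectory_def by (auto intro!: has_vector_derivative_diff)
  then have "((\<lambda>t. ?D t \<bullet> ?D t) has_real_derivative 2 * (?D t \<bullet> ?E t)) (at t within {0..})" if "0 \<le> t" for t
    using bounded_bilinear.has_vector_derivative[OF bounded_bilinear_inner, of ?D "?E t" t "{0..}" ?D "?E t"] that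
    by (simp add: has_real_derivative_iff_has_vector_derivative inner_commute)
  moreover have "2 * (?D t \<bullet> ?E t) \<le> 2 * K * (?D t \<bullet> ?D t)" if "0 \<le> t" for t
  proof -
    have "?D t \<bullet> ?E t \<le> norm (?D t) * norm (?E t)" by (rule norm_cauchy_schwarz)
    also have "\<dots> \<le> norm (?D t) * (K * norm (?D t))" by (intro mult_left_mono lip) auto
    finally show ?thesis by (simp add: power2_norm_eq_inner[symmetric] power2_eq_square algebra_simps)
  qed
  ultimately have "?D t \<bullet> ?D t \<le> (?D 0 \<bullet> ?D 0) * exp (2 * K * t)"
    using t by (rule exp_decay)
  also have "\<dots> = (norm (?D 0) * exp (K * t))\<^sup>2"
    using exp_double[of "K * t"] by (simp add: power2_norm_eq_inner power_mult_distrib mult.assoc)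
  finally have "(norm (?D t))\<^sup>2 \<le> (norm (?D 0) * exp (K * t))\<^sup>2"
    by (simp only: power2_norm_eq_inner)
  then show ?thesis by (rule power2_le_imp_le) simp
qed

section \<open>Strict differentiability\<close>

text \<open>
  Strict derivatives: the remainder of the linear part is not only small but Lipschitz with an
  arbitrarily small constant near the point.  This is what a perturbation argument for flows
  requires, and unlike continuous differentiability it is a condition at a single point, closed under
  the chain rule, so that the derivative has to be computed at the equilibrium only.
\<close>

definition has_strict_derivative ::
  "('a::real_normed_vector \<Rightarrow> 'b::real_normed_vector) \<Rightarrow> ('a \<Rightarrow> 'b) \<Rightarrow> 'a \<Rightarrow> bool" where
  "has_strict_derivative f L p \<longleftrightarrow> bounded_linear L \<and>
     (\<forall>e>0. \<forall>\<^sub>F z in nhds (p, p).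
        norm (f (fst z) - f (snd z) - L (fst z - snd z)) \<le> e * norm (fst z - snd z))"

lemma has_strict_derivative_bounded_linear:
  "has_strict_derivative f L p \<Longrightarrow> bounded_linear L"
  by (simp add: has_strict_derivative_def)

lemma has_strict_derivative_remainder:
  assumes "has_strict_derivative f L p" "0 < e"
  obtains d where "0 < d" "\<And>x y. x \<in> cball p d \<Longrightarrow> y \<in> cball p d \<Longrightarrow>
    norm (f x - f y - L (x - y)) \<le> e * norm (x - y)"
proof -
  obtain P where P: "eventually P (nhds p)"
    "\<And>x y. P x \<Longrightarrow> P y \<Longrightarrow> norm (f x - f y - L (x - y)) \<le> e * norm (x - y)"
    using assms unfolding has_strict_derivative_def nhds_prod eventually_prod_same by fastforce
  obtain d where "0 < d" "\<And>x. dist x p < d \<Longrightarrow> P x"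
    using P(1) unfolding eventually_nhds_metric by blast
  then show ?thesis
    using P(2) by (intro that[of "d/2"]) (auto simp: dist_commute)
qed

lemma has_strict_derivative_imp_has_derivative:
  assumes "has_strict_derivative f L p"
  shows "(f has_derivative L) (at p)"
  unfolding has_derivative_at_alt
proof (intro conjI allI impI)
  fix e :: real assume "0 < e"
  obtain d where d: "0 < d" "\<And>x y. x \<in> cball p d \<Longrightarrow> y \<in> cball p d \<Longrightarrow>
      norm (f x - f y - L (x - y)) \<le> e * norm (x - y)"
    using has_strict_derivative_remainder[OF assms \<open>0 < e\<close>] by blast
  then show "\<exists>d>0. \<forall>y. norm (y - p) < d \<longrightarrow> norm (f y - f p - L (y - p)) \<le> e * norm (y - p)"
    by (intro exI[of _ d]) (auto simp: dist_norm norm_minus_commute)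
qed (use assms in \<open>simp add: has_strict_derivative_def\<close>)

lemma has_strict_derivative_frechet:
  "has_strict_derivative f L p \<Longrightarrow> frechet_derivative f (at p) = L"
  using has_strict_derivative_imp_has_derivative frechet_derivative_at by metis

lemma has_strict_derivative_continuous:
  "has_strict_derivative f L p \<Longrightarrow> isCont f p"
  using has_strict_derivative_imp_has_derivative has_derivative_continuous by blast

lemma has_strict_derivative_lipschitz:
  assumes "has_strict_derivative f L p"
  obtains C where "0 < C"
    "\<forall>\<^sub>F z in nhds (p, p). norm (f (fst z) - f (snd z)) \<le> C * norm (fst z - snd z)"
proof -
  obtain B where B: "0 < B" "\<And>x. norm (L x) \<le> norm x * B"
    using bounded_linear.pos_bounded[of L] assms by (auto simp: has_strict_derivative_def)
  have "\<forall>\<^sub>F z in nhds (p, p). norm (f (fst z) - f (snd z) - L (fst z - snd z)) \<le> 1 * norm (fst z - snd z)"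
    using assms unfolding has_strict_derivative_def by (meson zero_less_one)
  then have "\<forall>\<^sub>F z in nhds (p, p). norm (f (fst z) - f (snd z)) \<le> (B + 1) * norm (fst z - snd z)"
  proof eventually_elim
    case (elim z)
    have "norm (f (fst z) - f (snd z)) \<le> norm (f (fst z) - f (snd z) - L (fst z - snd z)) + norm (L (fst z - snd z))"
      by (metis add.commute diff_add_cancel norm_triangle_ineq)
    then show ?case using elim B(2)[of "fst z - snd z"] by (simp add: algebra_simps)
  qed
  then show ?thesis using B(1) by (intro that[of "B + 1"]) auto
qed

lemma has_strict_derivative_linear:
  "bounded_linear f \<Longrightarrow> has_strict_derivative f f p"
  by (simp add: has_strict_derivative_def bounded_linear.linear linear_diff)

lemma has_strict_derivative_const: "has_strict_derivative (\<lambda>x. a) (\<lambda>h. 0) p"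
  by (simp add: has_strict_derivative_def)

lemma has_strict_derivative_add:
  assumes f: "has_strict_derivative f L p" and g: "has_strict_derivative g M p"
  shows "has_strict_derivative (\<lambda>x. f x + g x) (\<lambda>h. L h + M h) p"
  unfolding has_strict_derivative_def
proof (intro conjI allI impI)
  show "bounded_linear (\<lambda>h. L h + M h)"
    using f g by (simp add: has_strict_derivative_def bounded_linear_add)
  fix e :: real assume e: "0 < e"
  have "\<forall>\<^sub>F z in nhds (p, p). norm (f (fst z) - f (snd z) - L (fst z - snd z)) \<le> e/2 * norm (fst z - snd z)"
    "\<forall>\<^sub>F z in nhds (p, p). norm (g (fst z) - g (snd z) - M (fst z - snd z)) \<le> e/2 * norm (fst z - snd z)"
    using f g half_gt_zero[OF e] unfolding has_strict_derivative_def by blast+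
  then show "\<forall>\<^sub>F z in nhds (p, p). norm (f (fst z) + g (fst z) - (f (snd z) + g (snd z)) -
      (L (fst z - snd z) + M (fst z - snd z))) \<le> e * norm (fst z - snd z)"
  proof eventually_elim
    case (elim z)
    then show ?case
      using norm_triangle_ineq[of "f (fst z) - f (snd z) - L (fst z - snd z)"
          "g (fst z) - g (snd z) - M (fst z - snd z)"] by (simp add: algebra_simps)
  qed
qed

lemma has_strict_derivative_chain:
  assumes f: "has_strict_derivative f L p" and g: "has_strict_derivative g M (f p)"
  shows "has_strict_derivative (\<lambda>x. g (f x)) (\<lambda>h. M (L h)) p"
  unfolding has_strict_derivative_def
proof (intro conjI allI impI)
  show "bounded_linear (\<lambda>h. M (L h))"
    using f g unfolding has_strict_derivative_def by (metis bounded_linear_compose)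
  fix e :: real assume e: "0 < e"
  obtain C where C: "0 < C"
    "\<forall>\<^sub>F z in nhds (p, p). norm (f (fst z) - f (snd z)) \<le> C * norm (fst z - snd z)"
    using has_strict_derivative_lipschitz[OF f] by blast
  have "bounded_linear M" using g by (simp add: has_strict_derivative_def)
  then obtain B where B: "0 < B" "\<And>x. norm (M x) \<le> norm x * B"
    using bounded_linear.pos_bounded[of M] by auto
  have "0 < e / (2 * C)" "0 < e / (2 * B)" using e B C by auto
  then have 1: "\<forall>\<^sub>F z in nhds (p, p). norm (f (fst z) - f (snd z) - L (fst z - snd z)) \<le> e / (2 * B) * norm (fst z - snd z)"
    and 2: "\<forall>\<^sub>F z in nhds (f p, f p). norm (g (fst z) - g (snd z) - M (fst z - snd z)) \<le> e / (2 * C) * norm (fst z - snd z)"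
    using f g unfolding has_strict_derivative_def by blast+
  have fp: "((\<lambda>z. (f (fst z), f (snd z))) \<longlongrightarrow> (f p, f p)) (nhds (p, p))"
  proof -
    have "isCont (\<lambda>z. (f (fst z), f (snd z))) (p, p)"
      using has_strict_derivative_continuous[OF f]
      by (intro continuous_Pair isCont_o2[OF isCont_fst] isCont_o2[OF isCont_snd]) auto
    then show ?thesis
      unfolding isCont_def using tendsto_at_iff_tendsto_nhds[of "\<lambda>z. (f (fst z), f (snd z))" "(p, p)"] by simp
  qed
  have "\<forall>\<^sub>F z in nhds (p, p). norm (g (f (fst z)) - g (f (snd z)) - M (f (fst z) - f (snd z)))
       \<le> e / (2 * C) * norm (f (fst z) - f (snd z))"
    using eventually_compose_filterlim[OF 2 fp] by simp
  with 1 C(2) show "\<forall>\<^sub>F z in nhds (p, p). norm (g (f (fst z)) - g (f (snd z)) -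
      M (L (fst z - snd z))) \<le> e * norm (fst z - snd z)"
  proof eventually_elim
    case (elim z)
    let ?h = "fst z - snd z" and ?k = "f (fst z) - f (snd z)"
    have "M (?k - L ?h) = M ?k - M (L ?h)"
      using \<open>bounded_linear M\<close> by (simp add: bounded_linear.linear linear_diff)
    then have "norm (g (f (fst z)) - g (f (snd z)) - M (L ?h))
        \<le> norm (g (f (fst z)) - g (f (snd z)) - M ?k) + norm (M (?k - L ?h))"
      using norm_triangle_ineq[of "g (f (fst z)) - g (f (snd z)) - M ?k" "M (?k - L ?h)"] by simp
    also have "\<dots> \<le> e / (2 * C) * norm ?k + norm (?k - L ?h) * B"
      using elim B(2) by (intro add_mono) auto
    also have "\<dots> \<le> e / (2 * C) * (C * norm ?h) + (e / (2 * B) * norm ?h) * B"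
      using elim B(1) C(1) e by (intro add_mono mult_left_mono mult_right_mono) auto
    also have "\<dots> = e * norm ?h" using B C by (simp add: field_simps)
    finally show ?case .
  qed
qed

lemma has_strict_derivative_Pair:
  assumes f: "has_strict_derivative f L p" and g: "has_strict_derivative g M p"
  shows "has_strict_derivative (\<lambda>x. (f x, g x)) (\<lambda>h. (L h, M h)) p"
proof -
  have i: "bounded_linear (\<lambda>a :: 'b. (a, 0 :: 'c))" "bounded_linear (\<lambda>b :: 'c. (0 :: 'b, b))"
    by (intro bounded_linear_Pair bounded_linear_ident bounded_linear_zero)+
  show ?thesis
    using has_strict_derivative_add[OF
        has_strict_derivative_chain[OF f has_strict_derivative_linear[OF i(1)]]
        has_strict_derivative_chain[OF g has_strict_derivative_linear[OF i(2)]]]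
    by simp
qed

text \<open>
  From \<open>x y - x' y' - a (y - y') - (x - x') b = (x - a) (y - y') + (x - x') (y' - b)\<close>.  The product
  rule follows by composition.
\<close>

lemma has_strict_derivative_times:
  "has_strict_derivative (\<lambda>x. fst x * snd x) (\<lambda>h. a * snd h + fst h * b) (a, b :: real)"
  unfolding has_strict_derivative_def
proof (intro conjI allI impI)
  show "bounded_linear (\<lambda>h. a * snd h + fst h * b)"
    by (intro bounded_linear_add bounded_linear_mult_const bounded_linear_const_mult
        bounded_linear_fst bounded_linear_snd)
  fix e :: real assume e: "0 < e"
  have "\<forall>\<^sub>F z in nhds ((a,b),(a,b)). dist z ((a,b),(a,b)) < e / 2"
    using e unfolding eventually_nhds_metric by (intro exI[of _ "e/2"]) simp
  then show "\<forall>\<^sub>F z in nhds ((a, b), a, b). norm (fst (fst z) * snd (fst z) - fst (snd z) * snd (snd z) -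
      (a * snd (fst z - snd z) + fst (fst z - snd z) * b)) \<le> e * norm (fst z - snd z)"
  proof eventually_elim
    case (elim z)
    obtain x y x' y' where z: "z = ((x, y), (x', y'))" by (metis prod.collapse)
    have "dist x a \<le> dist z ((a,b),(a,b))"
      using dist_fst_le[of "(x,y)" "(a,b)"] dist_fst_le[of z "((a,b),(a,b))"] unfolding z by simp
    moreover have "dist y' b \<le> dist z ((a,b),(a,b))"
      using dist_snd_le[of "(x',y')" "(a,b)"] dist_snd_le[of z "((a,b),(a,b))"] unfolding z by simp
    ultimately have d: "\<bar>x - a\<bar> \<le> e/2" "\<bar>y' - b\<bar> \<le> e/2" using elim by (auto simp: dist_real_def)
    have n: "\<bar>x - x'\<bar> \<le> norm (fst z - snd z)" "\<bar>y - y'\<bar> \<le> norm (fst z - snd z)"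
      unfolding z using norm_fst_le[of "x-x'" "y-y'"] norm_snd_le[of "y-y'" "x-x'"] by auto
    have "x * y - x' * y' - (a * (y - y') + (x - x') * b) = (x - a) * (y - y') + (x - x') * (y' - b)"
      by (simp add: algebra_simps)
    also have "\<bar>\<dots>\<bar> \<le> \<bar>x - a\<bar> * \<bar>y - y'\<bar> + \<bar>x - x'\<bar> * \<bar>y' - b\<bar>"
      using abs_triangle_ineq[of "(x - a) * (y - y')" "(x - x') * (y' - b)"] by (simp add: abs_mult)
    also have "\<dots> \<le> e/2 * norm (fst z - snd z) + norm (fst z - snd z) * (e/2)"
      using d n e by (intro add_mono mult_mono) auto
    finally show ?case by (simp add: z)
  qed
qed

lemma has_strict_derivative_mult:
  fixes f g :: "'a::real_normed_vector \<Rightarrow> real"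
  assumes f: "has_strict_derivative f L p" and g: "has_strict_derivative g M p"
  shows "has_strict_derivative (\<lambda>x. f x * g x) (\<lambda>h. f p * M h + L h * g p) p"
  using has_strict_derivative_chain[OF has_strict_derivative_Pair[OF f g] has_strict_derivative_times]
  by simp

lemma has_strict_derivative_minus:
  fixes f :: "'a::real_normed_vector \<Rightarrow> real"
  assumes f: "has_strict_derivative f L p"
  shows "has_strict_derivative (\<lambda>x. - f x) (\<lambda>h. - L h) p"
  using has_strict_derivative_mult[OF has_strict_derivative_const f, of "-1"] by simp

lemma has_strict_derivative_diff:
  fixes f g :: "'a::real_normed_vector \<Rightarrow> real"
  assumes f: "has_strict_derivative f L p" and g: "has_strict_derivative g M p"
  shows "has_strict_derivative (\<lambda>x. f x - g x) (\<lambda>h. L h - M h) p"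
  using has_strict_derivative_add[OF f has_strict_derivative_minus[OF g]] by simp

text \<open>
  The mean value theorem for \<open>f - f'(p) \<cdot>\<close> on a ball where \<open>f'\<close> differs little from \<open>f' p\<close>.
\<close>

lemma has_strict_derivative_real:
  fixes f :: "real \<Rightarrow> real"
  assumes der: "\<forall>\<^sub>F x in nhds p. (f has_real_derivative f' x) (at x)" and cont: "isCont f' p"
  shows "has_strict_derivative f (\<lambda>h. f' p * h) p"
  unfolding has_strict_derivative_def
proof (intro conjI allI impI)
  show "bounded_linear (\<lambda>h. f' p * h)" by (rule bounded_linear_mult_right)
  fix e :: real assume e: "0 < e"
  have "(f' \<longlongrightarrow> f' p) (nhds p)"
    using cont by (simp add: isCont_def tendsto_at_iff_tendsto_nhds)
  then have "\<forall>\<^sub>F x in nhds p. dist (f' x) (f' p) < e" using e by (rule tendstoD)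
  then have "\<forall>\<^sub>F x in nhds p. (f has_real_derivative f' x) (at x) \<and> dist (f' x) (f' p) < e"
    using der by eventually_elim simp
  then obtain d where d: "0 < d" "\<And>x. dist x p < d \<Longrightarrow> (f has_real_derivative f' x) (at x)"
    "\<And>x. dist x p < d \<Longrightarrow> \<bar>f' x - f' p\<bar> \<le> e"
    unfolding eventually_nhds_metric dist_real_def by (auto intro: less_imp_le)
  have bd: "norm (f x - f y - f' p * (x - y)) \<le> e * norm (x - y)" if "dist x p < d" "dist y p < d" for x y
  proof -
    have "norm ((\<lambda>x. f x - f' p * x) x - (\<lambda>x. f x - f' p * x) y) \<le> e * norm (x - y)"
    proof (rule field_differentiable_bound[of "ball p d" _ "\<lambda>x. f' x - f' p"])
      fix z assume "z \<in> ball p d"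
      then have "dist z p < d" by (simp add: dist_commute)
      then show "((\<lambda>x. f x - f' p * x) has_field_derivative f' z - f' p) (at z within ball p d)"
        using d(2)[THEN has_field_derivative_at_within] by (auto intro!: derivative_eq_intros)
      show "norm (f' z - f' p) \<le> e" using d(3) \<open>dist z p < d\<close> by simp
    qed (use that in \<open>auto simp: dist_commute\<close>)
    then show ?thesis by (simp add: algebra_simps)
  qed
  have "\<forall>\<^sub>F x in nhds p. dist x p < d" using d(1) by (auto simp: eventually_nhds_metric)
  then show "\<forall>\<^sub>F z in nhds (p, p). norm (f (fst z) - f (snd z) - f' p * (fst z - snd z)) \<le> e * norm (fst z - snd z)"
    unfolding nhds_prod eventually_prod_same using bd by (intro exI[of _ "\<lambda>x. dist x p < d"]) auto
qed

section \<open>Vector fields with an expanding direction\<close>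

text \<open>
  In \<open>(x, z)\<close> the real component \<open>z\<close> expands and \<open>x\<close> contracts.  The assumption \<open>cone\<close> says that
  \<open>z\<^sup>2 - |x|\<^sup>2\<close>, evaluated on the difference of two trajectories, has derivative at least
  \<open>2 c\<close> times the squared norm of that difference.
\<close>

locale cone_field =
  fixes Y :: "'u::euclidean_space \<times> real \<Rightarrow> 'u \<times> real" and K c :: real
  assumes K_pos: "0 < K" and c_pos: "0 < c"
    and lip: "norm (Y x - Y y) \<le> K * norm (x - y)"
    and zero: "Y 0 = 0"
    and cone: "c * (norm (x - y))\<^sup>2 \<le> snd (x - y) * snd (Y x - Y y) - fst (x - y) \<bullet> fst (Y x - Y y)"
    and contracting: "\<bar>snd x\<bar> \<le> norm (fst x) \<Longrightarrow> fst x \<bullet> fst (Y x) \<le> - c * (norm (fst x))\<^sup>2"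
begin

lemma has_real_derivative_fst_square:
  fixes \<gamma> :: "real \<Rightarrow> 'u \<times> real"
  assumes "(\<gamma> has_vector_derivative d) (at t within T)"
  shows "((\<lambda>t. (norm (fst (\<gamma> t)))\<^sup>2) has_real_derivative 2 * (fst (\<gamma> t) \<bullet> fst d)) (at t within T)"
proof -
  have "((\<lambda>t. fst (\<gamma> t)) has_vector_derivative fst d) (at t within T)"
    using bounded_linear.has_vector_derivative[OF bounded_linear_fst assms] .
  from bounded_bilinear.has_vector_derivative[OF bounded_bilinear_inner this this]
  show ?thesis
    by (simp add: has_real_derivative_iff_has_vector_derivative inner_commute power2_norm_eq_inner)
qed

lemma has_real_derivative_snd_square:
  fixes \<gamma> :: "real \<Rightarrow> 'u \<times> real"
  assumes "(\<gamma> has_vector_derivative d) (at t within T)"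
  shows "((\<lambda>t. (snd (\<gamma> t))\<^sup>2) has_real_derivative 2 * (snd (\<gamma> t) * snd d)) (at t within T)"
proof -
  have "((\<lambda>t. snd (\<gamma> t)) has_real_derivative snd d) (at t within T)"
    using bounded_linear.has_vector_derivative[OF bounded_linear_snd assms]
    by (simp add: has_real_derivative_iff_has_vector_derivative)
  then show ?thesis
    by (auto intro!: derivative_eq_intros)
qed

definition cone_form :: "'u \<times> real \<Rightarrow> real" where
  "cone_form x = (snd x)\<^sup>2 - (norm (fst x))\<^sup>2"

lemma cone_form_growth:
  assumes g: "trajectory Y S {0..} \<gamma>" and d: "trajectory Y S' {0..} \<delta>" and st: "0 \<le> s" "s \<le> t"
  shows "cone_form (\<gamma> s - \<delta> s) * exp (2 * c * (t - s)) \<le> cone_form (\<gamma> t - \<delta> t)"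
proof (rule exp_growth[OF _ _ st])
  fix t :: real assume t: "0 \<le> t"
  have "((\<lambda>t. \<gamma> t - \<delta> t) has_vector_derivative Y (\<gamma> t) - Y (\<delta> t)) (at t within {0..})"
    using g d t unfolding trajectory_def by (auto intro!: has_vector_derivative_diff)
  then show "((\<lambda>t. cone_form (\<gamma> t - \<delta> t)) has_real_derivative
      2 * (snd (\<gamma> t - \<delta> t) * snd (Y (\<gamma> t) - Y (\<delta> t)))
      - 2 * (fst (\<gamma> t - \<delta> t) \<bullet> fst (Y (\<gamma> t) - Y (\<delta> t)))) (at t within {0..})"
    unfolding cone_form_def
    by (intro DERIV_diff has_real_derivative_snd_square has_real_derivative_fst_square)
  have "cone_form x \<le> (norm x)\<^sup>2" for x
    unfolding cone_form_def norm_prod_def by simp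
  then have "c * cone_form (\<gamma> t - \<delta> t) \<le> c * (norm (\<gamma> t - \<delta> t))\<^sup>2"
    using c_pos by (intro mult_left_mono) auto
  then show "2 * c * cone_form (\<gamma> t - \<delta> t) \<le>
      2 * (snd (\<gamma> t - \<delta> t) * snd (Y (\<gamma> t) - Y (\<delta> t)))
      - 2 * (fst (\<gamma> t - \<delta> t) \<bullet> fst (Y (\<gamma> t) - Y (\<delta> t)))"
    using cone[of "\<gamma> t" "\<delta> t"] by linarith
qed

text \<open>
  If the form were positive at time \<open>0\<close> it would grow exponentially, and the trajectories would
  separate without bound.  For equal \<open>fst\<close> the statement is uniqueness of the bounded trajectory.
\<close>

lemma bounded_trajectories_in_cone:
  assumes g: "trajectory Y S {0..} \<gamma>" "bounded (\<gamma> ` {0..})"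
    and d: "trajectory Y S' {0..} \<delta>" "bounded (\<delta> ` {0..})"
  shows "\<bar>snd (\<gamma> 0) - snd (\<delta> 0)\<bar> \<le> norm (fst (\<gamma> 0) - fst (\<delta> 0))"
proof -
  have "cone_form (\<gamma> 0 - \<delta> 0) \<le> 0"
  proof (rule ccontr)
    assume "\<not> ?thesis"
    then have q: "0 < cone_form (\<gamma> 0 - \<delta> 0)" by simp
    obtain a b where a: "\<And>t. 0 \<le> t \<Longrightarrow> norm (\<gamma> t) \<le> a" and b: "\<And>t. 0 \<le> t \<Longrightarrow> norm (\<delta> t) \<le> b"
      using g d unfolding bounded_iff by auto
    \<comment> \<open>By this time the lower bound for the form exceeds \<open>(a + b)\<^sup>2\<close>.\<close>
    define t where "t = (a + b)\<^sup>2 / cone_form (\<gamma> 0 - \<delta> 0) / (2 * c)"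
    have t: "0 \<le> t" using q c_pos by (simp add: t_def)
    have "1 + 2 * c * t \<le> exp (2 * c * t)" by (rule exp_ge_add_one_self)
    then have "cone_form (\<gamma> 0 - \<delta> 0) * (1 + 2 * c * t) \<le> cone_form (\<gamma> 0 - \<delta> 0) * exp (2 * c * t)"
      using q by (intro mult_left_mono) auto
    also have "\<dots> \<le> cone_form (\<gamma> t - \<delta> t)"
      using cone_form_growth[OF g(1) d(1), of 0 t] t by simp
    also have "\<dots> \<le> (norm (\<gamma> t - \<delta> t))\<^sup>2"
      unfolding cone_form_def norm_prod_def by simp
    also have "\<dots> \<le> (a + b)\<^sup>2"
      using a[OF t] b[OF t] norm_triangle_ineq4[of "\<gamma> t" "\<delta> t"] by (intro power_mono) auto
    finally show False using q c_pos by (simp add: t_def distrib_left)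
  qed
  then have "\<bar>snd (\<gamma> 0 - \<delta> 0)\<bar> \<le> \<bar>norm (fst (\<gamma> 0 - \<delta> 0))\<bar>"
    unfolding cone_form_def abs_le_square_iff by simp
  then show ?thesis by simp
qed

lemma trajectory_zero: "trajectory Y UNIV {0..} (\<lambda>t. 0)"
  by (auto simp: trajectory_def zero)

text \<open>
  The upper (\<open>\<sigma> = 1\<close>) and the lower (\<open>\<sigma> = - 1\<close>) half of the cone around the expanding axis are
  forward invariant: the form stays positive, so that the sign of \<open>z\<close> cannot change.
\<close>

lemma escaping_cone_invariant:
  assumes g: "trajectory Y UNIV {0..} \<gamma>" and \<sigma>: "\<sigma>\<^sup>2 = 1"
    and s: "0 \<le> s" "norm (fst (\<gamma> s)) < \<sigma> * snd (\<gamma> s)" and t: "s \<le> t"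
  shows "norm (fst (\<gamma> t)) < \<sigma> * snd (\<gamma> t)"
proof -
  have "(norm (fst (\<gamma> s)))\<^sup>2 < (\<sigma> * snd (\<gamma> s))\<^sup>2"
    using s(2) by (intro power_strict_mono) auto
  then have "0 < cone_form (\<gamma> s)"
    using \<sigma> by (simp add: cone_form_def power_mult_distrib)
  then have pos: "0 < cone_form (\<gamma> u)" if "s \<le> u" for u
    using cone_form_growth[OF g trajectory_zero s(1) that]
    by (smt (verit) diff_zero exp_gt_zero zero_less_mult_iff)
  have "0 < \<sigma> * snd (\<gamma> t)"
  proof (rule ccontr)
    assume "\<not> ?thesis"
    moreover have "0 \<le> \<sigma> * snd (\<gamma> s)" using s(2) norm_ge_zero less_imp_le order_trans by blast
    moreover have "continuous_on {s..t} (\<lambda>t. \<sigma> * snd (\<gamma> t))"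
      using continuous_on_subset[OF trajectory_continuous_on[OF g]] s(1)
      by (intro continuous_intros) auto
    ultimately obtain u where "s \<le> u" "\<sigma> * snd (\<gamma> u) = 0"
      using IVT2'[of "\<lambda>t. \<sigma> * snd (\<gamma> t)" t 0 s] t by auto
    then show False using pos[of u] \<sigma> by (auto simp: cone_form_def)
  qed
  moreover have "(norm (fst (\<gamma> t)))\<^sup>2 < (\<sigma> * snd (\<gamma> t))\<^sup>2"
    using pos[OF t] \<sigma> by (simp add: cone_form_def power_mult_distrib)
  ultimately show ?thesis by (meson less_imp_le power2_less_imp_less)
qed

text \<open>
  Shooting: the heights \<open>z\<close> whose trajectories enter the upper, respectively the lower half of the
  cone form two nonempty disjoint open sets, which cannot exhaust the line.
\<close>

lemma trajectory_in_cone_exists: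
  "\<exists>z \<gamma>. trajectory Y UNIV {0..} \<gamma> \<and> \<gamma> 0 = (x, z) \<and> (\<forall>t\<ge>0. \<bar>snd (\<gamma> t)\<bar> \<le> norm (fst (\<gamma> t)))"
proof -
  have "\<forall>z. \<exists>\<gamma>. trajectory Y UNIV {0..} \<gamma> \<and> \<gamma> 0 = (x, z)"
    using lipschitz_trajectory_exists[OF K_pos lip zero] by blast
  then obtain \<Gamma> where \<Gamma>: "\<And>z. trajectory Y UNIV {0..} (\<Gamma> z)" "\<And>z. \<Gamma> z 0 = (x, z)"
    by metis
  define Z where "Z \<sigma> = (\<Union>t\<in>{0..}. {z. norm (fst (\<Gamma> z t)) < \<sigma> * snd (\<Gamma> z t)})" for \<sigma> :: real
  have cont: "continuous_on UNIV (\<lambda>z. \<Gamma> z t)" if "0 \<le> t" for t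
  proof (rule lipschitz_on_continuous_on[of "exp (K * t)"], rule lipschitz_onI)
    fix y z :: real
    have "norm ((x, y) - (x, z)) = \<bar>y - z\<bar>" by (simp add: norm_prod_def)
    then show "dist (\<Gamma> y t) (\<Gamma> z t) \<le> exp (K * t) * dist y z"
      using lipschitz_trajectory_dependence[OF lip \<Gamma>(1) \<Gamma>(1) that, of y z]
      by (simp add: dist_norm \<Gamma>(2) mult.commute)
  qed simp
  have "open (Z \<sigma>)" for \<sigma>
    unfolding Z_def by (intro open_UN ballI open_Collect_less continuous_intros cont) auto
  moreover have "Z 1 \<inter> Z (-1) = {}"
  proof (rule ccontr)
    assume "Z 1 \<inter> Z (-1) \<noteq> {}"
    then obtain z s t where "0 \<le> s" "norm (fst (\<Gamma> z s)) < 1 * snd (\<Gamma> z s)"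
      "0 \<le> t" "norm (fst (\<Gamma> z t)) < - 1 * snd (\<Gamma> z t)"
      unfolding Z_def by auto
    then have "norm (fst (\<Gamma> z (max s t))) < 1 * snd (\<Gamma> z (max s t))"
      "norm (fst (\<Gamma> z (max s t))) < - 1 * snd (\<Gamma> z (max s t))"
      using escaping_cone_invariant[OF \<Gamma>(1), of 1 s z "max s t"]
        escaping_cone_invariant[OF \<Gamma>(1), of "-1" t z "max s t"] by auto
    then show False using norm_ge_zero[of "fst (\<Gamma> z (max s t))"] by linarith
  qed
  moreover have "norm x + 1 \<in> Z 1" "- (norm x + 1) \<in> Z (-1)"
    unfolding Z_def using \<Gamma>(2) by (auto intro!: bexI[of _ 0])
  ultimately have "Z 1 \<union> Z (-1) \<noteq> UNIV"
    using connectedD[OF connected_UNIV, of "Z 1" "Z (-1)"] by auto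
  then obtain z where "z \<notin> Z 1" "z \<notin> Z (-1)" by blast
  then have "\<forall>t\<ge>0. \<bar>snd (\<Gamma> z t)\<bar> \<le> norm (fst (\<Gamma> z t))"
    unfolding Z_def by (auto simp: abs_le_iff not_less)
  then show ?thesis using \<Gamma> by blast
qed

lemma trajectory_in_cone_decay:
  assumes g: "trajectory Y UNIV {0..} \<gamma>" and le: "\<forall>t\<ge>0. \<bar>snd (\<gamma> t)\<bar> \<le> norm (fst (\<gamma> t))" and t: "0 \<le> t"
  shows "norm (fst (\<gamma> t)) \<le> norm (fst (\<gamma> 0)) * exp (- c * t)"
proof -
  have "(norm (fst (\<gamma> t)))\<^sup>2 \<le> (norm (fst (\<gamma> 0)))\<^sup>2 * exp (- 2 * c * t)"
  proof (rule exp_decay[OF _ _ t])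
    fix t :: real assume t: "0 \<le> t"
    show "((\<lambda>t. (norm (fst (\<gamma> t)))\<^sup>2) has_real_derivative 2 * (fst (\<gamma> t) \<bullet> fst (Y (\<gamma> t)))) (at t within {0..})"
      using g t unfolding trajectory_def by (intro has_real_derivative_fst_square) auto
    show "2 * (fst (\<gamma> t) \<bullet> fst (Y (\<gamma> t))) \<le> - 2 * c * (norm (fst (\<gamma> t)))\<^sup>2"
      using contracting[of "\<gamma> t"] le t by simp
  qed
  also have "\<dots> = (norm (fst (\<gamma> 0)) * exp (- c * t))\<^sup>2"
    using exp_double[of "- c * t"] by (simp add: power_mult_distrib mult.assoc)
  finally show ?thesis by (rule power2_le_imp_le) simp
qed

lemma trajectory_in_cone_bounded:
  assumes g: "trajectory Y UNIV {0..} \<gamma>" and le: "\<forall>t\<ge>0. \<bar>snd (\<gamma> t)\<bar> \<le> norm (fst (\<gamma> t))" and t: "0 \<le> t"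
  shows "norm (fst (\<gamma> t)) \<le> norm (fst (\<gamma> 0))"
proof -
  have "norm (fst (\<gamma> 0)) * exp (- c * t) \<le> norm (fst (\<gamma> 0)) * 1"
    using c_pos t by (intro mult_left_mono) auto
  then show ?thesis using trajectory_in_cone_decay[OF assms] by simp
qed

lemma trajectory_in_cone_tendsto:
  assumes g: "trajectory Y UNIV {0..} \<gamma>" and le: "\<forall>t\<ge>0. \<bar>snd (\<gamma> t)\<bar> \<le> norm (fst (\<gamma> t))"
  shows "(\<gamma> \<longlongrightarrow> 0) at_top"
proof -
  have "((\<lambda>t. exp (- (c * t))) \<longlongrightarrow> 0) at_top"
    using c_pos by (auto intro!: filterlim_compose[OF exp_at_bot] filterlim_tendsto_pos_mult_at_top[OF tendsto_const] filterlim_ident simp: filterlim_uminus_at_bot)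
  then have lim: "((\<lambda>t. 2 * norm (fst (\<gamma> 0)) * exp (- c * t)) \<longlongrightarrow> 0) at_top"
    using tendsto_mult_right_zero by simp
  have "\<forall>\<^sub>F t in at_top. norm (\<gamma> t) \<le> 2 * norm (fst (\<gamma> 0)) * exp (- c * t)"
  proof (rule eventually_mono[OF eventually_ge_at_top])
    fix t :: real assume "0 \<le> t"
    then show "norm (\<gamma> t) \<le> 2 * norm (fst (\<gamma> 0)) * exp (- c * t)"
      using norm_Pair_le[of "fst (\<gamma> t)" "snd (\<gamma> t)"] le trajectory_in_cone_decay[OF assms, of t]
      by fastforce
  qed
  then show ?thesis by (rule tendsto_norm_zero_cancel[OF tendsto_sandwich[OF _ _ tendsto_const lim, rotated]]) simp
qed

end

section \<open>The local stable manifold of an equilibrium\<close>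

text \<open>
  The local stable set is the graph of a function over the contracting directions.  Outside a small
  ball the nonlinear part is altered so that the cone conditions hold globally.  The trajectories
  found for the altered field satisfy \<open>|z| \<le> |x|\<close> with \<open>|x|\<close> nonincreasing, hence they stay where the
  two fields agree.
\<close>

lemma stable_graph:
  fixes Y L :: "'u::euclidean_space \<times> real \<Rightarrow> 'u \<times> real"
  assumes Y: "has_strict_derivative Y L 0" "Y 0 = 0" and c: "0 < c" and e: "0 < e"
    and cone: "\<And>x. c * (norm x)\<^sup>2 \<le> snd x * snd (L x) - fst x \<bullet> fst (L x)"
    and contr: "\<And>x. \<bar>snd x\<bar> \<le> norm (fst x) \<Longrightarrow> fst x \<bullet> fst (L x) \<le> - c * (norm (fst x))\<^sup>2"
  obtains \<rho> \<phi> where "0 < \<rho>" "\<rho> \<le> e" "continuous_on (ball 0 \<rho>) \<phi>"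
    "\<And>\<gamma>. trajectory Y (ball 0 \<rho> \<times> ball 0 \<rho>) {0..} \<gamma> \<Longrightarrow> snd (\<gamma> 0) = \<phi> (fst (\<gamma> 0))"
    "\<And>x. x \<in> ball 0 \<rho> \<Longrightarrow>
      \<exists>\<gamma>. trajectory Y (ball 0 \<rho> \<times> ball 0 \<rho>) {0..} \<gamma> \<and> \<gamma> 0 = (x, \<phi> x) \<and> (\<gamma> \<longlongrightarrow> 0) at_top"
proof -
  obtain d where d: "0 < d" and rem: "\<And>x y. x \<in> cball 0 d \<Longrightarrow> y \<in> cball 0 d \<Longrightarrow>
      norm (Y x - Y y - L (x - y)) \<le> c/4 * norm (x - y)"
    using has_strict_derivative_remainder[OF Y(1), of "c/4"] c by auto
  have "bounded_linear L" using Y(1) by (rule has_strict_derivative_bounded_linear)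
  then have L: "L (x - y) = L x - L y" "L 0 = 0" for x y
    by (simp_all add: bounded_linear.linear linear_diff linear_0)
  obtain B where B: "0 < B" "\<And>x. norm (L x) \<le> norm x * B"
    using bounded_linear.pos_bounded[OF \<open>bounded_linear L\<close>] by auto
  \<comment> \<open>The nearest-point projection is 1-Lipschitz, so the altered remainder \<open>Z - L\<close> keeps the
    Lipschitz constant \<open>c/4\<close> on the whole space.\<close>
  define \<pi> where "\<pi> = closest_point (cball (0 :: 'u \<times> real) d)"
  define Z where "Z y = L y + (Y (\<pi> y) - L (\<pi> y))" for y
  have \<pi>: "\<pi> x \<in> cball 0 d" "norm (\<pi> x - \<pi> y) \<le> norm (x - y)" for x y
    unfolding \<pi>_def
    using d closest_point_in_set[of "cball (0 :: 'u \<times> real) d" x]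
      closest_point_lipschitz[of "cball (0 :: 'u \<times> real) d" x y]
    by (simp_all add: dist_norm)
  have ZY: "Z x = Y x" if "x \<in> cball 0 d" for x
    using that by (simp add: Z_def \<pi>_def closest_point_self)
  have Zdiff: "norm (Z x - Z y - L (x - y)) \<le> c/4 * norm (x - y)" for x y
  proof -
    have "Z x - Z y - L (x - y) = Y (\<pi> x) - Y (\<pi> y) - L (\<pi> x - \<pi> y)"
      by (simp add: Z_def L)
    then have "norm (Z x - Z y - L (x - y)) \<le> c/4 * norm (\<pi> x - \<pi> y)"
      using rem[OF \<pi>(1) \<pi>(1)] by simp
    also have "\<dots> \<le> c/4 * norm (x - y)" using \<pi>(2) c by (intro mult_left_mono) auto
    finally show ?thesis .
  qed
  have Z0: "Z 0 = 0" using d by (subst ZY) (auto simp: Y)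
  interpret cone_field Z "B + c/4" "c/2"
  proof
    fix x y :: "'u \<times> real"
    show "norm (Z x - Z y) \<le> (B + c/4) * norm (x - y)"
      using Zdiff[of x y] B(2)[of "x - y"] norm_triangle_ineq[of "Z x - Z y - L (x - y)" "L (x - y)"]
      by (simp add: algebra_simps)
    define D where "D = x - y"
    define E where "E = Z x - Z y"
    have "(- (- fst D, snd D)) \<bullet> (E - L D) \<le> norm (- (- fst D, snd D)) * norm (E - L D)"
      by (rule norm_cauchy_schwarz)
    also have "\<dots> \<le> norm D * (c/4 * norm D)"
    proof (rule mult_mono)
      show "norm (- (- fst D, snd D)) \<le> norm D" by (simp add: norm_prod_def)
      show "norm (E - L D) \<le> c/4 * norm D" using Zdiff[of x y] by (simp add: D_def E_def)
    qed auto
    finally have "- (snd D * snd (E - L D) - fst D \<bullet> fst (E - L D)) \<le> c/4 * (norm D)\<^sup>2"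
      by (simp add: inner_prod_def power2_eq_square mult_ac)
    moreover have "c * (norm D)\<^sup>2 \<le> snd D * snd (L D) - fst D \<bullet> fst (L D)" by (rule cone)
    moreover have "0 \<le> c * (norm D)\<^sup>2" using c by simp
    ultimately have "c/2 * (norm D)\<^sup>2 \<le> snd D * snd E - fst D \<bullet> fst E"
      by (simp add: inner_diff_right algebra_simps)
    then show "c/2 * (norm (x - y))\<^sup>2 \<le> snd (x - y) * snd (Z x - Z y) - fst (x - y) \<bullet> fst (Z x - Z y)"
      by (simp add: D_def E_def)
  next
    fix x :: "'u \<times> real" assume x: "\<bar>snd x\<bar> \<le> norm (fst x)"
    have "fst x \<bullet> fst (Z x - L x) \<le> norm (fst x) * norm (fst (Z x - L x))"
      by (rule norm_cauchy_schwarz)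
    also have "\<dots> \<le> norm (fst x) * (c/4 * (2 * norm (fst x)))"
    proof (rule mult_left_mono)
      have "norm (fst (Z x - L x)) \<le> norm (Z x - L x)"
        by (metis norm_fst_le prod.collapse)
      also have "\<dots> \<le> c/4 * norm x" using Zdiff[of x 0] Z0 by simp
      also have "\<dots> \<le> c/4 * (2 * norm (fst x))"
        using c x norm_Pair_le[of "fst x" "snd x"] by (intro mult_left_mono) auto
      finally show "norm (fst (Z x - L x)) \<le> c/4 * (2 * norm (fst x))" .
    qed simp
    finally show "fst x \<bullet> fst (Z x) \<le> - (c/2) * (norm (fst x))\<^sup>2"
      using contr[OF x] by (simp add: inner_diff_right power2_eq_square mult_ac)
  qed (use B c Z0 in auto)
  define \<phi> where "\<phi> x = (SOME z. \<exists>\<gamma>. trajectory Z UNIV {0..} \<gamma> \<and> \<gamma> 0 = (x, z) \<and>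
    (\<forall>t\<ge>0. \<bar>snd (\<gamma> t)\<bar> \<le> norm (fst (\<gamma> t))))" for x
  have "\<exists>\<gamma>. trajectory Z UNIV {0..} \<gamma> \<and> \<gamma> 0 = (x, \<phi> x) \<and>
    (\<forall>t\<ge>0. \<bar>snd (\<gamma> t)\<bar> \<le> norm (fst (\<gamma> t)))" for x
    unfolding \<phi>_def by (rule someI_ex[OF trajectory_in_cone_exists])
  then obtain \<Gamma> where \<Gamma>: "\<And>x. trajectory Z UNIV {0..} (\<Gamma> x)" "\<And>x. \<Gamma> x 0 = (x, \<phi> x)"
    "\<And>x. \<forall>t\<ge>0. \<bar>snd (\<Gamma> x t)\<bar> \<le> norm (fst (\<Gamma> x t))"
    by metis
  have fst\<Gamma>: "norm (fst (\<Gamma> x t)) \<le> norm x" if "0 \<le> t" for x t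
    using trajectory_in_cone_bounded[OF \<Gamma>(1) \<Gamma>(3) that, of x] \<Gamma>(2) by simp
  have bnd: "bounded (\<Gamma> x ` {0..})" for x
    unfolding bounded_iff
  proof (intro exI[of _ "2 * norm x"] ballI, elim imageE)
    fix y and t :: real assume "y = \<Gamma> x t" "t \<in> {0..}"
    then show "norm y \<le> 2 * norm x"
      using fst\<Gamma>[of t x] \<Gamma>(3)[of x] norm_Pair_le[of "fst (\<Gamma> x t)" "snd (\<Gamma> x t)"] by fastforce
  qed
  define \<rho> where "\<rho> = min e (d/2)"
  have \<rho>: "0 < \<rho>" "\<rho> \<le> e" "2 * \<rho> \<le> d" using d e by (auto simp: \<rho>_def)
  have box: "x \<in> cball 0 d" if "x \<in> ball 0 \<rho> \<times> ball 0 \<rho>" for x :: "'u \<times> real"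
    using that norm_Pair_le[of "fst x" "snd x"] \<rho> by auto
  have lipphi: "\<bar>\<phi> x - \<phi> y\<bar> \<le> norm (x - y)" for x y
    using bounded_trajectories_in_cone[OF \<Gamma>(1) bnd \<Gamma>(1) bnd, of x y] by (simp add: \<Gamma>(2))
  show ?thesis
  proof (rule that[OF \<rho>(1,2), of \<phi>])
    show "continuous_on (ball 0 \<rho>) \<phi>"
      by (rule lipschitz_on_continuous_on[of 1]) (use lipphi in \<open>auto intro!: lipschitz_onI simp: dist_norm\<close>)
  next
    fix \<gamma> assume \<gamma>: "trajectory Y (ball 0 \<rho> \<times> ball 0 \<rho>) {0..} \<gamma>"
    have in_ball: "\<gamma> t \<in> cball 0 d" if "0 \<le> t" for t
      using \<gamma> that unfolding trajectory_def by (intro box) blast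
    have "trajectory Z UNIV {0..} \<gamma>"
      using \<gamma> ZY[OF in_ball] unfolding trajectory_def by simp
    moreover have "bounded (\<gamma> ` {0..})"
      using in_ball by (intro bounded_subset[OF bounded_cball[of 0 d]] image_subsetI) simp
    ultimately show "snd (\<gamma> 0) = \<phi> (fst (\<gamma> 0))"
      using bounded_trajectories_in_cone[OF _ _ \<Gamma>(1) bnd, of UNIV \<gamma> "fst (\<gamma> 0)"] by (simp add: \<Gamma>(2))
  next
    fix x :: 'u assume x: "x \<in> ball 0 \<rho>"
    have in_box: "\<Gamma> x t \<in> ball 0 \<rho> \<times> ball 0 \<rho>" if "0 \<le> t" for t
      using fst\<Gamma>[OF that, of x] \<Gamma>(3)[of x] that x by (force simp: mem_Times_iff)
    then have "trajectory Y (ball 0 \<rho> \<times> ball 0 \<rho>) {0..} (\<Gamma> x)"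
      using \<Gamma>(1)[of x] ZY[OF box] unfolding trajectory_def by simp
    then show "\<exists>\<gamma>. trajectory Y (ball 0 \<rho> \<times> ball 0 \<rho>) {0..} \<gamma> \<and> \<gamma> 0 = (x, \<phi> x) \<and> (\<gamma> \<longlongrightarrow> 0) at_top"
      using \<Gamma>(2) trajectory_in_cone_tendsto[OF \<Gamma>(1,3)] by blast
  qed
qed

text \<open>
  The form in which the graph is used: \<open>\<Lambda>\<close> parametrizes the relevant part of \<open>S\<close> near \<open>p\<close>, and \<open>\<Psi>\<close>
  reads off the coordinates.  The homeomorphism onto the model recovers \<open>x\<close> from \<open>fst \<circ> \<Psi>\<close>, while
  the expanding coordinate may shrink under \<open>\<Psi> \<circ> \<Lambda>\<close>; this admits a coordinate that \<open>\<Lambda>\<close> forgets.  The embedding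
  \<open>J\<close> places the contracting space in the state space, where \<open>a\<close> describes the boundary of \<open>S\<close>.
\<close>

lemma stable_dim_by_coordinates:
  fixes Y L :: "'u::euclidean_space \<times> real \<Rightarrow> 'u \<times> real" and X :: "'s::euclidean_space \<Rightarrow> 's"
    and J :: "'u \<Rightarrow> 's" and J' :: "'s \<Rightarrow> 'u"
  assumes Y: "has_strict_derivative Y L 0" "Y 0 = 0" and c: "0 < c"
    and cone: "\<And>x. c * (norm x)\<^sup>2 \<le> snd x * snd (L x) - fst x \<bullet> fst (L x)"
    and contr: "\<And>x. \<bar>snd x\<bar> \<le> norm (fst x) \<Longrightarrow> fst x \<bullet> fst (L x) \<le> - c * (norm (fst x))\<^sup>2"
    and \<delta>: "0 < \<delta>"
    and \<Lambda>: "continuous_on (ball 0 \<delta> \<times> ball 0 \<delta>) \<Lambda>" "\<Lambda> 0 = p"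
    and \<Psi>: "continuous_on UNIV \<Psi>"
      "\<And>y. y \<in> ball 0 \<delta> \<times> ball 0 \<delta> \<Longrightarrow> fst (\<Psi> (\<Lambda> y)) = fst y"
      "\<And>y. y \<in> ball 0 \<delta> \<times> ball 0 \<delta> \<Longrightarrow> \<bar>snd (\<Psi> (\<Lambda> y))\<bar> \<le> \<bar>snd y\<bar>"
    and N0: "open N0" "p \<in> N0"
    and lower: "\<And>\<gamma>. trajectory X (S \<inter> N0) {0..} \<gamma> \<Longrightarrow>
        (\<And>t. 0 \<le> t \<Longrightarrow> \<Psi> (\<gamma> t) \<in> ball 0 \<delta> \<times> ball 0 \<delta>) \<Longrightarrow>
        trajectory Y UNIV {0..} (\<lambda>t. \<Psi> (\<gamma> t)) \<and> \<Lambda> (\<Psi> (\<gamma> 0)) = \<gamma> 0 \<and> 0 \<le> a \<bullet> J (fst (\<Psi> (\<gamma> 0)))"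
    and lift: "\<And>\<gamma>. trajectory Y (ball 0 \<delta> \<times> ball 0 \<delta>) {0..} \<gamma> \<Longrightarrow> 0 \<le> a \<bullet> J (fst (\<gamma> 0)) \<Longrightarrow>
        trajectory X S {0..} (\<lambda>t. \<Lambda> (\<gamma> t))"
    and J: "linear J" "linear J'" "\<And>x. J' (J x) = x"
  shows "stable_dim X S p (DIM('u))"
  unfolding stable_dim_def
proof (intro allI impI)
  fix \<epsilon> :: real assume \<epsilon>: "0 < \<epsilon>"
  define Box where "Box r = (ball 0 r \<times> ball 0 r :: ('u \<times> real) set)" for r
  have Box: "open (Box r)" "0 < r \<Longrightarrow> 0 \<in> Box r" "r \<le> s \<Longrightarrow> Box r \<subseteq> Box s" for r s
    by (auto simp: Box_def open_Times zero_prod_def)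
  have Box_ball: "Box r \<subseteq> ball 0 (2 * r)" for r
  proof
    fix y assume "y \<in> Box r"
    then show "y \<in> ball 0 (2 * r)"
      using norm_Pair_le[of "fst y" "snd y"] by (simp add: Box_def mem_Times_iff)
  qed
  have \<Psi>p: "\<Psi> p = 0"
    using \<Psi>(2,3)[of 0] \<Lambda>(2) Box(2)[OF \<delta>] by (simp add: Box_def prod_eq_iff)
  have "open (Box \<delta> \<inter> \<Lambda> -` (N0 \<inter> ball p \<epsilon>))"
    using \<Lambda>(1) N0 by (intro continuous_open_preimage Box) (auto simp: Box_def)
  moreover have "0 \<in> Box \<delta> \<inter> \<Lambda> -` (N0 \<inter> ball p \<epsilon>)"
    using Box(2)[OF \<delta>] \<Lambda>(2) N0(2) \<epsilon> by simp
  ultimately obtain r where r: "0 < r" "ball 0 r \<subseteq> Box \<delta> \<inter> \<Lambda> -` (N0 \<inter> ball p \<epsilon>)"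
    unfolding open_contains_ball by blast
  obtain \<rho> \<phi> where \<rho>: "0 < \<rho>" "\<rho> \<le> min \<delta> (r/2)" and \<phi>c: "continuous_on (ball 0 \<rho>) \<phi>"
    and uniq: "\<And>\<gamma>. trajectory Y (Box \<rho>) {0..} \<gamma> \<Longrightarrow> snd (\<gamma> 0) = \<phi> (fst (\<gamma> 0))"
    and ex: "\<And>x. x \<in> ball 0 \<rho> \<Longrightarrow>
      \<exists>\<gamma>. trajectory Y (Box \<rho>) {0..} \<gamma> \<and> \<gamma> 0 = (x, \<phi> x) \<and> (\<gamma> \<longlongrightarrow> 0) at_top"
    unfolding Box_def
    by (rule stable_graph[OF Y c _ cone contr, of "min \<delta> (r/2)"]) (use \<delta> r in auto)
  have Box\<delta>: "Box \<rho> \<subseteq> Box \<delta>" using \<rho> by (intro Box) auto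
  have \<Lambda>box: "\<Lambda> y \<in> N0 \<inter> ball p \<epsilon>" if "y \<in> Box \<rho>" for y
  proof -
    have "y \<in> ball 0 r"
      using that Box_ball[of \<rho>] \<rho> subset_ball[of "2 * \<rho>" r 0] by auto
    then show ?thesis using r(2) by blast
  qed
  have \<phi>box: "(x, \<phi> x) \<in> Box \<rho>" if "x \<in> ball 0 \<rho>" for x
    using ex[OF that] unfolding trajectory_def by (metis atLeast_iff order_refl)
  have \<phi>0: "\<phi> 0 = 0"
    using uniq[of "\<lambda>t. 0"] Box(2)[OF \<rho>(1)] Y(2) by (auto simp: trajectory_def)
  \<comment> \<open>A box in the coordinates: the trajectories on the graph never leave it, and no trajectory off
    the graph remains in it.\<close>
  define N where "N = N0 \<inter> ball p \<epsilon> \<inter> \<Psi> -` Box \<rho>"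
  have N: "open N" "p \<in> N" "N \<subseteq> ball p \<epsilon>"
    unfolding N_def using N0 \<epsilon> \<Psi>p Box(2)[OF \<rho>(1)] open_vimage[OF Box(1) \<Psi>(1)] by auto
  define D where "D = {x \<in> ball 0 \<rho>. 0 \<le> a \<bullet> J x}"
  define g where "g x = \<Lambda> (x, \<phi> x)" for x
  have M: "stable_manifold X (S \<inter> N) p = g ` D"
  proof (intro equalityI subsetI)
    fix q assume "q \<in> stable_manifold X (S \<inter> N) p"
    then obtain \<gamma> where \<gamma>: "trajectory X (S \<inter> N) {0..} \<gamma>" "\<gamma> 0 = q"
      unfolding stable_manifold_def by auto
    have \<Psi>\<gamma>: "\<Psi> (\<gamma> t) \<in> Box \<rho>" if "0 \<le> t" for t
      using \<gamma>(1) that unfolding trajectory_def N_def by auto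
    have "trajectory X (S \<inter> N0) {0..} \<gamma>"
      using \<gamma>(1) unfolding trajectory_def N_def by auto
    from lower[OF this] \<Psi>\<gamma> Box\<delta>
    have l: "trajectory Y UNIV {0..} (\<lambda>t. \<Psi> (\<gamma> t))" "\<Lambda> (\<Psi> q) = q" "0 \<le> a \<bullet> J (fst (\<Psi> q))"
      unfolding Box_def \<gamma>(2) by blast+
    have "trajectory Y (Box \<rho>) {0..} (\<lambda>t. \<Psi> (\<gamma> t))"
      using l(1) \<Psi>\<gamma> by (simp add: trajectory_def)
    from uniq[OF this] have "snd (\<Psi> q) = \<phi> (fst (\<Psi> q))" by (simp add: \<gamma>(2))
    moreover have "fst (\<Psi> q) \<in> D"
      using \<Psi>\<gamma>[of 0] l(3) by (auto simp: D_def \<gamma>(2) Box_def)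
    ultimately show "q \<in> g ` D" using l(2) by (metis g_def imageI prod.collapse)
  next
    fix q assume "q \<in> g ` D"
    then obtain x where x: "x \<in> ball 0 \<rho>" "0 \<le> a \<bullet> J x" "q = \<Lambda> (x, \<phi> x)"
      unfolding D_def g_def by auto
    obtain \<gamma> where \<gamma>: "trajectory Y (Box \<rho>) {0..} \<gamma>" "\<gamma> 0 = (x, \<phi> x)" "(\<gamma> \<longlongrightarrow> 0) at_top"
      using ex[OF x(1)] by blast
    have \<gamma>box: "\<gamma> t \<in> Box \<rho>" if "0 \<le> t" for t using \<gamma>(1) that by (simp add: trajectory_def)
    have "trajectory Y (Box \<delta>) {0..} \<gamma>" using \<gamma>(1) Box\<delta> by (auto simp: trajectory_def)
    then have "trajectory X S {0..} (\<lambda>t. \<Lambda> (\<gamma> t))"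
      using lift[of \<gamma>] \<gamma>(2) x(2) by (simp add: Box_def)
    moreover have "\<Lambda> (\<gamma> t) \<in> N" if "0 \<le> t" for t
    proof -
      have "\<Psi> (\<Lambda> (\<gamma> t)) \<in> Box \<rho>"
        using \<Psi>(2,3)[of "\<gamma> t"] \<gamma>box[OF that] Box\<delta> by (auto simp: Box_def mem_Times_iff)
      then show ?thesis using \<Lambda>box[OF \<gamma>box[OF that]] by (simp add: N_def)
    qed
    ultimately have "trajectory X (S \<inter> N) {0..} (\<lambda>t. \<Lambda> (\<gamma> t))"
      by (simp add: trajectory_def)
    moreover have "((\<lambda>t. \<Lambda> (\<gamma> t)) \<longlongrightarrow> p) at_top"
    proof -
      have "isCont \<Lambda> 0"
        using \<Lambda>(1) Box(1,2)[of \<delta>] \<delta> by (auto simp: Box_def continuous_on_eq_continuous_at zero_prod_def)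
      from isCont_tendsto_compose[OF this \<gamma>(3)] show ?thesis by (simp add: \<Lambda>(2))
    qed
    ultimately show "q \<in> stable_manifold X (S \<inter> N) p"
      unfolding stable_manifold_def using \<gamma>(2) x(3) by force
  qed
  have p: "p \<in> g ` D"
    using \<phi>0 \<rho>(1) \<Lambda>(2) linear_0[OF J(1)] by (auto simp: g_def D_def zero_prod_def intro!: image_eqI[of _ _ 0])
  have gc: "continuous_on D g"
  proof -
    have "continuous_on (ball 0 \<rho>) g"
      unfolding g_def
    proof (intro continuous_on_compose2[OF \<Lambda>(1)] continuous_on_Pair continuous_on_id \<phi>c)
      show "(\<lambda>x. (x, \<phi> x)) ` ball 0 \<rho> \<subseteq> ball 0 \<delta> \<times> ball 0 \<delta>"
        using Box\<delta> \<phi>box unfolding Box_def by blast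
    qed
    then show ?thesis by (rule continuous_on_subset) (auto simp: D_def)
  qed
  have \<Psi>g: "fst (\<Psi> (g x)) = x" if "x \<in> D" for x
  proof -
    have "(x, \<phi> x) \<in> Box \<delta>" using that \<phi>box Box\<delta> unfolding D_def by blast
    then show ?thesis using \<Psi>(2)[of "(x, \<phi> x)"] by (simp add: g_def Box_def)
  qed
  have Jc: "continuous_on A J" "continuous_on B J'" for A B
    using J by (simp_all add: linear_continuous_on linear_linear)
  have "homeomorphism (g ` D) (J ` D) (\<lambda>q. J (fst (\<Psi> q))) (\<lambda>y. g (J' y))"
  proof (rule homeomorphismI)
    show "continuous_on (g ` D) (\<lambda>q. J (fst (\<Psi> q)))"
      by (intro continuous_on_compose2[OF Jc(1)[of UNIV]] continuous_on_fst continuous_on_subset[OF \<Psi>(1)]) auto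
    show "continuous_on (J ` D) (\<lambda>y. g (J' y))"
      by (intro continuous_on_compose2[OF gc] Jc(2)) (auto simp: J)
  qed (auto simp: \<Psi>g J)
  then have "g ` D homeomorphic J ` D" unfolding homeomorphic_def by blast
  moreover have "openin (top_of_set {y \<in> range J. 0 \<le> a \<bullet> y}) (J ` D)"
  proof -
    have "J ` D = {y \<in> range J. 0 \<le> a \<bullet> y} \<inter> J' -` ball 0 \<rho>"
      unfolding D_def using J(3) by force
    then show ?thesis using open_vimage[OF open_ball Jc(2)[of UNIV]] by (metis openin_open_Int)
  qed
  moreover have "dim (range J) = DIM('u)"
    using dim_image_eq[OF J(1), of UNIV] J(3) by (metis dim_UNIV inj_on_inverseI)
  moreover have "subspace (range J)"
    using J(1) by (simp add: linear_subspace_image)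
  ultimately have "manifold_of_dim (DIM('u)) (g ` D)"
    unfolding manifold_of_dim_def
    by (intro ballI exI[of _ "g ` D"] exI[of _ "range J"] exI[of _ a] exI[of _ "J ` D"]) auto
  then show "\<exists>N. open N \<and> p \<in> N \<and> N \<subseteq> ball p \<epsilon> \<and> p \<in> stable_manifold X (S \<inter> N) p \<and>
      manifold_of_dim (DIM('u)) (stable_manifold X (S \<inter> N) p)"
    using N p by (intro exI[of _ N]) (simp add: M)
qed

lemma trajectory_reverse:
  assumes "trajectory X S (uminus ` I) \<gamma>"
  shows "trajectory (\<lambda>x. - X x) S I (\<lambda>t. \<gamma> (- t))"
  unfolding trajectory_def
proof (intro ballI conjI)
  fix t :: real assume t: "t \<in> I"
  have g: "\<gamma> (- t) \<in> S" "(\<gamma> has_vector_derivative X (\<gamma> (- t))) (at (- t) within uminus ` I)"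
    using assms t unfolding trajectory_def by auto
  show "\<gamma> (- t) \<in> S" by (rule g)
  have "((\<lambda>t. - t) has_vector_derivative (- 1)) (at t within I)"
    by (auto intro!: derivative_eq_intros simp flip: has_real_derivative_iff_has_vector_derivative)
  then show "((\<lambda>t. \<gamma> (- t)) has_vector_derivative - X (\<gamma> (- t))) (at t within I)"
    using vector_diff_chain_within[of uminus "-1" t I \<gamma> "X (\<gamma> (- t))"] g(2) by (simp add: o_def)
qed

lemma unstable_manifold_eq_stable_manifold:
  "unstable_manifold X S p = stable_manifold (\<lambda>x. - X x) S p"
proof (intro equalityI subsetI)
  fix x assume "x \<in> unstable_manifold X S p"
  then obtain \<gamma> where \<gamma>: "trajectory X S {..0} \<gamma>" "\<gamma> 0 = x" "(\<gamma> \<longlongrightarrow> p) at_bot"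
    unfolding unstable_manifold_def by blast
  have "trajectory (\<lambda>x. - X x) S {0..} (\<lambda>t. \<gamma> (- t))" "((\<lambda>t. \<gamma> (- t)) \<longlongrightarrow> p) at_top"
    using trajectory_reverse[of X S "{0..}"] \<gamma>(1) \<gamma>(3)[unfolded filterlim_at_bot_mirror] by simp_all
  then show "x \<in> stable_manifold (\<lambda>x. - X x) S p"
    unfolding stable_manifold_def using \<gamma>(2) by (intro CollectI exI[of _ "\<lambda>t. \<gamma> (- t)"]) simp
next
  fix x assume "x \<in> stable_manifold (\<lambda>x. - X x) S p"
  then obtain \<gamma> where \<gamma>: "trajectory (\<lambda>x. - X x) S {0..} \<gamma>" "\<gamma> 0 = x" "(\<gamma> \<longlongrightarrow> p) at_top"
    unfolding stable_manifold_def by blast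
  have "trajectory X S {..0} (\<lambda>t. \<gamma> (- t))" "((\<lambda>t. \<gamma> (- t)) \<longlongrightarrow> p) at_bot"
    using trajectory_reverse[of "\<lambda>x. - X x" S "{..0}"] \<gamma>(1) \<gamma>(3)[unfolded filterlim_at_top_mirror]
    by simp_all
  then show "x \<in> unstable_manifold X S p"
    unfolding unstable_manifold_def using \<gamma>(2) by (intro CollectI exI[of _ "\<lambda>t. \<gamma> (- t)"]) simp
qed

lemma unstable_dim_eq_stable_dim:
  "unstable_dim X S p k = stable_dim (\<lambda>x. - X x) S p k"
  unfolding unstable_dim_def stable_dim_def unstable_manifold_eq_stable_manifold ..

lemma has_strict_derivative_transform:
  assumes f: "has_strict_derivative f L p" and eq: "\<forall>\<^sub>F x in nhds p. f x = g x"
  shows "has_strict_derivative g L p"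
proof -
  have e: "\<forall>\<^sub>F z in nhds (p, p). f (fst z) = g (fst z) \<and> f (snd z) = g (snd z)"
    unfolding nhds_prod eventually_prod_same using eq by (intro exI[of _ "\<lambda>x. f x = g x"]) auto
  show ?thesis
    unfolding has_strict_derivative_def
  proof (intro conjI allI impI)
    show "bounded_linear L" using f by (rule has_strict_derivative_bounded_linear)
    fix \<epsilon> :: real assume "0 < \<epsilon>"
    then have "\<forall>\<^sub>F z in nhds (p, p). norm (f (fst z) - f (snd z) - L (fst z - snd z)) \<le> \<epsilon> * norm (fst z - snd z)"
      using f unfolding has_strict_derivative_def by blast
    with e show "\<forall>\<^sub>F z in nhds (p, p). norm (g (fst z) - g (snd z) - L (fst z - snd z)) \<le> \<epsilon> * norm (fst z - snd z)"
      by eventually_elim simp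
  qed
qed

section \<open>Strictly differentiable functions on the real line\<close>

definition strictly_differentiable :: "(real \<Rightarrow> real) \<Rightarrow> real \<Rightarrow> bool" where
  "strictly_differentiable f x \<longleftrightarrow> (\<exists>f'. has_strict_derivative f (\<lambda>h. f' * h) x)"

lemma strictly_differentiableD:
  assumes "strictly_differentiable f x"
  shows "(f has_real_derivative deriv f x) (at x)"
    and "has_strict_derivative f (\<lambda>h. deriv f x * h) x"
proof -
  obtain f' where f': "has_strict_derivative f (\<lambda>h. f' * h) x"
    using assms unfolding strictly_differentiable_def by blast
  then have "(f has_real_derivative f') (at x)"
    unfolding has_field_derivative_def by (rule has_strict_derivative_imp_has_derivative)
  then show "(f has_real_derivative deriv f x) (at x)" "has_strict_derivative f (\<lambda>h. deriv f x * h) x"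
    using f' DERIV_imp_deriv by auto
qed

lemma strictly_differentiableI:
  assumes "has_strict_derivative f L x" "\<And>h. L h = f' * h"
  shows "strictly_differentiable f x"
proof -
  have "L = (\<lambda>h. f' * h)" using assms(2) by blast
  then show ?thesis using assms(1) unfolding strictly_differentiable_def by blast
qed

lemma strictly_differentiable_C1:
  assumes "\<forall>\<^sub>F y in nhds x. (f has_real_derivative f' y) (at y)" "isCont f' x"
  shows "strictly_differentiable f x"
  using has_strict_derivative_real[OF assms] unfolding strictly_differentiable_def by blast

lemma strictly_differentiable_compose:
  assumes g: "strictly_differentiable g (f x)" and f: "strictly_differentiable f x"
  shows "strictly_differentiable (\<lambda>x. g (f x)) x"
  using has_strict_derivative_chain[OF strictly_differentiableD(2)[OF f] strictly_differentiableD(2)[OF g]]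
  unfolding strictly_differentiable_def by (auto simp: mult.assoc[symmetric])

lemma strictly_differentiable_const: "strictly_differentiable (\<lambda>x. a) x"
  by (rule strictly_differentiableI[OF has_strict_derivative_const, of 0]) simp

lemma strictly_differentiable_ident: "strictly_differentiable (\<lambda>x. x) x"
  by (rule strictly_differentiableI[OF has_strict_derivative_linear[OF bounded_linear_ident], of 1]) simp

lemma strictly_differentiable_add:
  assumes "strictly_differentiable f x" "strictly_differentiable g x"
  shows "strictly_differentiable (\<lambda>x. f x + g x) x"
  using has_strict_derivative_add[OF assms[THEN strictly_differentiableD(2)]]
  unfolding strictly_differentiable_def by (auto simp: distrib_right[symmetric])

lemma strictly_differentiable_mult:
  assumes "strictly_differentiable f x" "strictly_differentiable g x"
  shows "strictly_differentiable (\<lambda>x. f x * g x) x"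
  by (rule strictly_differentiableI[OF has_strict_derivative_mult[OF assms[THEN strictly_differentiableD(2)]],
        of "f x * deriv g x + deriv f x * g x"]) (simp add: algebra_simps)

lemma strictly_differentiable_minus:
  assumes "strictly_differentiable f x"
  shows "strictly_differentiable (\<lambda>x. - f x) x"
  using strictly_differentiable_mult[OF strictly_differentiable_const assms, of "-1"] by simp

lemma strictly_differentiable_diff:
  assumes "strictly_differentiable f x" "strictly_differentiable g x"
  shows "strictly_differentiable (\<lambda>x. f x - g x) x"
  using strictly_differentiable_add[OF assms(1) strictly_differentiable_minus[OF assms(2)]] by simp

lemma strictly_differentiable_power:
  assumes "strictly_differentiable f x"
  shows "strictly_differentiable (\<lambda>x. f x ^ n) x"
  by (induction n) (auto intro: strictly_differentiable_const strictly_differentiable_mult assms)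

lemma strictly_differentiable_divide:
  assumes f: "strictly_differentiable f x" and g: "strictly_differentiable g x" "g x \<noteq> 0"
  shows "strictly_differentiable (\<lambda>x. f x / g x) x"
proof -
  have "\<forall>\<^sub>F y in nhds (g x). y \<in> - {0}"
    using g(2) by (intro eventually_nhds_in_open) auto
  then have "strictly_differentiable inverse (g x)"
    using g(2)
    by (intro strictly_differentiable_C1[where f' = "\<lambda>y. - (1 / y\<^sup>2)"])
       (auto elim!: eventually_mono intro!: derivative_eq_intros continuous_intros simp: field_simps power2_eq_square)
  from strictly_differentiable_mult[OF f strictly_differentiable_compose[OF this g(1)]]
  show ?thesis by (simp add: divide_inverse)
qed

lemma strictly_differentiable_sin: "strictly_differentiable sin x"
  by (rule strictly_differentiable_C1[where f' = cos]) (auto intro: DERIV_sin)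

lemma strictly_differentiable_cos: "strictly_differentiable cos x"
  by (rule strictly_differentiable_C1[where f' = "\<lambda>x. - sin x"]) (auto intro: DERIV_cos)

lemma strictly_differentiable_powr:
  assumes f: "strictly_differentiable f x" and pos: "0 < f x"
  shows "strictly_differentiable (\<lambda>x. f x powr a) x"
proof -
  have "\<forall>\<^sub>F y in nhds (f x). y \<in> {0<..}"
    using pos by (intro eventually_nhds_in_open) auto
  then have "strictly_differentiable (\<lambda>y. y powr a) (f x)"
    using pos
    by (intro strictly_differentiable_C1[where f' = "\<lambda>y. a * y powr (a - 1)"])
       (auto elim!: eventually_mono intro!: has_real_derivative_powr continuous_intros)
  from strictly_differentiable_compose[OF this f] show ?thesis .
qed

lemma strictly_differentiable_sqrt:
  assumes f: "strictly_differentiable f x" and pos: "0 < f x"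
  shows "strictly_differentiable (\<lambda>x. sqrt (f x)) x"
proof -
  have "\<forall>\<^sub>F y in nhds (f x). y \<in> {0<..}"
    using pos by (intro eventually_nhds_in_open) auto
  then have "strictly_differentiable sqrt (f x)"
    using pos
    by (intro strictly_differentiable_C1[where f' = "\<lambda>y. inverse (sqrt y) / 2"])
       (auto elim!: eventually_mono intro!: DERIV_real_sqrt continuous_intros)
  from strictly_differentiable_compose[OF this f] show ?thesis .
qed

lemma strictly_differentiable_transform:
  assumes "strictly_differentiable f x" "\<forall>\<^sub>F y in nhds x. f y = g y"
  shows "strictly_differentiable g x"
  using assms has_strict_derivative_transform unfolding strictly_differentiable_def by metis

lemmas strictly_differentiable_intros =
  strictly_differentiable_const strictly_differentiable_ident strictly_differentiable_add
  strictly_differentiable_diff strictly_differentiable_minus strictly_differentiable_mult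
  strictly_differentiable_power strictly_differentiable_divide
  strictly_differentiable_sin strictly_differentiable_cos
  strictly_differentiable_sqrt strictly_differentiable_powr

lemma eventually_cos_neq_0:
  assumes "cos x \<noteq> 0"
  shows "\<forall>\<^sub>F y in nhds x. cos y \<noteq> (0 :: real)"
proof -
  have "(cos \<longlongrightarrow> cos x) (nhds x)"
    using isCont_cos[of x] unfolding isCont_def tendsto_at_iff_tendsto_nhds .
  then show ?thesis
    using eventually_compose_filterlim[OF t1_space_nhds[OF assms]] by blast
qed

section \<open>Potentials and the vector field\<close>

locale isosceles =
  fixes A A1 B B1 M m h C :: real
  assumes pos: "0 < A" "0 < A1" "0 < B" "0 < B1" "0 < M" "0 < m"
begin

abbreviation "V \<equiv> potV A A1 M m"
abbreviation "U \<equiv> potU B B1 M m"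
abbreviation "W \<equiv> potW B B1 M m"
abbreviation "X \<equiv> vector_field A A1 B B1 M m h C"
abbreviation "F \<equiv> energy_fun A A1 B B1 M m h C"
abbreviation "S \<equiv> energy_level A A1 B B1 M m h C"

definition "\<nu> = mu M m - 1"
definition "k = (M / 2) powr (3/2)"
definition "D \<theta> = 1 + \<nu> * (sin \<theta>)\<^sup>2"

lemma nu_pos: "0 < \<nu>" and k_pos: "0 < k"
  using pos by (auto simp: \<nu>_def k_def mu_def field_simps)

lemma D_pos: "0 < D \<theta>"
  using nu_pos by (simp add: D_def add_pos_nonneg)

lemma D_eq: "(cos \<theta>)\<^sup>2 + mu M m * (sin \<theta>)\<^sup>2 = D \<theta>"
  by (simp add: D_def \<nu>_def cos_squared_eq algebra_simps)

lemma U_alt: "U \<theta> = k * (B + 16 * B1 * (cos \<theta>) ^ 3 * D \<theta> powr (-3/2))"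
  by (simp add: potU_def D_eq k_def powr_minus_divide)

lemma W_alt: "W \<theta> = k * (B / (cos \<theta>) ^ 3 + 16 * B1 * D \<theta> powr (-3/2))"
  by (simp add: potW_def D_eq k_def powr_minus_divide)

lemma V_alt: "V \<theta> = sqrt (M/2) * (A / cos \<theta> + 4 * A1 * D \<theta> powr (-1/2))"
  by (simp add: potV_def D_eq powr_minus_divide powr_half_sqrt less_imp_le[OF D_pos])

lemma U_pos: "0 \<le> cos \<theta> \<Longrightarrow> 0 < U \<theta>"
  unfolding U_alt using k_pos pos D_pos by (intro mult_pos_pos add_pos_nonneg mult_nonneg_nonneg) auto

lemma W_pos: "0 < cos \<theta> \<Longrightarrow> 0 < W \<theta>"
  unfolding W_alt using k_pos pos D_pos by (intro mult_pos_pos add_pos_nonneg divide_pos_pos mult_nonneg_nonneg) auto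

lemma U_eq_W: "cos \<theta> \<noteq> 0 \<Longrightarrow> U \<theta> = W \<theta> * cos \<theta> ^ 3"
  by (rule potU_eq)

text \<open>
  \<open>K\<close> is the factor of \<open>W'\<close> that decides where the critical points other than \<open>0\<close> are.
\<close>

definition "K \<theta> = B / cos \<theta> ^ 5 - 16 * B1 * \<nu> * D \<theta> powr (-5/2)"
definition "W' \<theta> = 3 * k * sin \<theta> * cos \<theta> * K \<theta>"
definition "U' \<theta> = k * 16 * B1 * (- 3 * (cos \<theta>)\<^sup>2 * sin \<theta> * D \<theta> powr (-3/2)
    - 3 * \<nu> * sin \<theta> * cos \<theta> ^ 4 * D \<theta> powr (-5/2))"
definition "V' \<theta> = sqrt (M/2) * (A * sin \<theta> / (cos \<theta>)\<^sup>2 - 4 * A1 * \<nu> * sin \<theta> * cos \<theta> * D \<theta> powr (-3/2))"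

lemma D_deriv: "(D has_real_derivative 2 * \<nu> * sin \<theta> * cos \<theta>) (at \<theta>)"
  unfolding D_def by (auto intro!: derivative_eq_intros)

lemma D_powr_deriv: "((\<lambda>\<theta>. D \<theta> powr a) has_real_derivative a * D \<theta> powr (a - 1) * (2 * \<nu> * sin \<theta> * cos \<theta>)) (at \<theta>)"
  using DERIV_chain2[OF has_real_derivative_powr[OF D_pos] D_deriv] .

lemma U_deriv: "(U has_real_derivative U' \<theta>) (at \<theta>)"
  unfolding U_alt[abs_def] U'_def
  by (rule derivative_eq_intros D_powr_deriv refl | simp)+
     (simp add: algebra_simps power2_eq_square power3_eq_cube power4_eq_xxxx)

lemma W_deriv:
  assumes "cos \<theta> \<noteq> 0"
  shows "(W has_real_derivative W' \<theta>) (at \<theta>)"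
  unfolding W_alt[abs_def] W'_def K_def
  by (rule derivative_eq_intros D_powr_deriv refl | simp add: assms)+
     (use assms in \<open>simp add: field_simps eval_nat_numeral\<close>)

lemma V_deriv:
  assumes "cos \<theta> \<noteq> 0"
  shows "(V has_real_derivative V' \<theta>) (at \<theta>)"
  unfolding V_alt[abs_def] V'_def
  by (rule derivative_eq_intros D_powr_deriv refl | simp add: assms)+
     (use assms in \<open>simp add: field_simps eval_nat_numeral\<close>)

lemma deriv_U: "deriv U \<theta> = U' \<theta>"
  by (rule DERIV_imp_deriv[OF U_deriv])

lemma deriv_V: "cos \<theta> \<noteq> 0 \<Longrightarrow> deriv V \<theta> = V' \<theta>"
  by (rule DERIV_imp_deriv[OF V_deriv])

text \<open>
  Differentiating \<open>U = W cos\<^sup>3\<close>.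
\<close>

lemma W'_U':
  assumes "cos \<theta> \<noteq> 0"
  shows "W' \<theta> * cos \<theta> ^ 4 = U' \<theta> * cos \<theta> + 3 * U \<theta> * sin \<theta>"
proof -
  have eq: "\<forall>\<^sub>F x in nhds \<theta>. U x = W x * cos x ^ 3"
    using eventually_cos_neq_0[OF assms] by eventually_elim (auto intro: U_eq_W)
  have "((\<lambda>\<theta>. W \<theta> * cos \<theta> ^ 3) has_real_derivative W' \<theta> * cos \<theta> ^ 3 + (3 * (cos \<theta>)\<^sup>2 * - sin \<theta>) * W \<theta>) (at \<theta>)"
    by (auto intro!: derivative_eq_intros W_deriv assms)
  then have "(U has_real_derivative W' \<theta> * cos \<theta> ^ 3 + (3 * (cos \<theta>)\<^sup>2 * - sin \<theta>) * W \<theta>) (at \<theta>)"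
    using DERIV_cong_ev[OF refl eq refl] by simp
  then have "U' \<theta> = W' \<theta> * cos \<theta> ^ 3 + (3 * (cos \<theta>)\<^sup>2 * - sin \<theta>) * W \<theta>"
    using DERIV_unique[OF U_deriv] by blast
  then have "U' \<theta> * cos \<theta> = (W' \<theta> * cos \<theta> ^ 3 + (3 * (cos \<theta>)\<^sup>2 * - sin \<theta>) * W \<theta>) * cos \<theta>" by simp
  then show ?thesis by (simp add: U_eq_W[OF assms] algebra_simps eval_nat_numeral)
qed

lemma strictly_differentiable_D: "strictly_differentiable D x"
  unfolding D_def[abs_def] by (intro strictly_differentiable_intros)

lemma strictly_differentiable_coefficients:
  "strictly_differentiable U x" "strictly_differentiable U' x"
  "cos x \<noteq> 0 \<Longrightarrow> strictly_differentiable V x" "cos x \<noteq> 0 \<Longrightarrow> strictly_differentiable W x"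
  "cos x \<noteq> 0 \<Longrightarrow> strictly_differentiable V' x" "cos x \<noteq> 0 \<Longrightarrow> strictly_differentiable W' x"
  using D_pos[of x]
  unfolding U_alt[abs_def] U'_def[abs_def] V_alt[abs_def] V'_def[abs_def] W_alt[abs_def] W'_def[abs_def] K_def[abs_def]
  by (auto intro!: strictly_differentiable_intros strictly_differentiable_D)

lemma strictly_differentiable_deriv_V:
  assumes "cos x \<noteq> 0"
  shows "strictly_differentiable (deriv V) x"
  using strictly_differentiable_coefficients(5)[OF assms]
  by (rule strictly_differentiable_transform) 
     (use eventually_cos_neq_0[OF assms] in eventually_elim, simp add: deriv_V)


text \<open>
  The functions of \<open>\<theta>\<close> that occur as coefficients when the vector field and the energy are sorted by
  monomials in \<open>r, v, w\<close>.  Strict derivatives of the sorted expressions at \<open>r = w = 0\<close> involve the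
  derivatives of few of them.
\<close>

definition "a \<theta> = cos \<theta> ^ 3 / sqrt (U \<theta>)"
definition "c6 \<theta> = cos \<theta> ^ 6" for \<theta> :: real
definition "c4 \<theta> = cos \<theta> ^ 4" for \<theta> :: real
definition "Uc3 \<theta> = U \<theta> * cos \<theta> ^ 3"
definition "Vc6 \<theta> = V \<theta> * cos \<theta> ^ 6"
definition "g1 \<theta> = cos \<theta> ^ 6 / U \<theta> * deriv V \<theta>"
definition "g2 \<theta> = 3 * sin \<theta> * cos \<theta> ^ 5 / U \<theta>"
definition "g3 \<theta> = sin \<theta> * cos \<theta> ^ 3 / U \<theta>"
definition "dlogU \<theta> = deriv U \<theta> / U \<theta>"
definition "e \<theta> = deriv U \<theta> / U \<theta> * cos \<theta> ^ 3 - 3 * sin \<theta> * (cos \<theta>)\<^sup>2"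
definition "sU \<theta> = sqrt (U \<theta>)"

lemma X_eq: "X = (\<lambda>x. let r = fst x; v = fst (snd x); t = fst (snd (snd x)); w = snd (snd (snd x)) in
   (a t * (r * v), a t * (v * v) * (1/2) - sU t + (r * r) * ((2 * h) * r + V t) * a t, w,
    (a t * (v * w)) * (1/2) + g1 t * (r * r) + e t - dlogU t * (w * w) * (1/2)
      + g2 t * (v * v - (2 * h) * (r * r * r) - 2 * (r * r * V t)) + (2 * C\<^sup>2) * (r * g3 t)))"
  unfolding vector_field_def a_def sU_def g1_def g2_def g3_def e_def dlogU_def Let_def fun_eq_iff case_prod_unfold
  by (simp add: power2_eq_square power3_eq_cube algebra_simps add_divide_distrib)

lemma F_eq: "F = (\<lambda>x. let r = fst x; v = fst (snd x); t = fst (snd (snd x)); w = snd (snd (snd x)) in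
   U t * (w * w) + c6 t * (v * v) - 2 * Uc3 t + C\<^sup>2 * (r * c4 t) - 2 * (r * r * Vc6 t)
    - (2 * h) * (r * r * r * c6 t))"
  unfolding energy_fun_def Let_def fun_eq_iff case_prod_unfold c6_def c4_def Uc3_def Vc6_def
  by (simp add: eval_nat_numeral algebra_simps)

text \<open>
  The next two identities express the equations \<open>v' = 0\<close> and \<open>w' = 0\<close> at \<open>r = w = 0\<close> through \<open>W\<close> and
  \<open>W'\<close>; near a critical point they also give the \<open>\<theta>\<close>-derivatives of \<open>v'\<close> and \<open>w'\<close>.
\<close>

lemma a_W: "0 < cos \<theta> \<Longrightarrow> a \<theta> * W \<theta> = sU \<theta>"
  using U_pos[of \<theta>] by (simp add: a_def sU_def U_eq_W mult.commute) (metis U_eq_W less_irrefl mult.commute real_div_sqrt less_imp_le)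

lemma e_g2_W:
  assumes "0 < cos \<theta>"
  shows "e \<theta> + 2 * g2 \<theta> * W \<theta> = W' \<theta> * (cos \<theta> ^ 3 / W \<theta>)"
proof -
  have W: "W \<theta> = U \<theta> / cos \<theta> ^ 3" using assms by (simp add: U_eq_W)
  have W': "W' \<theta> = (U' \<theta> * cos \<theta> + 3 * U \<theta> * sin \<theta>) / cos \<theta> ^ 4"
    using W'_U'[of \<theta>] assms by (simp add: field_simps)
  show ?thesis
    unfolding W W' e_def g2_def deriv_U using assms U_pos[of \<theta>]
    by (simp add: divide_simps) (simp add: eval_nat_numeral algebra_simps)
qed


end

lemma has_strict_derivative_eq_rhs:
  "has_strict_derivative f L p \<Longrightarrow> L = M \<Longrightarrow> has_strict_derivative f M p"
  by simp

lemma has_strict_derivative_component: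
  assumes f: "strictly_differentiable f t" and \<pi>: "bounded_linear \<pi>" "\<pi> p = t"
  shows "has_strict_derivative (\<lambda>x. f (\<pi> x)) (\<lambda>h. deriv f t * \<pi> h) p"
  using has_strict_derivative_chain[OF has_strict_derivative_linear[OF \<pi>(1)], of f "\<lambda>h. deriv f t * h" p]
    strictly_differentiableD(2)[OF f] \<pi>(2) by simp

lemma has_strict_derivative_projections:
  "has_strict_derivative (\<lambda>x. fst x) (\<lambda>h. fst h) p"
  "has_strict_derivative (\<lambda>x. fst (snd x)) (\<lambda>h. fst (snd h)) p'"
  "has_strict_derivative (\<lambda>x. snd (snd x)) (\<lambda>h. snd (snd h)) p'"
  "has_strict_derivative (\<lambda>x. fst (snd (snd x))) (\<lambda>h. fst (snd (snd h))) p''"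
  "has_strict_derivative (\<lambda>x. snd (snd (snd x))) (\<lambda>h. snd (snd (snd h))) p''"
  by (intro has_strict_derivative_linear bounded_linear_fst_comp bounded_linear_snd_comp
      bounded_linear_fst bounded_linear_snd bounded_linear_ident)+

lemma DERIV_unique_eventually:
  assumes f: "(f has_real_derivative d) (at x)" and eq: "\<forall>\<^sub>F y in nhds x. f y = g y"
    and g: "(g has_real_derivative d') (at x)"
  shows "d = d'"
  using f g DERIV_cong_ev[OF refl eq refl, of d] DERIV_unique by blast

section \<open>The linearization along the energy level\<close>

locale critical_point = isosceles +
  fixes \<theta>s :: real
  assumes \<theta>s: "- (pi/2) < \<theta>s" "\<theta>s < pi/2" and W'_zero: "W' \<theta>s = 0"
begin

lemma cos_pos: "0 < cos \<theta>s"
  using \<theta>s by (intro cos_gt_zero_pi) auto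

lemma cos_neq: "cos \<theta>s \<noteq> 0" and U_neq: "U \<theta>s \<noteq> 0" and W_neq: "W \<theta>s \<noteq> 0"
  and sqrt_U_neq: "sqrt (U \<theta>s) \<noteq> 0"
  using cos_pos U_pos[of \<theta>s] W_pos[of \<theta>s] by auto

definition "q = cos \<theta>s ^ 3 / W \<theta>s * deriv W' \<theta>s"

lemma eventually_cos_pos: "\<forall>\<^sub>F \<theta> in nhds \<theta>s. 0 < cos \<theta>"
proof -
  have "(cos \<longlongrightarrow> cos \<theta>s) (nhds \<theta>s)"
    using isCont_cos[of \<theta>s] unfolding isCont_def tendsto_at_iff_tendsto_nhds .
  then show ?thesis
    using order_tendstoD(1) cos_pos by fastforce
qed

lemma strictly_differentiable_at_\<theta>s:
  "strictly_differentiable a \<theta>s" "strictly_differentiable sU \<theta>s" "strictly_differentiable V \<theta>s"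
  "strictly_differentiable U \<theta>s"
  "strictly_differentiable c6 \<theta>s" "strictly_differentiable c4 \<theta>s" "strictly_differentiable Uc3 \<theta>s"
  "strictly_differentiable Vc6 \<theta>s" "strictly_differentiable g1 \<theta>s" "strictly_differentiable g2 \<theta>s"
  "strictly_differentiable g3 \<theta>s" "strictly_differentiable e \<theta>s" "strictly_differentiable dlogU \<theta>s"
  "strictly_differentiable W \<theta>s" "strictly_differentiable W' \<theta>s"
  unfolding a_def[abs_def] sU_def[abs_def] c6_def[abs_def] c4_def[abs_def] Uc3_def[abs_def]
    Vc6_def[abs_def] g1_def[abs_def] g2_def[abs_def] g3_def[abs_def] e_def[abs_def] dlogU_def[abs_def] deriv_U
  using cos_pos U_pos[of \<theta>s]
  by (auto intro!: strictly_differentiable_intros strictly_differentiable_coefficients strictly_differentiable_deriv_V)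

text \<open>
  The \<open>\<theta>\<close>-derivative of \<open>v'\<close> vanishes: by \<open>a W = sqrt U\<close>, at \<open>r = 0\<close> one has
  \<open>v' = a (v\<^sup>2 - 2 W) / 2\<close>, and both \<open>v\<^sup>2 - 2 W\<close> and \<open>W'\<close> are zero at the critical point.  The two
  lemmas after this one rest on the same factor \<open>v\<^sup>2 - 2 W\<close>.
\<close>

lemma deriv_relation_v:
  assumes v: "v\<^sup>2 = 2 * W \<theta>s"
  shows "deriv a \<theta>s * v\<^sup>2 / 2 - deriv sU \<theta>s = 0"
proof -
  note d = strictly_differentiable_at_\<theta>s[THEN strictly_differentiableD(1)]
  have "((\<lambda>\<theta>. a \<theta> * v\<^sup>2 / 2 - sU \<theta>) has_real_derivative deriv a \<theta>s * v\<^sup>2 / 2 - deriv sU \<theta>s) (at \<theta>s)"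
    by (auto intro!: derivative_eq_intros d)
  moreover have "\<forall>\<^sub>F \<theta> in nhds \<theta>s. a \<theta> * v\<^sup>2 / 2 - sU \<theta> = a \<theta> * (v\<^sup>2 - 2 * W \<theta>) / 2"
    using eventually_cos_pos
  proof eventually_elim
    case (elim \<theta>)
    then show ?case using a_W[of \<theta>] by (simp add: algebra_simps)
  qed
  moreover have "((\<lambda>\<theta>. a \<theta> * (v\<^sup>2 - 2 * W \<theta>) / 2) has_real_derivative 0) (at \<theta>s)"
    using W_deriv[OF cos_neq] by (auto intro!: derivative_eq_intros d(1) simp: v W'_zero)
  ultimately show ?thesis
    by (rule DERIV_unique_eventually)
qed

lemma deriv_relation_w:
  assumes v: "v\<^sup>2 = 2 * W \<theta>s"
  shows "deriv e \<theta>s + deriv g2 \<theta>s * v\<^sup>2 = q"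
proof -
  note d = strictly_differentiable_at_\<theta>s[THEN strictly_differentiableD(1)]
  have "((\<lambda>\<theta>. e \<theta> + g2 \<theta> * v\<^sup>2) has_real_derivative deriv e \<theta>s + deriv g2 \<theta>s * v\<^sup>2) (at \<theta>s)"
    by (auto intro!: derivative_eq_intros d)
  moreover have "\<forall>\<^sub>F \<theta> in nhds \<theta>s. e \<theta> + g2 \<theta> * v\<^sup>2 = W' \<theta> * (cos \<theta> ^ 3 / W \<theta>) + g2 \<theta> * (v\<^sup>2 - 2 * W \<theta>)"
    using eventually_cos_pos
  proof eventually_elim
    case (elim \<theta>)
    then show ?case using e_g2_W[of \<theta>] by (simp add: algebra_simps)
  qed
  moreover have "((\<lambda>\<theta>. W' \<theta> * (cos \<theta> ^ 3 / W \<theta>) + g2 \<theta> * (v\<^sup>2 - 2 * W \<theta>)) has_real_derivative q) (at \<theta>s)"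
    using W_deriv[OF cos_neq] W_neq by (auto intro!: derivative_eq_intros d(10,15) simp: v W'_zero q_def)
  ultimately show ?thesis
    by (rule DERIV_unique_eventually)
qed

lemma deriv_relation_F:
  assumes v: "v\<^sup>2 = 2 * W \<theta>s"
  shows "deriv c6 \<theta>s * v\<^sup>2 - 2 * deriv Uc3 \<theta>s = 0"
proof -
  note d = strictly_differentiable_at_\<theta>s[THEN strictly_differentiableD(1)]
  have "((\<lambda>\<theta>. c6 \<theta> * v\<^sup>2 - 2 * Uc3 \<theta>) has_real_derivative deriv c6 \<theta>s * v\<^sup>2 - 2 * deriv Uc3 \<theta>s) (at \<theta>s)"
    by (auto intro!: derivative_eq_intros d)
  moreover have "\<forall>\<^sub>F \<theta> in nhds \<theta>s. c6 \<theta> * v\<^sup>2 - 2 * Uc3 \<theta> = c6 \<theta> * (v\<^sup>2 - 2 * W \<theta>)"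
    using eventually_cos_neq_0[OF cos_neq]
    by eventually_elim (simp add: c6_def Uc3_def U_eq_W eval_nat_numeral algebra_simps)
  moreover have "((\<lambda>\<theta>. c6 \<theta> * (v\<^sup>2 - 2 * W \<theta>)) has_real_derivative 0) (at \<theta>s)"
    using W_deriv[OF cos_neq] by (auto intro!: derivative_eq_intros d(5) simp: v W'_zero)
  ultimately show ?thesis
    by (rule DERIV_unique_eventually)
qed

lemma X_strict_derivative:
  assumes v: "v\<^sup>2 = 2 * W \<theta>s"
  shows "has_strict_derivative X (\<lambda>(dr, dv, dt, dw). (a \<theta>s * v * dr, a \<theta>s * v * dv, dw,
      a \<theta>s * v / 2 * dw + q * dt + 2 * g2 \<theta>s * v * dv + 2 * C\<^sup>2 * g3 \<theta>s * dr)) (0, v, \<theta>s, 0)"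
proof -
  let ?p = "(0, v, \<theta>s, 0) :: state"
  have t: "bounded_linear (\<lambda>x :: state. fst (snd (snd x)))" "fst (snd (snd ?p)) = \<theta>s"
    by (auto intro!: bounded_linear_fst_comp bounded_linear_snd_comp bounded_linear_ident)
  note c = strictly_differentiable_at_\<theta>s[THEN has_strict_derivative_component[OF _ t]]
  note rules = has_strict_derivative_Pair has_strict_derivative_add has_strict_derivative_diff
    has_strict_derivative_mult has_strict_derivative_const has_strict_derivative_projections
  have q: "q = deriv e \<theta>s + deriv g2 \<theta>s * v\<^sup>2" "deriv sU \<theta>s = deriv a \<theta>s * v\<^sup>2 / 2"
    using deriv_relation_w[OF v] deriv_relation_v[OF v] by auto
  show ?thesis
    unfolding X_eq Let_def
    by (rule has_strict_derivative_eq_rhs, (rule c rules)+)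
       (auto simp: fun_eq_iff q power2_eq_square algebra_simps)
qed

lemma F_strict_derivative:
  assumes v: "v\<^sup>2 = 2 * W \<theta>s"
  shows "has_strict_derivative F (\<lambda>(dr, dv, dt, dw). 2 * v * cos \<theta>s ^ 6 * dv + C\<^sup>2 * cos \<theta>s ^ 4 * dr) (0, v, \<theta>s, 0)"
proof -
  let ?p = "(0, v, \<theta>s, 0) :: state"
  have t: "bounded_linear (\<lambda>x :: state. fst (snd (snd x)))" "fst (snd (snd ?p)) = \<theta>s"
    by (auto intro!: bounded_linear_fst_comp bounded_linear_snd_comp bounded_linear_ident)
  note c = strictly_differentiable_at_\<theta>s[THEN has_strict_derivative_component[OF _ t]]
  note rules = has_strict_derivative_Pair has_strict_derivative_add has_strict_derivative_diff
    has_strict_derivative_mult has_strict_derivative_const has_strict_derivative_projections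
  have q: "2 * deriv Uc3 \<theta>s = deriv c6 \<theta>s * v\<^sup>2"
    using deriv_relation_F[OF v] by auto
  show ?thesis
    unfolding F_eq Let_def
    by (rule has_strict_derivative_eq_rhs, (rule c rules)+)
       (auto simp: fun_eq_iff q power2_eq_square c6_def c4_def algebra_simps)
qed



text \<open>
  The coefficient of \<open>- r\<close> in the linearized equation for \<open>w'\<close> on the tangent space, after \<open>dv\<close> has
  been eliminated.
\<close>

definition "slope = C\<^sup>2 * g3 \<theta>s"

lemma tangent_iff:
  assumes v: "v\<^sup>2 = 2 * W \<theta>s"
  shows "(dr, dv, dt, dw) \<in> tangent_space F (0, v, \<theta>s, 0) \<longleftrightarrow> 2 * v * (cos \<theta>s)\<^sup>2 * dv + C\<^sup>2 * dr = 0"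
proof -
  have "2 * v * cos \<theta>s ^ 6 * dv + C\<^sup>2 * cos \<theta>s ^ 4 * dr = cos \<theta>s ^ 4 * (2 * v * (cos \<theta>s)\<^sup>2 * dv + C\<^sup>2 * dr)"
    by (simp add: eval_nat_numeral algebra_simps)
  then show ?thesis
    unfolding tangent_space_def has_strict_derivative_frechet[OF F_strict_derivative[OF v]]
    using cos_neq by simp
qed

lemma g2_g3: "g2 \<theta>s = 3 * (cos \<theta>s)\<^sup>2 * g3 \<theta>s"
  by (simp add: g2_def g3_def eval_nat_numeral)

lemma X_derivative_tangent:
  assumes v: "v\<^sup>2 = 2 * W \<theta>s" and t: "2 * v * (cos \<theta>s)\<^sup>2 * dv + C\<^sup>2 * dr = 0"
  shows "frechet_derivative X (at (0, v, \<theta>s, 0)) (dr, dv, dt, dw) =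
    (a \<theta>s * v * dr, a \<theta>s * v * dv, dw, a \<theta>s * v / 2 * dw + q * dt - slope * dr)"
proof -
  have "2 * g2 \<theta>s * v * dv = 3 * g3 \<theta>s * (2 * v * (cos \<theta>s)\<^sup>2 * dv)" by (simp add: g2_g3)
  also have "2 * v * (cos \<theta>s)\<^sup>2 * dv = - (C\<^sup>2 * dr)" using t by linarith
  finally show ?thesis
    unfolding has_strict_derivative_frechet[OF X_strict_derivative[OF v]]
    by (simp add: slope_def algebra_simps)
qed

text \<open>
  With complex coordinates the linearization on the tangent space is \<open>r' = l r\<close>, \<open>t' = w\<close>,
  \<open>w' = (l/2) w + q t - slope r\<close> for \<open>l = a(\<theta>s) v\<close>.  Either \<open>r \<noteq> 0\<close> and the eigenvalue is \<open>l\<close>, or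
  \<open>r = 0\<close>, and tangency forces \<open>dv = 0\<close>, so that \<open>(t, w)\<close> is an eigenvector of the \<open>2 \<times> 2\<close> block.
\<close>

lemma eigenvalueD:
  assumes v: "v\<^sup>2 = 2 * W \<theta>s" and ev: "level_eigenvalue X F (0, v, \<theta>s, 0) \<zeta>"
  shows "\<zeta> = of_real (a \<theta>s * v) \<or> \<zeta>\<^sup>2 - of_real (a \<theta>s * v / 2) * \<zeta> - of_real q = 0"
proof -
  obtain r1 v1 t1 w1 r2 v2 t2 w2 where
    T: "(r1, v1, t1, w1) \<in> tangent_space F (0, v, \<theta>s, 0)" "(r2, v2, t2, w2) \<in> tangent_space F (0, v, \<theta>s, 0)"
    and nz: "((r1, v1, t1, w1), (r2, v2, t2, w2)) \<noteq> (0, 0)"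
    and L: "frechet_derivative X (at (0, v, \<theta>s, 0)) (r1, v1, t1, w1) = Re \<zeta> *\<^sub>R (r1, v1, t1, w1) - Im \<zeta> *\<^sub>R (r2, v2, t2, w2)"
      "frechet_derivative X (at (0, v, \<theta>s, 0)) (r2, v2, t2, w2) = Im \<zeta> *\<^sub>R (r1, v1, t1, w1) + Re \<zeta> *\<^sub>R (r2, v2, t2, w2)"
    using ev unfolding level_eigenvalue_def Let_def by (metis prod.collapse)
  note T = T[unfolded tangent_iff[OF v]]
  let ?l = "a \<theta>s * v"
  define r t w where "r = Complex r1 r2" and "t = Complex t1 t2" and "w = Complex w1 w2"
  have eq: "of_real ?l * r = \<zeta> * r" "w = \<zeta> * t" "of_real (?l/2) * w + of_real q * t - of_real slope * r = \<zeta> * w"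
    using L T unfolding X_derivative_tangent[OF v T(1)] X_derivative_tangent[OF v T(2)]
    by (auto simp: complex_eq_iff r_def t_def w_def algebra_simps)
  show ?thesis
  proof (cases "r = 0")
    case False
    then show ?thesis using eq(1) by simp
  next
    case True
    then have "r1 = 0" "r2 = 0" by (auto simp: r_def complex_eq_iff)
    moreover have "v \<noteq> 0" using v W_neq by auto
    ultimately have "v1 = 0" "v2 = 0" using T cos_neq by auto
    have "t \<noteq> 0"
    proof
      assume "t = 0"
      with eq have "w = 0" by simp
      with \<open>t = 0\<close> have "t1 = 0" "t2 = 0" "w1 = 0" "w2 = 0" by (auto simp: t_def w_def complex_eq_iff)
      then show False using nz \<open>r1 = 0\<close> \<open>r2 = 0\<close> \<open>v1 = 0\<close> \<open>v2 = 0\<close> by (simp add: zero_prod_def)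
    qed
    moreover have "(\<zeta>\<^sup>2 - of_real (?l/2) * \<zeta> - of_real q) * t = 0"
      using eq True by (simp add: algebra_simps power2_eq_square)
    ultimately show ?thesis by simp
  qed
qed

text \<open>
  The eigenvector is \<open>(0, 0, 1, \<zeta>)\<close>.
\<close>

lemma eigenvalueI:
  assumes v: "v\<^sup>2 = 2 * W \<theta>s" and z: "\<zeta>\<^sup>2 - of_real (a \<theta>s * v / 2) * \<zeta> - of_real q = 0"
  shows "level_eigenvalue X F (0, v, \<theta>s, 0) \<zeta>"
proof -
  let ?l = "a \<theta>s * v" and ?p = "(0, v, \<theta>s, 0) :: state"
  have "Re (\<zeta>\<^sup>2 - of_real (?l/2) * \<zeta> - of_real q) = 0" "Im (\<zeta>\<^sup>2 - of_real (?l/2) * \<zeta> - of_real q) = 0"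
    using z by (metis zero_complex.simps)+
  then have "?l / 2 * Re \<zeta> + q = Re \<zeta> * Re \<zeta> - Im \<zeta> * Im \<zeta>" "?l / 2 * Im \<zeta> = Im \<zeta> * Re \<zeta> + Re \<zeta> * Im \<zeta>"
    by (auto simp: power2_eq_square algebra_simps)
  moreover have "(0, 0, 1, Re \<zeta>) \<in> tangent_space F ?p" "(0, 0, 0, Im \<zeta>) \<in> tangent_space F ?p"
    by (auto simp: tangent_iff[OF v])
  ultimately show ?thesis
    unfolding level_eigenvalue_def Let_def
    by (intro bexI[of _ "(0, 0, 1, Re \<zeta>)"] bexI[of _ "(0, 0, 0, Im \<zeta>)"])
       (auto simp: X_derivative_tangent[OF v] zero_prod_def)
qed

lemma saddle_if:
  assumes v: "v\<^sup>2 = 2 * W \<theta>s" and q: "0 < q"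
  shows "saddle X F (0, v, \<theta>s, 0)"
proof -
  define l where "l = a \<theta>s * v"
  have "v \<noteq> 0" using v W_neq by auto
  then have l: "l \<noteq> 0" using cos_neq U_neq by (simp add: l_def a_def)
  define s where "s = sqrt (l\<^sup>2 / 16 + q)"
  have s: "\<bar>l\<bar> / 4 < s" "s\<^sup>2 = l\<^sup>2 / 16 + q"
    using q real_less_rsqrt[of "\<bar>l\<bar>/4" "l\<^sup>2 / 16 + q"] by (auto simp: s_def power_divide)
  have ev: "level_eigenvalue X F (0, v, \<theta>s, 0) (of_real x)" if "x = l/4 + s \<or> x = l/4 - s" for x
  proof (rule eigenvalueI[OF v, folded l_def])
    have "(x - l/4)\<^sup>2 = s\<^sup>2" using that by auto
    then have "x\<^sup>2 - l / 2 * x - q = 0"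
      using s(2) by (simp add: power2_eq_square algebra_simps)
    then have "complex_of_real (x\<^sup>2 - l / 2 * x - q) = 0" by simp
    then show "(complex_of_real x)\<^sup>2 - of_real (l / 2) * of_real x - of_real q = 0" by simp
  qed
  have "Re \<zeta> \<noteq> 0" if e: "level_eigenvalue X F (0, v, \<theta>s, 0) \<zeta>" for \<zeta>
  proof
    assume re: "Re \<zeta> = 0"
    from eigenvalueD[OF v e, folded l_def] show False
    proof
      assume "\<zeta> = of_real l" then show False using re l by simp
    next
      assume "\<zeta>\<^sup>2 - of_real (l / 2) * \<zeta> - of_real q = 0"
      then have "Re (\<zeta>\<^sup>2 - of_real (l / 2) * \<zeta> - of_real q) = 0" by simp
      then have "- (Im \<zeta>)\<^sup>2 - q = 0" using re by (simp add: power2_eq_square)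
      then show False using q by (smt (verit) zero_le_power2)
    qed
  qed
  moreover have "level_eigenvalue X F (0, v, \<theta>s, 0) (of_real (l/4 + s))" "0 < Re (of_real (l/4 + s))"
    using ev[of "l/4 + s"] s(1) by (simp_all del: of_real_add)
  moreover have "level_eigenvalue X F (0, v, \<theta>s, 0) (of_real (l/4 - s))" "Re (of_real (l/4 - s)) < 0"
    using ev[of "l/4 - s"] s(1) by (simp_all del: of_real_diff)
  ultimately show ?thesis unfolding saddle_def by blast
qed

lemma spiral_eigenvalues:
  assumes v: "v\<^sup>2 = 2 * W \<theta>s" and q: "q < - (a \<theta>s * v)\<^sup>2 / 16"
  shows "\<exists>\<zeta>. level_eigenvalue X F (0, v, \<theta>s, 0) \<zeta> \<and> level_eigenvalue X F (0, v, \<theta>s, 0) (cnj \<zeta>) \<and> Im \<zeta> \<noteq> 0"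
    and "level_eigenvalue X F (0, v, \<theta>s, 0) \<zeta> \<Longrightarrow> Re \<zeta> = a \<theta>s * v \<or> Re \<zeta> = a \<theta>s * v / 4"
proof -
  define l where "l = a \<theta>s * v"
  define s where "s = sqrt (- q - l\<^sup>2 / 16)"
  have s: "0 < s" "s\<^sup>2 = - q - l\<^sup>2 / 16"
    using q by (auto simp: s_def l_def)
  have ev: "level_eigenvalue X F (0, v, \<theta>s, 0) (Complex (l/4) x)" if "x = s \<or> x = - s" for x
  proof (rule eigenvalueI[OF v, folded l_def])
    show "(Complex (l/4) x)\<^sup>2 - of_real (l / 2) * Complex (l/4) x - of_real q = 0"
      using that s(2) by (auto simp: complex_eq_iff power2_eq_square)
  qed
  show "\<exists>\<zeta>. level_eigenvalue X F (0, v, \<theta>s, 0) \<zeta> \<and> level_eigenvalue X F (0, v, \<theta>s, 0) (cnj \<zeta>) \<and> Im \<zeta> \<noteq> 0"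
    using ev s(1) by (intro exI[of _ "Complex (l/4) s"]) (auto simp: complex_cnj)
  assume e: "level_eigenvalue X F (0, v, \<theta>s, 0) \<zeta>"
  from eigenvalueD[OF v e, folded l_def] have "Re \<zeta> = l \<or> Re \<zeta> = l/4"
  proof
    assume z: "\<zeta>\<^sup>2 - of_real (l / 2) * \<zeta> - of_real q = 0"
    then have "Re (\<zeta>\<^sup>2 - of_real (l / 2) * \<zeta> - of_real q) = 0" "Im (\<zeta>\<^sup>2 - of_real (l / 2) * \<zeta> - of_real q) = 0"
      by simp_all
    then have re: "(Re \<zeta>)\<^sup>2 - (Im \<zeta>)\<^sup>2 - l/2 * Re \<zeta> - q = 0" and im: "Im \<zeta> * (2 * Re \<zeta> - l/2) = 0"
      by (auto simp: power2_eq_square algebra_simps)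
    have "Im \<zeta> \<noteq> 0"
    proof
      assume "Im \<zeta> = 0"
      then have "(Re \<zeta> - l/4)\<^sup>2 = - s\<^sup>2" using re s(2) by (simp add: power2_eq_square algebra_simps)
      then show False using s(1) by (smt (verit) zero_le_power2 zero_less_power)
    qed
    then show ?thesis using im by simp
  qed simp
  then show "Re \<zeta> = a \<theta>s * v \<or> Re \<zeta> = a \<theta>s * v / 4" by (simp add: l_def)
qed

lemma a_pos: "0 < a \<theta>s"
  using cos_pos U_pos[of \<theta>s] by (simp add: a_def)

lemma spiral_source_if:
  assumes v: "v\<^sup>2 = 2 * W \<theta>s" "0 < v" and q: "q < - (a \<theta>s * v)\<^sup>2 / 16"
  shows "spiral_source X F (0, v, \<theta>s, 0)"
  using spiral_eigenvalues[OF v(1) q] mult_pos_pos[OF a_pos v(2)] unfolding spiral_source_def by force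

lemma spiral_sink_if:
  assumes v: "v\<^sup>2 = 2 * W \<theta>s" "v < 0" and q: "q < - (a \<theta>s * v)\<^sup>2 / 16"
  shows "spiral_sink X F (0, v, \<theta>s, 0)"
  using spiral_eigenvalues[OF v(1) q] mult_pos_neg[OF a_pos v(2)] unfolding spiral_sink_def by force

end

section \<open>The energy level as a graph\<close>

text \<open>
  The square of \<open>r\<close> satisfies a two-sided linear differential inequality, so that \<open>r\<close> is identically
  zero or never zero.
\<close>

lemma linear_scalar_ode_nonneg:
  fixes r b :: "real \<Rightarrow> real"
  assumes der: "\<And>t. 0 \<le> t \<Longrightarrow> (r has_real_derivative b t * r t) (at t within {0..})"
    and b: "\<And>t. 0 \<le> t \<Longrightarrow> \<bar>b t\<bar> \<le> K" and r0: "0 \<le> r 0" and t: "0 \<le> t"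
  shows "0 \<le> r t"
proof -
  have der2: "((\<lambda>t. (r t)\<^sup>2) has_real_derivative 2 * b t * (r t)\<^sup>2) (at t within {0..})" if "0 \<le> t" for t
    using der[OF that] by (auto intro!: derivative_eq_intros simp: power2_eq_square)
  have b2: "2 * b t * (r t)\<^sup>2 \<le> 2 * K * (r t)\<^sup>2" "- 2 * K * (r t)\<^sup>2 \<le> 2 * b t * (r t)\<^sup>2" if "0 \<le> t" for t
    using b[OF that] by (intro mult_right_mono; simp)+
  show ?thesis
  proof (cases "r 0 = 0")
    case True
    have "(r t)\<^sup>2 \<le> (r 0)\<^sup>2 * exp (2 * K * t)"
      by (rule exp_decay[OF der2 b2(1) t])
    then show ?thesis using True by simp
  next
    case False
    have nz: "r u \<noteq> 0" if "0 \<le> u" for u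
    proof -
      have "(r 0)\<^sup>2 * exp (- 2 * K * (u - 0)) \<le> (r u)\<^sup>2"
        by (rule exp_growth[OF der2 b2(2)]) (use that in auto)
      moreover have "0 < (r 0)\<^sup>2 * exp (- 2 * K * (u - 0))" using False by simp
      ultimately show ?thesis by auto
    qed
    show ?thesis
    proof (rule ccontr)
      assume "\<not> ?thesis"
      moreover have "continuous_on {0..t} r"
        using DERIV_continuous_on[of "{0..}" r "\<lambda>t. b t * r t"] der
        by (auto intro: continuous_on_subset[of "{0..}"])
      ultimately obtain u where "0 \<le> u" "r u = 0"
        using IVT2'[of r t 0 0] r0 t by auto
      then show False using nz by blast
    qed
  qed
qed

text \<open>
  Conservation of energy.  With \<open>c = cos \<theta>\<close>, \<open>sn = sin \<theta>\<close>, \<open>u = sqrt U\<close>, the left-hand side is the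
  derivative of the right-hand side of \<open>e\<close> along the flow, and the claim is that it equals \<open>(v\<^sup>2)'\<close>.
  Off the level the two sides differ by a multiple of \<open>v\<^sup>2\<close> minus the right-hand side of \<open>e\<close>.
\<close>

lemma energy_identity:
  fixes c u :: real
  assumes "c \<noteq> 0" "u \<noteq> 0"
    and e: "v\<^sup>2 = 2 * u\<^sup>2 / c^3 - u\<^sup>2 * w\<^sup>2 / c^6 - C\<^sup>2 * r / c\<^sup>2 + 2 * r\<^sup>2 * V + 2 * h * r^3"
    and Xw: "Xw = c^3 / (2 * u) * v * w + c^6 / u\<^sup>2 * r\<^sup>2 * V' + U' / u\<^sup>2 * (c^3 - w\<^sup>2 / 2) - 3 * sn * c\<^sup>2
      + 3 * sn * c^5 / u\<^sup>2 * (v\<^sup>2 - 2 * h * r^3 - 2 * r\<^sup>2 * V) + 2 * C\<^sup>2 * r * sn * c^3 / u\<^sup>2"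
    and Xr: "Xr = c^3 / u * r * v"
    and Xv: "Xv = c^3 / (2 * u) * v\<^sup>2 - u + r\<^sup>2 * (2 * h * r + V) * c^3 / u"
  shows "2 * ((U' * c + 3 * u\<^sup>2 * sn) / c^4) * w
      - ((U' / c^6 + 6 * u\<^sup>2 * sn / c^7) * w * w\<^sup>2 + u\<^sup>2 / c^6 * (2 * w * Xw))
      - C\<^sup>2 * (Xr / c\<^sup>2 + r * (2 * sn / c^3 * w))
      + 2 * (2 * r * Xr * V + r\<^sup>2 * (V' * w)) + 2 * h * (3 * r\<^sup>2 * Xr) = 2 * v * Xv"
    (is "?L = _")
proof -
  define i where "i = 1 / c"
  define j where "j = 1 / u"
  define b where "b = c^3 / u"
  define P where "P = v\<^sup>2 - 2 * h * r^3 - 2 * r\<^sup>2 * V"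
  define ee where "ee = 2 * u\<^sup>2 * i^3 - u\<^sup>2 * w\<^sup>2 * i^6 - C\<^sup>2 * r * i\<^sup>2 + 2 * r\<^sup>2 * V + 2 * h * r^3"
  have d: "x / c ^ n = x * i ^ n" "x / u ^ n = x * j ^ n" for x n
    using assms(1,2) by (auto simp: i_def j_def power_one_over)
  have e': "v\<^sup>2 = ee" using e unfolding ee_def d .
  have "u\<^sup>2 / c^6 * Xw = u * i^3 * v * w / 2 + r\<^sup>2 * V' + U' * i^3 - U' * i^6 * w\<^sup>2 / 2
      - 3 * sn * u\<^sup>2 * i^4 + 3 * sn * i * P + 2 * C\<^sup>2 * r * sn * i^3"
    unfolding Xw P_def[symmetric] using assms(1,2)
    by (simp add: i_def divide_simps) (simp add: eval_nat_numeral algebra_simps)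
  then have Xw': "u\<^sup>2 / c^6 * (2 * w * Xw) = 2 * w * (u * i^3 * v * w / 2 + r\<^sup>2 * V' + U' * i^3 - U' * i^6 * w\<^sup>2 / 2
      - 3 * sn * u\<^sup>2 * i^4 + 3 * sn * i * P + 2 * C\<^sup>2 * r * sn * i^3)"
    by (metis mult.left_commute)
  have be: "b * ee = 2 * u - u * w\<^sup>2 * i^3 + b * (- C\<^sup>2 * r * i\<^sup>2 + 2 * r\<^sup>2 * V + 2 * h * r^3)"
    unfolding ee_def b_def using assms(1,2)
    by (simp add: i_def divide_simps) (simp add: eval_nat_numeral algebra_simps)
  have U4: "(U' * c + 3 * u\<^sup>2 * sn) / c^4 = U' * i^3 + 3 * u\<^sup>2 * sn * i^4"
    using assms(1) by (simp add: i_def divide_simps) (simp add: eval_nat_numeral algebra_simps)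
  have Xr': "Xr = b * r * v" and Xv': "Xv = b * v\<^sup>2 / 2 - u + r\<^sup>2 * (2 * h * r + V) * b"
    using Xr Xv by (simp_all add: b_def)
  have "?L - 2 * v * Xv = - 6 * sn * i * w * (v\<^sup>2 - ee) + v * b * ee - v * b * v\<^sup>2"
  proof -
    have "?L - 2 * v * Xv = - 6 * sn * i * w * (v\<^sup>2 - ee)
      + v * (2 * u - u * w\<^sup>2 * i^3 + b * (- C\<^sup>2 * r * i\<^sup>2 + 2 * r\<^sup>2 * V + 2 * h * r^3)) - v * b * v\<^sup>2"
      unfolding Xw' U4 unfolding Xr' Xv' d P_def ee_def
      by (simp add: eval_nat_numeral algebra_simps)
    then show ?thesis unfolding be[symmetric] by (simp add: mult.assoc)
  qed
  also have "\<dots> = 0" unfolding e' by simp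
  finally show ?thesis by simp
qed

context critical_point begin

definition "v0 = sqrt (2 * W \<theta>s)"
definition "lam = a \<theta>s * v0"
definition ystar :: "real \<times> real \<times> real" where "ystar = (0, \<theta>s, 0)"
definition "Uc6 \<theta> = U \<theta> / cos \<theta> ^ 6"
definition "i2 \<theta> = 1 / (cos \<theta>)\<^sup>2" for \<theta> :: real
text \<open>
  \<open>E\<close> is the value of \<open>v\<^sup>2\<close> that the energy relation prescribes at \<open>(r, \<theta>, w)\<close>.
\<close>

definition E :: "real \<times> real \<times> real \<Rightarrow> real" where
  "E y = 2 * W (fst (snd y)) - Uc6 (fst (snd y)) * (snd (snd y) * snd (snd y)) - C\<^sup>2 * (fst y * i2 (fst (snd y)))
    + 2 * (fst y * fst y * V (fst (snd y))) + (2 * h) * (fst y * fst y * fst y)"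

lemma v0: "0 < v0" "v0\<^sup>2 = 2 * W \<theta>s" "E ystar = v0\<^sup>2"
proof -
  have W: "0 < W \<theta>s" by (rule W_pos[OF cos_pos])
  then show "0 < v0" "v0\<^sup>2 = 2 * W \<theta>s" by (simp_all add: v0_def)
  then show "E ystar = v0\<^sup>2" by (simp add: E_def ystar_def)
qed

lemma lam_pos: "0 < lam"
  using a_pos v0 by (simp add: lam_def)

lemma F_E:
  assumes "cos t \<noteq> 0"
  shows "F (r, v, t, w) = cos t ^ 6 * (v\<^sup>2 - E (r, t, w))"
proof -
  have c: "Uc3 t = W t * cos t ^ 6" "U t = Uc6 t * cos t ^ 6"
    using assms by (simp_all add: Uc3_def U_eq_W Uc6_def flip: power_add)
  have c4: "c4 t = i2 t * cos t ^ 6"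
    using assms by (simp add: c4_def i2_def nonzero_eq_divide_eq flip: power_add)
  show ?thesis
    unfolding F_eq E_def Let_def fst_conv snd_conv unfolding c c4 c6_def Vc6_def
    by (simp add: algebra_simps power2_eq_square)
qed

lemma E_cont:
  assumes "cos (fst (snd y)) \<noteq> 0"
  shows "isCont E y"
proof -
  have p: "isCont (\<lambda>y :: real \<times> real \<times> real. fst (snd y)) y" by (intro continuous_intros)
  note c = isCont_o2[OF p]
  have "isCont Uc6 (fst (snd y))" "isCont i2 (fst (snd y))"
    unfolding Uc6_def[abs_def] i2_def[abs_def] using assms
    by (auto intro!: continuous_intros DERIV_isCont[OF U_deriv])
  note U = this[THEN c]
  note V = c[OF DERIV_isCont[OF V_deriv[OF assms]]] and W = c[OF DERIV_isCont[OF W_deriv[OF assms]]]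
  show ?thesis
    unfolding E_def[abs_def]
    by (intro continuous_add continuous_diff continuous_mult continuous_const U V W
        continuous_fst continuous_snd continuous_ident)
qed

lemma strictly_differentiable_E_coefficients:
  "strictly_differentiable Uc6 \<theta>s" "strictly_differentiable i2 \<theta>s"
  unfolding Uc6_def[abs_def] i2_def[abs_def]
  using cos_pos by (auto intro!: strictly_differentiable_intros strictly_differentiable_coefficients)

lemma deriv_W: "deriv W \<theta>s = 0"
  using DERIV_imp_deriv[OF W_deriv[OF cos_neq]] W'_zero by simp

lemma E_strict_derivative:
  "has_strict_derivative E (\<lambda>h. - (C\<^sup>2 / (cos \<theta>s)\<^sup>2 * fst h)) ystar"
proof -
  have t: "bounded_linear (\<lambda>x :: real \<times> real \<times> real. fst (snd x))" "fst (snd ystar) = \<theta>s"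
    by (auto intro!: bounded_linear_fst_comp bounded_linear_snd_comp bounded_linear_ident simp: ystar_def)
  note c = strictly_differentiable_at_\<theta>s[THEN has_strict_derivative_component[OF _ t]]
    strictly_differentiable_E_coefficients[THEN has_strict_derivative_component[OF _ t]]
  note rules = has_strict_derivative_Pair has_strict_derivative_add has_strict_derivative_diff
    has_strict_derivative_mult has_strict_derivative_const has_strict_derivative_projections
  show ?thesis
    unfolding E_def[abs_def]
    by (rule has_strict_derivative_eq_rhs, (rule c rules)+)
       (auto simp: fun_eq_iff ystar_def deriv_W i2_def algebra_simps)
qed

lemma sqrt_E_strict_derivative:
  "has_strict_derivative (\<lambda>y. sqrt (E y)) (\<lambda>h. - (C\<^sup>2 / (2 * v0 * (cos \<theta>s)\<^sup>2) * fst h)) ystar"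
proof -
  have E: "0 < E ystar" using v0(1) by (simp add: v0(3))
  have "strictly_differentiable sqrt (E ystar)"
    using strictly_differentiable_sqrt[OF strictly_differentiable_ident E] by simp
  note d = strictly_differentiableD[OF this]
  have "deriv sqrt (E ystar) = inverse (sqrt (E ystar)) / 2"
    using DERIV_unique[OF d(1) DERIV_real_sqrt[OF E]] .
  also have "\<dots> = 1 / (2 * v0)" using v0(1) by (simp add: v0(3) inverse_eq_divide)
  finally have "deriv sqrt (E ystar) = 1 / (2 * v0)" .
  then show ?thesis
    using cos_neq v0(1)
    by (intro has_strict_derivative_eq_rhs[OF has_strict_derivative_chain[OF E_strict_derivative d(2)]])
       (simp add: fun_eq_iff divide_simps)
qed

lemma X_equilibrium:
  assumes "v\<^sup>2 = 2 * W \<theta>s"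
  shows "X (0, v, \<theta>s, 0) = 0"
proof -
  have v: "v * v = 2 * W \<theta>s" using assms by (simp add: power2_eq_square)
  have "a \<theta>s * (v * v) * (1/2) - sU \<theta>s = 0" unfolding v using a_W[OF cos_pos] by simp
  moreover have "e \<theta>s + g2 \<theta>s * (v * v) = 0" unfolding v using e_g2_W[OF cos_pos] W'_zero by simp
  ultimately show ?thesis unfolding X_eq Let_def by (simp add: zero_prod_def)
qed

end

section \<open>The reduced flow\<close>

text \<open>
  All local manifolds in question are stable manifolds of \<open>s X\<close>, where \<open>s = - 1\<close> reverses time, on the
  sheet of the level where \<open>v\<close> has the sign \<open>\<tau>\<close>.  In the coordinates \<open>(r, \<theta>, s w)\<close> the reduced field
  depends on \<open>s\<close> and \<open>\<tau>\<close> through \<open>\<kappa> = - s \<tau>\<close> only: for \<open>\<kappa> = 1\<close> the coordinate \<open>r\<close> contracts, for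
  \<open>\<kappa> = - 1\<close> it expands.
\<close>

locale branch = critical_point +
  fixes s \<tau> :: real
  assumes s: "s = 1 \<or> s = - 1" and \<tau>: "\<tau> = 1 \<or> \<tau> = - 1"
begin

definition \<Lambda>0 :: "real \<times> real \<times> real \<Rightarrow> state" where
  "\<Lambda>0 y = (fst y, \<tau> * sqrt (E y), fst (snd y), s * snd (snd y))"
definition \<rho>0 :: "state \<Rightarrow> real \<times> real \<times> real" where
  "\<rho>0 x = (fst x, fst (snd (snd x)), s * snd (snd (snd x)))"
definition "Red y = \<rho>0 (s *\<^sub>R X (\<Lambda>0 y))"
definition "pt = (0 :: real, \<tau> * v0, \<theta>s, 0 :: real)"
definition "\<kappa> = - s * \<tau>"

lemma ss: "s * s = 1" "s * (s * x) = x" "\<tau> * \<tau> = 1" "\<tau> * (\<tau> * x) = x" "\<tau>\<^sup>2 = 1" "s\<^sup>2 = 1"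
  using s \<tau> by auto

lemma \<rho>0_\<Lambda>0: "\<rho>0 (\<Lambda>0 y) = y"
  by (simp add: \<rho>0_def \<Lambda>0_def ss)

lemma \<rho>0_linear: "bounded_linear \<rho>0"
  unfolding \<rho>0_def[abs_def]
  by (intro bounded_linear_Pair bounded_linear_const_mult bounded_linear_fst bounded_linear_fst_comp
      bounded_linear_snd_comp bounded_linear_ident)

lemma pt_v: "(\<tau> * v0)\<^sup>2 = 2 * W \<theta>s"
  using v0 by (simp add: power_mult_distrib ss)

lemma \<Lambda>0_ystar: "\<Lambda>0 ystar = pt"
  using v0 by (simp add: \<Lambda>0_def ystar_def pt_def E_def v0_def)

lemma Red_ystar: "Red ystar = 0"
  unfolding Red_def \<Lambda>0_ystar pt_def X_equilibrium[OF pt_v]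
  by (simp add: \<rho>0_def zero_prod_def)

lemma \<Lambda>0_strict_derivative:
  "has_strict_derivative \<Lambda>0 (\<lambda>h. (fst h, - \<tau> * C\<^sup>2 / (2 * v0 * (cos \<theta>s)\<^sup>2) * fst h, fst (snd h), s * snd (snd h))) ystar"
proof -
  note rules = has_strict_derivative_Pair sqrt_E_strict_derivative
    has_strict_derivative_mult has_strict_derivative_const has_strict_derivative_projections
  show ?thesis
    unfolding \<Lambda>0_def[abs_def]
    by (rule has_strict_derivative_eq_rhs, (rule rules)+) (auto simp: fun_eq_iff)
qed

lemma Red_strict_derivative:
  "has_strict_derivative Red (\<lambda>h. (- \<kappa> * lam * fst h, snd (snd h),
     - \<kappa> * lam / 2 * snd (snd h) + q * fst (snd h) - slope * fst h)) ystar"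
proof -
  let ?L = "frechet_derivative X (at pt)"
  have X: "has_strict_derivative X ?L (\<Lambda>0 ystar)"
    unfolding \<Lambda>0_ystar pt_def using X_strict_derivative[OF pt_v] has_strict_derivative_frechet[OF X_strict_derivative[OF pt_v]] by simp
  have r: "has_strict_derivative (\<lambda>x. \<rho>0 (s *\<^sub>R x)) (\<lambda>x. \<rho>0 (s *\<^sub>R x)) p" for p
    by (intro has_strict_derivative_linear bounded_linear_compose[OF \<rho>0_linear] bounded_linear_scaleR_right)
  have c: "2 * (\<tau> * v0) * (cos \<theta>s)\<^sup>2 * (- \<tau> * C\<^sup>2 / (2 * v0 * (cos \<theta>s)\<^sup>2) * x) + C\<^sup>2 * x = 0" for x
    using v0 cos_neq \<tau> by (auto simp: field_simps)
  from has_strict_derivative_chain[OF has_strict_derivative_chain[OF \<Lambda>0_strict_derivative X] r]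
  have "has_strict_derivative Red (\<lambda>h. \<rho>0 (s *\<^sub>R ?L (fst h, - \<tau> * C\<^sup>2 / (2 * v0 * (cos \<theta>s)\<^sup>2) * fst h, fst (snd h), s * snd (snd h)))) ystar"
    unfolding Red_def[abs_def] .
  then show ?thesis
    unfolding pt_def X_derivative_tangent[OF pt_v c]
    by (rule has_strict_derivative_eq_rhs)
       (auto simp: fun_eq_iff \<rho>0_def \<kappa>_def lam_def ss algebra_simps)
qed

text \<open>
  Where \<open>E > 0\<close> the sheet is smooth.  The bounds on \<open>r'/r\<close> in terms of its value \<open>lam\<close> at the
  equilibrium, together with \<open>|r| < 1\<close>, make \<open>r\<close> vanish along trajectories if it expands.
\<close>

definition "good y \<longleftrightarrow> (\<bar>fst y\<bar> < 1 \<and> - (pi/2) < fst (snd y) \<and> fst (snd y) < pi/2) \<and>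
     0 < E y \<and> lam / 2 < a (fst (snd y)) * sqrt (E y) \<and> a (fst (snd y)) * sqrt (E y) < 2 * lam"
  for y :: "real \<times> real \<times> real"

lemma eventually_good: "\<forall>\<^sub>F y in nhds ystar. good y"
proof -
  have at: "(f \<longlongrightarrow> f ystar) (nhds ystar)" if "isCont f ystar" for f :: "real \<times> real \<times> real \<Rightarrow> real"
    using that unfolding isCont_def tendsto_at_iff_tendsto_nhds .
  have E: "isCont E ystar" by (rule E_cont) (simp add: ystar_def cos_neq)
  have a: "isCont (\<lambda>y. a (fst (snd y))) ystar"
  proof (rule isCont_o2[where g = a and f = "\<lambda>y. fst (snd y)"])
    show "isCont (\<lambda>y :: real \<times> real \<times> real. fst (snd y)) ystar" by (intro continuous_intros)
    show "isCont a (fst (snd ystar))"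
      using DERIV_isCont[OF strictly_differentiableD(1)[OF strictly_differentiable_at_\<theta>s(1)]]
      by (simp add: ystar_def)
  qed
  have p: "a \<theta>s * sqrt (E ystar) = lam" "0 < E ystar" "fst ystar = 0" "fst (snd ystar) = \<theta>s"
    using v0(1) by (auto simp: v0(3) lam_def) (simp_all add: ystar_def)
  note p = p(3,4,1,2)
  have "isCont (\<lambda>y. a (fst (snd y)) * sqrt (E y)) ystar"
    by (intro continuous_intros a E)
  note l = at[OF this, unfolded p]
  have "isCont (\<lambda>y. fst (snd y)) ystar" "isCont (\<lambda>y. \<bar>fst y\<bar>) ystar" by (intro continuous_intros)+
  note m = at[OF this(1), unfolded p] at[OF this(2), unfolded p]
  show ?thesis
    unfolding good_def
    by (intro eventually_conj order_tendstoD[OF l] order_tendstoD[OF m(1)] order_tendstoD(2)[OF m(2)]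
        order_tendstoD(1)[OF at[OF E] p(4)] \<theta>s) (use lam_pos in auto)
qed

lemma good_cos: "good y \<Longrightarrow> 0 < cos (fst (snd y))"
  unfolding good_def by (intro cos_gt_zero_pi) auto

lemma Red_eq:
  "Red y = (s * fst (X (\<Lambda>0 y)), snd (snd y), snd (snd (snd (X (\<Lambda>0 y)))))"
proof -
  have "fst (snd (snd (X (\<Lambda>0 y)))) = s * snd (snd y)"
    by (simp add: X_eq Let_def \<Lambda>0_def)
  then show ?thesis by (simp add: Red_def \<rho>0_def ss)
qed

lemma Red_fst: "fst (Red y) = (s * \<tau> * (a (fst (snd y)) * sqrt (E y))) * fst y"
  by (simp add: Red_eq X_eq Let_def \<Lambda>0_def)

lemma Uc6_deriv:
  assumes "cos t \<noteq> 0"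
  shows "(Uc6 has_real_derivative U' t / cos t ^ 6 + 6 * U t * sin t / cos t ^ 7) (at t)"
  unfolding Uc6_def[abs_def]
  by (rule derivative_eq_intros U_deriv refl | simp add: assms)+
     (use assms in \<open>simp add: field_simps eval_nat_numeral\<close>)

lemma i2_deriv:
  assumes "cos t \<noteq> 0"
  shows "(i2 has_real_derivative 2 * sin t / cos t ^ 3) (at t)"
  unfolding i2_def[abs_def]
  by (rule derivative_eq_intros refl | simp add: assms)+
     (use assms in \<open>simp add: field_simps eval_nat_numeral\<close>)

text \<open>
  Along the reduced flow \<open>E\<close> changes as \<open>v\<^sup>2\<close> does along the full one, which makes the sheet invariant.
\<close>

lemma E_flow:
  assumes y: "(y has_vector_derivative Red (y x)) (at x within T)"
    and c: "0 < cos (fst (snd (y x)))" and E: "0 < E (y x)"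
  shows "((\<lambda>x. E (y x)) has_real_derivative 2 * (\<tau> * sqrt (E (y x))) * (s * fst (snd (X (\<Lambda>0 (y x)))))) (at x within T)"
proof -
  obtain r t w where yx: "y x = (r, t, w)" by (metis prod.collapse)
  obtain Xr Xv Xt Xw where X: "X (\<Lambda>0 (y x)) = (Xr, Xv, Xt, Xw)" by (metis prod.collapse)
  have c: "0 < cos t" "cos t \<noteq> 0" using c by (simp_all add: yx)
  define u where "u = sqrt (U t)"
  have u: "0 < u" "u \<noteq> 0" "u\<^sup>2 = U t" using U_pos[of t] c by (auto simp: u_def)
  define v where "v = \<tau> * sqrt (E (y x))"
  have X': "Xr = cos t ^ 3 / u * r * v"
    "Xv = cos t ^ 3 / (2 * u) * v\<^sup>2 - u + r\<^sup>2 * (2 * h * r + V t) * cos t ^ 3 / u"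
    "Xw = cos t ^ 3 / (2 * u) * v * (s * w) + cos t ^ 6 / u\<^sup>2 * r\<^sup>2 * V' t + U' t / u\<^sup>2 * (cos t ^ 3 - (s * w)\<^sup>2 / 2) - 3 * sin t * (cos t)\<^sup>2
      + 3 * sin t * cos t ^ 5 / u\<^sup>2 * (v\<^sup>2 - 2 * h * r^3 - 2 * r\<^sup>2 * V t) + 2 * C\<^sup>2 * r * sin t * cos t ^ 3 / u\<^sup>2"
    using X unfolding vector_field_def \<Lambda>0_def u(3) v_def yx deriv_U[symmetric] deriv_V[OF c(2), symmetric]
    by (auto simp: Let_def u_def)
  have R: "Red (y x) = (s * Xr, w, Xw)" by (simp add: Red_eq X) (simp add: yx)
  have dr: "((\<lambda>x. fst (y x)) has_real_derivative s * Xr) (at x within T)"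
    using bounded_linear.has_vector_derivative[OF bounded_linear_fst y]
    by (simp add: R has_real_derivative_iff_has_vector_derivative)
  have dt: "((\<lambda>x. fst (snd (y x))) has_real_derivative w) (at x within T)"
    using bounded_linear.has_vector_derivative[OF bounded_linear_fst_comp[OF bounded_linear_snd] y]
    by (simp add: R has_real_derivative_iff_has_vector_derivative)
  have dw: "((\<lambda>x. snd (snd (y x))) has_real_derivative Xw) (at x within T)"
    using bounded_linear.has_vector_derivative[OF bounded_linear_snd_comp[OF bounded_linear_snd] y]
    by (simp add: R has_real_derivative_iff_has_vector_derivative)
  have tt: "fst (snd (y x)) = t" by (simp add: yx)
  have dW: "((\<lambda>x. W (fst (snd (y x)))) has_real_derivative W' t * w) (at x within T)"
    using DERIV_chain2[of W "W' t" "\<lambda>x. fst (snd (y x))" x w T] W_deriv[OF c(2)] dt by (simp add: tt)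
  have dU: "((\<lambda>x. Uc6 (fst (snd (y x)))) has_real_derivative (U' t / cos t ^ 6 + 6 * u\<^sup>2 * sin t / cos t ^ 7) * w) (at x within T)"
    using DERIV_chain2[of Uc6 "U' t / cos t ^ 6 + 6 * U t * sin t / cos t ^ 7" "\<lambda>x. fst (snd (y x))" x w T] Uc6_deriv[OF c(2)] dt by (simp add: tt u)
  have di: "((\<lambda>x. i2 (fst (snd (y x)))) has_real_derivative 2 * sin t / cos t ^ 3 * w) (at x within T)"
    using DERIV_chain2[of i2 "2 * sin t / cos t ^ 3" "\<lambda>x. fst (snd (y x))" x w T] i2_deriv[OF c(2)] dt by (simp add: tt)
  have dV: "((\<lambda>x. V (fst (snd (y x)))) has_real_derivative V' t * w) (at x within T)"
    using DERIV_chain2[of V "V' t" "\<lambda>x. fst (snd (y x))" x w T] V_deriv[OF c(2)] dt by (simp add: tt)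
  have W't: "W' t = (U' t * cos t + 3 * u\<^sup>2 * sin t) / cos t ^ 4"
    using W'_U'[OF c(2)] c u by (simp add: field_simps)
  have Et: "E (y x) = 2 * u\<^sup>2 / cos t ^ 3 - u\<^sup>2 * (s * w)\<^sup>2 / cos t ^ 6 - C\<^sup>2 * r / (cos t)\<^sup>2 + 2 * r\<^sup>2 * V t + 2 * h * r^3"
  proof -
    have Wt: "W t = u\<^sup>2 / cos t ^ 3" using c(2) by (simp add: u(3) U_eq_W)
    have sw: "(s * w)\<^sup>2 = w * w" by (simp add: power_mult_distrib ss power2_eq_square)
    show ?thesis
      unfolding E_def yx fst_conv snd_conv Uc6_def i2_def u(3)[symmetric] Wt sw
      by (simp add: power2_eq_square power3_eq_cube)
  qed
  have v2: "v\<^sup>2 = E (y x)" using E by (simp add: v_def power_mult_distrib ss)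
  define Ed where "Ed = 2 * (W' t * w) - ((U' t / cos t ^ 6 + 6 * u\<^sup>2 * sin t / cos t ^ 7) * w * w\<^sup>2 + u\<^sup>2 / cos t ^ 6 * (2 * w * Xw))
      - C\<^sup>2 * (s * Xr / (cos t)\<^sup>2 + r * (2 * sin t / cos t ^ 3 * w))
      + 2 * (2 * r * (s * Xr) * V t + r\<^sup>2 * (V' t * w)) + 2 * h * (3 * r\<^sup>2 * (s * Xr))"
  have der: "((\<lambda>x. E (y x)) has_real_derivative Ed) (at x within T)"
    unfolding E_def
    by (rule derivative_eq_intros dr dt dw dW dU di dV refl)+
       (simp add: Ed_def tt, simp add: yx Uc6_def i2_def u(3)[unfolded power2_eq_square] power2_eq_square power3_eq_cube algebra_simps)
  have "s * Ed = 2 * ((U' t * cos t + 3 * u\<^sup>2 * sin t) / cos t ^ 4) * (s * w)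
      - ((U' t / cos t ^ 6 + 6 * u\<^sup>2 * sin t / cos t ^ 7) * (s * w) * (s * w)\<^sup>2 + u\<^sup>2 / cos t ^ 6 * (2 * (s * w) * Xw))
      - C\<^sup>2 * (Xr / (cos t)\<^sup>2 + r * (2 * sin t / cos t ^ 3 * (s * w)))
      + 2 * (2 * r * Xr * V t + r\<^sup>2 * (V' t * (s * w))) + 2 * h * (3 * r\<^sup>2 * Xr)"
    unfolding Ed_def W't[symmetric] using s by (elim disjE) (simp_all add: algebra_simps)
  also have "\<dots> = 2 * v * Xv"
    by (rule energy_identity[OF c(2) u(2) _ X'(3,1,2)]) (simp only: v2 Et)
  finally have "Ed = 2 * v * (s * Xv)" using s by auto
  then show ?thesis using der by (simp add: X v_def)
qed

lemma lift_trajectory: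
  assumes y: "trajectory Red Good {0..} y" and good: "\<And>y. y \<in> Good \<Longrightarrow> good y" and r0: "0 \<le> fst (y 0)"
  shows "trajectory (\<lambda>x. s *\<^sub>R X x) S {0..} (\<lambda>t. \<Lambda>0 (y t))"
  unfolding trajectory_def
proof (intro ballI conjI)
  have g: "good (y t)" if "0 \<le> t" for t using y good that unfolding trajectory_def by auto
  have d: "(y has_vector_derivative Red (y t)) (at t within {0..})" if "0 \<le> t" for t
    using y that unfolding trajectory_def by auto
  fix t :: real assume "t \<in> {0..}"
  then have t: "0 \<le> t" by simp
  have c: "0 < cos (fst (snd (y t)))" and E: "0 < E (y t)"
    using g[OF t] good_cos unfolding good_def by auto
  have "0 \<le> fst (y t)"
  proof (rule linear_scalar_ode_nonneg[where r = "\<lambda>t. fst (y t)" and t = t and K = "2 * lam"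
        and b = "\<lambda>u. s * \<tau> * (a (fst (snd (y u))) * sqrt (E (y u)))"])
    fix u :: real assume u: "0 \<le> u"
    show "((\<lambda>t. fst (y t)) has_real_derivative (s * \<tau> * (a (fst (snd (y u))) * sqrt (E (y u)))) * fst (y u)) (at u within {0..})"
      using bounded_linear.has_vector_derivative[OF bounded_linear_fst d[OF u]]
      by (simp add: Red_fst has_real_derivative_iff_has_vector_derivative)
    have "\<bar>a (fst (snd (y u))) * sqrt (E (y u))\<bar> \<le> 2 * lam"
      using g[OF u] lam_pos unfolding good_def by linarith
    then show "\<bar>s * \<tau> * (a (fst (snd (y u))) * sqrt (E (y u)))\<bar> \<le> 2 * lam"
      using s \<tau> by auto
  qed (use r0 t in auto)
  moreover have "F (\<Lambda>0 (y t)) = 0"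
    using F_E[of "fst (snd (y t))" "fst (y t)" "\<tau> * sqrt (E (y t))" "s * snd (snd (y t))"] c E
    by (simp add: \<Lambda>0_def E_def power_mult_distrib ss)
  ultimately show "\<Lambda>0 (y t) \<in> S"
    using g[OF t] by (simp add: energy_level_def phase_space_def \<Lambda>0_def good_def)
  have dE: "((\<lambda>t. \<tau> * sqrt (E (y t))) has_real_derivative s * fst (snd (X (\<Lambda>0 (y t))))) (at t within {0..})"
  proof -
    have "((\<lambda>t. \<tau> * sqrt (E (y t))) has_real_derivative
        \<tau> * (inverse (sqrt (E (y t))) / 2 * (2 * (\<tau> * sqrt (E (y t))) * (s * fst (snd (X (\<Lambda>0 (y t)))))))) (at t within {0..})"
      by (rule DERIV_cmult, rule DERIV_chain2[where f = sqrt and g = "\<lambda>t. E (y t)"])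
         (intro DERIV_real_sqrt E_flow d t c E)+
    moreover have "sqrt (E (y t)) \<noteq> 0" using E by simp
    moreover have "\<tau> * (inverse q / 2 * (2 * (\<tau> * q) * z)) = z" if "q \<noteq> 0" for q z
      using that \<tau> by (auto simp: field_simps)
    ultimately show ?thesis by metis
  qed
  have R: "Red (y t) = (s * fst (X (\<Lambda>0 (y t))), snd (snd (y t)), snd (snd (snd (X (\<Lambda>0 (y t))))))"
    by (rule Red_eq)
  have r: "((\<lambda>t. fst (y t)) has_vector_derivative s * fst (X (\<Lambda>0 (y t)))) (at t within {0..})"
    using bounded_linear.has_vector_derivative[OF bounded_linear_fst d[OF t]] by (simp add: R)
  have th: "((\<lambda>t. fst (snd (y t))) has_vector_derivative snd (snd (y t))) (at t within {0..})"
    using bounded_linear.has_vector_derivative[OF bounded_linear_fst_comp[OF bounded_linear_snd] d[OF t]] by (simp add: R)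
  have w: "((\<lambda>t. s * snd (snd (y t))) has_vector_derivative s * snd (snd (snd (X (\<Lambda>0 (y t)))))) (at t within {0..})"
    using bounded_linear.has_vector_derivative[OF bounded_linear_const_mult[OF bounded_linear_snd_comp[OF bounded_linear_snd]] d[OF t]]
    by (simp add: R)
  have X3: "fst (snd (snd (X (\<Lambda>0 (y t))))) = s * snd (snd (y t))"
    by (simp add: X_eq Let_def \<Lambda>0_def)
  note v = dE[unfolded has_real_derivative_iff_has_vector_derivative]
  note has_vector_derivative_Pair[OF r has_vector_derivative_Pair[OF v has_vector_derivative_Pair[OF th w]]]
  moreover have "(\<lambda>t. (fst (y t), \<tau> * sqrt (E (y t)), fst (snd (y t)), s * snd (snd (y t)))) = (\<lambda>t. \<Lambda>0 (y t))"
    by (simp add: \<Lambda>0_def)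
  ultimately have "((\<lambda>t. \<Lambda>0 (y t)) has_vector_derivative
     (s * fst (X (\<Lambda>0 (y t))), s * fst (snd (X (\<Lambda>0 (y t)))), snd (snd (y t)), s * snd (snd (snd (X (\<Lambda>0 (y t))))))) (at t within {0..})"
    by metis
  also have "(s * fst (X (\<Lambda>0 (y t))), s * fst (snd (X (\<Lambda>0 (y t)))), snd (snd (y t)), s * snd (snd (snd (X (\<Lambda>0 (y t)))))) = s *\<^sub>R X (\<Lambda>0 (y t))"
    using X3 by (simp add: prod_eq_iff ss)
  finally show "((\<lambda>t. \<Lambda>0 (y t)) has_vector_derivative s *\<^sub>R X (\<Lambda>0 (y t))) (at t within {0..})" .
qed

lemma on_branch:
  assumes "x \<in> S" "good (\<rho>0 x)" "0 < \<tau> * fst (snd x)"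
  shows "\<Lambda>0 (\<rho>0 x) = x"
proof -
  obtain r v t w where x: "x = (r, v, t, w)" by (metis prod.collapse)
  have c: "0 < cos t" and E: "0 < E (\<rho>0 x)" using assms(2) good_cos[OF assms(2)] by (simp_all add: good_def \<rho>0_def x)
  have "E (r, t, w) = E (\<rho>0 x)" 
    using s by (auto simp: E_def \<rho>0_def x)
  then have "v\<^sup>2 = E (\<rho>0 x)"
    using assms(1) F_E[of t r v w] c by (simp add: energy_level_def x)
  then have "\<bar>v\<bar> = sqrt (E (\<rho>0 x))" by (simp flip: real_sqrt_abs)
  moreover have "\<bar>v\<bar> = \<tau> * v" using assms(3) \<tau> by (auto simp: x)
  ultimately have "\<tau> * sqrt (E (\<rho>0 x)) = v" by (metis ss(4))
  then show ?thesis by (simp add: \<Lambda>0_def) (simp add: \<rho>0_def x ss)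
qed

lemma lower_trajectory:
  assumes x: "trajectory (\<lambda>x. s *\<^sub>R X x) (S \<inter> N0) {0..} x"
    and N0: "\<And>x. x \<in> N0 \<Longrightarrow> \<rho>0 x \<in> Good \<and> good (\<rho>0 x) \<and> 0 < \<tau> * fst (snd x)"
  shows "trajectory Red Good {0..} (\<lambda>t. \<rho>0 (x t))" "\<And>t. 0 \<le> t \<Longrightarrow> \<Lambda>0 (\<rho>0 (x t)) = x t"
proof -
  show l: "\<Lambda>0 (\<rho>0 (x t)) = x t" if "0 \<le> t" for t
    using x that N0 unfolding trajectory_def by (intro on_branch) auto
  show "trajectory Red Good {0..} (\<lambda>t. \<rho>0 (x t))"
    unfolding trajectory_def
  proof (intro ballI conjI)
    fix t :: real assume t: "t \<in> {0..}"
    show "\<rho>0 (x t) \<in> Good" using x t N0 unfolding trajectory_def by auto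
    have "(x has_vector_derivative s *\<^sub>R X (x t)) (at t within {0..})"
      using x t unfolding trajectory_def by auto
    from bounded_linear.has_vector_derivative[OF \<rho>0_linear this]
    show "((\<lambda>t. \<rho>0 (x t)) has_vector_derivative Red (\<rho>0 (x t))) (at t within {0..})"
      using l t by (simp add: Red_def)
  qed
qed

section \<open>Dimensions of the local invariant manifolds\<close>

definition DRed :: "real \<times> real \<times> real \<Rightarrow> real \<times> real \<times> real" where
  "DRed \<xi> = (- \<kappa> * lam * fst \<xi>, snd (snd \<xi>),
     - \<kappa> * lam / 2 * snd (snd \<xi>) + q * fst (snd \<xi>) - slope * fst \<xi>)"

text \<open>
  \<open>P\<close> and \<open>R\<close> are linear changes between \<open>(x, z)\<close> and the displacement of \<open>(r, \<theta>, s w)\<close> from the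
  equilibrium.  The range of \<open>P\<close> may be a proper invariant subspace, provided that all trajectories
  near the equilibrium lie in it; this covers \<open>r = 0\<close>.  If nothing expands, \<open>P\<close> ignores \<open>z\<close>, and the
  artificial equation \<open>z' = d z\<close> supplies the expanding direction that the cone argument wants.
\<close>

lemma stable_dim_reduced:
  fixes P :: "'u::euclidean_space \<times> real \<Rightarrow> real \<times> real \<times> real"
    and J :: "'u \<Rightarrow> state" and d c :: real and b :: state
  assumes P: "linear P" and R: "linear R"
    and RP: "\<And>y. fst (R (P y)) = fst y" "\<And>y. \<bar>snd (R (P y))\<bar> \<le> \<bar>snd y\<bar>"
    and PR: "\<And>\<xi>. \<xi> \<in> range P \<Longrightarrow> P (R \<xi>) = \<xi>"
    and invariant: "\<And>y. Red (ystar + P y) \<in> range P"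
    and stay: "\<And>y Good t. trajectory Red Good {0..} y \<Longrightarrow> (\<And>y. y \<in> Good \<Longrightarrow> good y) \<Longrightarrow> 0 \<le> t \<Longrightarrow>
        y t - ystar \<in> range P"
    and d: "\<And>z. P (0, d * z) = 0" "\<And>\<xi>. \<xi> \<in> range P \<Longrightarrow> d * snd (R \<xi>) = 0"
    and c: "0 < c"
    and cone: "\<And>y. c * (norm y)\<^sup>2 \<le> snd y * (snd (R (DRed (P y))) + d * snd y) - fst y \<bullet> fst (R (DRed (P y)))"
    and contr: "\<And>y. \<bar>snd y\<bar> \<le> norm (fst y) \<Longrightarrow> fst y \<bullet> fst (R (DRed (P y))) \<le> - c * (norm (fst y))\<^sup>2"
    and boundary: "\<And>y. 0 \<le> b \<bullet> J (fst y) \<longleftrightarrow> 0 \<le> fst (P y)"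
    and J: "linear J" "linear J'" "\<And>x. J' (J x) = x"
  shows "stable_dim (\<lambda>x. s *\<^sub>R X x) S pt DIM('u)"
proof -
  have bP: "bounded_linear P" and bR: "bounded_linear R"
    using P R by (simp_all add: linear_linear)
  have P0: "P 0 = 0" and R0: "R 0 = 0" and Padd: "\<And>x y. P (x + y) = P x + P y"
    using P R by (simp_all add: linear_0 linear_add)
  obtain Good where Good: "open Good" "ystar \<in> Good" "\<And>y. y \<in> Good \<Longrightarrow> good y"
    using eventually_good unfolding eventually_nhds by blast
  define Y where "Y y = R (Red (ystar + P y)) + (0, d * snd y)" for y
  define L where "L y = R (DRed (P y)) + (0, d * snd y)" for y
  define \<Lambda> where "\<Lambda> y = \<Lambda>0 (ystar + P y)" for y
  define \<Psi> where "\<Psi> x = R (\<rho>0 x - ystar)" for x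
  define N0 where "N0 = {x. \<rho>0 x \<in> Good \<and> 0 < \<tau> * fst (snd x)}"
  have YL: "has_strict_derivative Y L 0"
  proof -
    have 1: "has_strict_derivative (\<lambda>y. ystar + P y) P 0"
      using has_strict_derivative_add[OF has_strict_derivative_const has_strict_derivative_linear[OF bP]] by simp
    have "has_strict_derivative Red DRed (ystar + P 0)"
      using Red_strict_derivative unfolding DRed_def[abs_def] by (simp add: P0)
    from has_strict_derivative_chain[OF has_strict_derivative_chain[OF 1 this] has_strict_derivative_linear[OF bR]]
    have 2: "has_strict_derivative (\<lambda>y. R (Red (ystar + P y))) (\<lambda>y. R (DRed (P y))) 0" .
    have "bounded_linear (\<lambda>y :: 'u \<times> real. (0 :: 'u, d * snd y))"
      by (intro bounded_linear_Pair bounded_linear_zero bounded_linear_const_mult bounded_linear_snd)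
    from has_strict_derivative_add[OF 2 has_strict_derivative_linear[OF this]]
    show ?thesis unfolding Y_def[abs_def] L_def[abs_def] .
  qed
  have Y0: "Y 0 = 0" by (simp add: Y_def P0 Red_ystar R0 flip: zero_prod_def)
  have Pc: "continuous_on UNIV (\<lambda>y. ystar + P y)"
    by (intro continuous_intros linear_continuous_on bP)
  have "open ((\<lambda>y. ystar + P y) -` Good)" "0 \<in> (\<lambda>y. ystar + P y) -` Good"
    using open_vimage[OF Good(1) Pc] Good(2) by (simp_all add: P0)
  then obtain r where r: "0 < r" "ball 0 r \<subseteq> (\<lambda>y. ystar + P y) -` Good"
    unfolding open_contains_ball by blast
  define Box where "Box = (ball 0 (r/2) \<times> ball 0 (r/2) :: ('u \<times> real) set)"
  have Box: "ystar + P y \<in> Good" if "y \<in> Box" for y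
  proof -
    have "norm y < r"
      using that norm_Pair_le[of "fst y" "snd y"] by (simp add: Box_def mem_Times_iff)
    then show ?thesis using r(2) by auto
  qed
  have \<rho>c: "continuous_on A \<rho>0" for A by (rule linear_continuous_on[OF \<rho>0_linear])
  have "continuous_on Good E"
    using E_cont Good(3) good_cos by (intro continuous_at_imp_continuous_on) (metis less_irrefl)
  then have \<Lambda>0c: "continuous_on Good \<Lambda>0"
    unfolding \<Lambda>0_def[abs_def] by (intro continuous_intros)
  have "stable_dim (\<lambda>x. s *\<^sub>R X x) S pt (DIM('u))"
  proof (rule stable_dim_by_coordinates[where Y = Y and L = L and c = c and \<Lambda> = \<Lambda> and \<Psi> = \<Psi>
        and \<delta> = "r/2" and ?N0.0 = N0 and J = J and J' = J' and a = b])
    show "has_strict_derivative Y L 0" "Y 0 = 0" "0 < c" by (fact YL Y0 c)+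
    show "c * (norm y)\<^sup>2 \<le> snd y * snd (L y) - fst y \<bullet> fst (L y)" for y
      using cone[of y] by (simp add: L_def)
    show "fst y \<bullet> fst (L y) \<le> - c * (norm (fst y))\<^sup>2" if "\<bar>snd y\<bar> \<le> norm (fst y)" for y
      using contr[OF that] by (simp add: L_def)
    show "0 < r/2" using r by simp
    show "continuous_on (ball 0 (r/2) \<times> ball 0 (r/2)) \<Lambda>"
      unfolding \<Lambda>_def using Box
      by (intro continuous_on_compose2[OF \<Lambda>0c] continuous_on_subset[OF Pc]) (auto simp: Box_def)
    show "\<Lambda> 0 = pt" by (simp add: \<Lambda>_def P0 \<Lambda>0_ystar)
    show "continuous_on UNIV \<Psi>"
      unfolding \<Psi>_def
      by (intro continuous_on_compose2[OF linear_continuous_on[OF bR, of UNIV]] continuous_intros \<rho>c) auto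
    show "fst (\<Psi> (\<Lambda> y)) = fst y" "\<bar>snd (\<Psi> (\<Lambda> y))\<bar> \<le> \<bar>snd y\<bar>" for y
      by (simp_all add: \<Psi>_def \<Lambda>_def \<rho>0_\<Lambda>0 RP)
    have "N0 = \<rho>0 -` Good \<inter> {x. 0 < \<tau> * fst (snd x)}" by (auto simp: N0_def)
    then show "open N0"
      by (auto intro!: open_Int open_vimage[OF Good(1) \<rho>c] open_Collect_less continuous_intros)
    have "\<rho>0 pt = ystar" by (simp add: \<Lambda>0_ystar[symmetric] \<rho>0_\<Lambda>0)
    then show "pt \<in> N0" using Good(2) v0(1) by (simp add: N0_def pt_def ss)
    show "linear J" "linear J'" "J' (J x) = x" for x by (fact J)+
  next
    fix \<gamma> assume \<gamma>: "trajectory (\<lambda>x. s *\<^sub>R X x) (S \<inter> N0) {0..} \<gamma>"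
    have N0: "\<rho>0 x \<in> Good \<and> good (\<rho>0 x) \<and> 0 < \<tau> * fst (snd x)" if "x \<in> N0" for x
      using that Good(3) by (simp add: N0_def)
    note l = lower_trajectory[OF \<gamma> N0]
    have P\<Psi>: "P (\<Psi> (\<gamma> t)) = \<rho>0 (\<gamma> t) - ystar" and d0: "d * snd (\<Psi> (\<gamma> t)) = 0" if "0 \<le> t" for t
      using PR d(2) stay[OF l(1) Good(3) that] by (simp_all add: \<Psi>_def)
    have "trajectory Y UNIV {0..} (\<lambda>t. \<Psi> (\<gamma> t))"
      unfolding trajectory_def
    proof (intro ballI conjI)
      fix t :: real assume t: "t \<in> {0..}"
      have "((\<lambda>t. \<rho>0 (\<gamma> t) - ystar) has_vector_derivative Red (\<rho>0 (\<gamma> t))) (at t within {0..})"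
        using l(1) t unfolding trajectory_def by (auto intro!: derivative_eq_intros)
      from bounded_linear.has_vector_derivative[OF bR this]
      moreover have "Y (\<Psi> (\<gamma> t)) = R (Red (\<rho>0 (\<gamma> t)))"
      proof -
        have "(0 :: 'u, d * snd (\<Psi> (\<gamma> t))) = 0" using d0[of t] t by (auto simp: zero_prod_def)
        then show ?thesis unfolding Y_def using P\<Psi>[of t] t by simp
      qed
      ultimately show "((\<lambda>t. \<Psi> (\<gamma> t)) has_vector_derivative Y (\<Psi> (\<gamma> t))) (at t within {0..})"
        by (simp add: \<Psi>_def)
    qed simp
    moreover have "\<Lambda> (\<Psi> (\<gamma> 0)) = \<gamma> 0"
      using P\<Psi>[of 0] l(2)[of 0] by (simp add: \<Lambda>_def)
    moreover have "0 \<le> b \<bullet> J (fst (\<Psi> (\<gamma> 0)))"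
    proof -
      have "\<gamma> 0 \<in> S" using \<gamma> unfolding trajectory_def by auto
      then have "0 \<le> fst (\<gamma> 0)" by (auto simp: energy_level_def phase_space_def)
      then show ?thesis unfolding boundary P\<Psi>[OF order_refl] by (simp add: \<rho>0_def ystar_def)
    qed
    ultimately show "trajectory Y UNIV {0..} (\<lambda>t. \<Psi> (\<gamma> t)) \<and> \<Lambda> (\<Psi> (\<gamma> 0)) = \<gamma> 0 \<and> 0 \<le> b \<bullet> J (fst (\<Psi> (\<gamma> 0)))"
      by blast
  next
    fix \<gamma> assume \<gamma>: "trajectory Y (ball 0 (r/2) \<times> ball 0 (r/2)) {0..} \<gamma>" and b: "0 \<le> b \<bullet> J (fst (\<gamma> 0))"
    have "trajectory Red Good {0..} (\<lambda>t. ystar + P (\<gamma> t))"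
      unfolding trajectory_def
    proof (intro ballI conjI)
      fix t :: real assume t: "t \<in> {0..}"
      have g: "\<gamma> t \<in> Box" "(\<gamma> has_vector_derivative Y (\<gamma> t)) (at t within {0..})"
        using \<gamma> t unfolding trajectory_def Box_def by auto
      show "ystar + P (\<gamma> t) \<in> Good" by (rule Box[OF g(1)])
      have "P (Y (\<gamma> t)) = Red (ystar + P (\<gamma> t))"
        unfolding Y_def Padd PR[OF invariant] d(1) by simp
      then show "((\<lambda>t. ystar + P (\<gamma> t)) has_vector_derivative Red (ystar + P (\<gamma> t))) (at t within {0..})"
        using bounded_linear.has_vector_derivative[OF bP g(2)] by (auto intro!: derivative_eq_intros)
    qed
    moreover have "0 \<le> fst (ystar + P (\<gamma> 0))" using b unfolding boundary by (simp add: ystar_def)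
    ultimately show "trajectory (\<lambda>x. s *\<^sub>R X x) S {0..} (\<lambda>t. \<Lambda> (\<gamma> t))"
      unfolding \<Lambda>_def by (intro lift_trajectory Good(3))
  qed
  then show ?thesis .
qed

text \<open>
  The coordinates \<open>\<theta>\<close> and \<open>(s w + (lam/4) \<theta>) / \<beta>\<close> turn the \<open>2 \<times> 2\<close> block into \<open>- lam/4\<close> times the
  identity plus a rotation, for which the Euclidean norm decreases.
\<close>

lemma stable_dim_spiral:
  assumes \<kappa>: "\<kappa> = 1" and slope: "slope = 0" and q: "q < - lam\<^sup>2 / 16"
  shows "stable_dim (\<lambda>x. s *\<^sub>R X x) S pt 3"
proof -
  define \<beta> where "\<beta> = sqrt (- q - lam\<^sup>2 / 16)"
  have \<beta>: "0 < \<beta>" "\<beta> \<noteq> 0" "\<beta> * \<beta> = - q - lam\<^sup>2 / 16" using q by (auto simp: \<beta>_def)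
  define P :: "(real \<times> real \<times> real) \<times> real \<Rightarrow> real \<times> real \<times> real"
    where "P y = (fst (fst y), fst (snd (fst y)), \<beta> * snd (snd (fst y)) - lam / 4 * fst (snd (fst y)))" for y
  define R :: "real \<times> real \<times> real \<Rightarrow> (real \<times> real \<times> real) \<times> real"
    where "R \<xi> = ((fst \<xi>, fst (snd \<xi>), (snd (snd \<xi>) + lam / 4 * fst (snd \<xi>)) / \<beta>), 0)" for \<xi>
  define J :: "real \<times> real \<times> real \<Rightarrow> state" where "J x = (fst x, fst (snd x), snd (snd x), 0)" for x
  define J' :: "state \<Rightarrow> real \<times> real \<times> real" where "J' x = (fst x, fst (snd x), fst (snd (snd x)))" for x
  have L: "R (DRed (P ((r, \<xi>, \<eta>), z))) = ((- lam * r, \<beta> * \<eta> - lam / 4 * \<xi>, - lam / 4 * \<eta> - \<beta> * \<xi>), 0)" for r \<xi> \<eta> z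
  proof -
    have "(- lam / 2 * (\<beta> * \<eta> - lam / 4 * \<xi>) + q * \<xi> + lam / 4 * (\<beta> * \<eta> - lam / 4 * \<xi>))
        = - lam / 4 * \<eta> * \<beta> - (- q - lam\<^sup>2 / 16) * \<xi>" by (simp add: field_simps power2_eq_square)
    also have "\<dots> = \<beta> * (- lam / 4 * \<eta> - \<beta> * \<xi>)" unfolding \<beta>(3)[symmetric] by (simp add: algebra_simps)
    finally show ?thesis using \<beta>(2) by (simp add: R_def DRed_def P_def \<kappa> slope)
  qed
  have "stable_dim (\<lambda>x. s *\<^sub>R X x) S pt DIM(real \<times> real \<times> real)"
  proof (rule stable_dim_reduced[where P = P and R = R and J = J and J' = J' and d = "lam/4" and c = "lam/4"
        and b = "(1, 0, 0, 0)"])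
    show "linear P" "linear R" "linear J" "linear J'"
      by (auto intro!: linearI simp: P_def R_def J_def J'_def algebra_simps add_divide_distrib)
    show "fst (R (P y)) = fst y" "\<bar>snd (R (P y))\<bar> \<le> \<bar>snd y\<bar>" for y
      using \<beta> by (simp_all add: P_def R_def)
    have PR: "P (R \<xi>) = \<xi>" for \<xi> using \<beta> by (simp add: P_def R_def)
    then show "P (R \<xi>) = \<xi>" for \<xi> .
    have "range P = UNIV" using PR by (metis surjI)
    then show "Red (ystar + P y) \<in> range P" "y' t - ystar \<in> range P" for y y' and t :: real by simp_all
    show "P (0, lam/4 * z) = 0" for z by (simp add: P_def zero_prod_def)
    show "lam/4 * snd (R \<xi>) = 0" for \<xi> by (simp add: R_def)
    show "0 < lam/4" using lam_pos by simp
    show "0 \<le> (1, 0, 0, 0) \<bullet> J (fst y) \<longleftrightarrow> 0 \<le> fst (P y)" for y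
      by (simp add: J_def P_def inner_prod_def)
    show "J' (J x) = x" for x by (simp add: J_def J'_def)
  next
    fix y :: "(real \<times> real \<times> real) \<times> real"
    obtain r \<xi> \<eta> z where y: "y = ((r, \<xi>, \<eta>), z)" by (metis prod.collapse)
    define rr xx hh zz where "rr = lam * (r * r)" and "xx = lam * (\<xi> * \<xi>)" and "hh = lam * (\<eta> * \<eta>)" and "zz = lam * (z * z)"
    have dot: "fst y \<bullet> fst (R (DRed (P y))) = - rr - xx / 4 - hh / 4"
      unfolding y L by (simp add: inner_prod_def rr_def xx_def hh_def field_simps)
    have nrm: "lam/4 * (norm (fst y))\<^sup>2 = (rr + xx + hh) / 4" "lam/4 * (norm y)\<^sup>2 = (rr + xx + hh + zz) / 4"
      by (simp_all add: y power2_norm_eq_inner inner_prod_def rr_def xx_def hh_def zz_def field_simps)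
    have snd: "snd y * (snd (R (DRed (P y))) + lam/4 * snd y) = zz / 4"
      unfolding y L by (simp add: zz_def)
    have pos: "0 \<le> rr" using lam_pos by (simp add: rr_def)
    show "fst y \<bullet> fst (R (DRed (P y))) \<le> - (lam/4) * (norm (fst y))\<^sup>2"
      unfolding dot mult_minus_left nrm using pos by (simp add: field_simps)
    show "lam/4 * (norm y)\<^sup>2 \<le> snd y * (snd (R (DRed (P y))) + lam/4 * snd y) - fst y \<bullet> fst (R (DRed (P y)))"
      unfolding dot nrm snd using pos by (simp add: field_simps)
  qed
  then show ?thesis by (simp add: numeral_3_eq_3)
qed

text \<open>
  The eigenvalues of the \<open>2 \<times> 2\<close> block are \<open>- \<kappa> lam/4 \<plusminus> sqrt (lam\<^sup>2/16 + q)\<close>, of opposite sign by the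
  following bound.
\<close>

lemma saddle_rate: "0 < q \<Longrightarrow> lam / 4 < sqrt (lam\<^sup>2 / 16 + q)"
  by (rule real_less_rsqrt) (simp add: power_divide)

text \<open>
  \<open>(\<theta>, s w)\<close> is written in the eigenvectors \<open>(1, \<alpha>')\<close> and \<open>(1, \<alpha>)\<close> of the block.  The term \<open>slope r\<close>
  couples \<open>r\<close> to both; measuring \<open>r\<close> in the unit \<open>\<eta>\<close> makes this coupling as weak as desired,
  whatever coincidences occur among the eigenvalues.
\<close>

lemma stable_dim_saddle_2:
  assumes \<kappa>: "\<kappa> = 1" and q: "0 < q"
  shows "stable_dim (\<lambda>x. s *\<^sub>R X x) S pt 2"
proof -
  define k where "k = sqrt (lam\<^sup>2 / 16 + q)"
  have "0 < lam\<^sup>2 / 16 + q" using q by (intro add_nonneg_pos) auto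
  then have k: "lam / 4 < k" "k * k = lam\<^sup>2 / 16 + q" "k \<noteq> 0" "0 < k"
    using saddle_rate[OF q] by (auto simp: k_def)
  define \<alpha> \<alpha>' where "\<alpha> = - lam / 4 + k" and "\<alpha>' = - lam / 4 - k"
  have \<alpha>: "0 < \<alpha>" "\<alpha>' < 0" "\<alpha> - \<alpha>' = 2 * k"
    using k lam_pos by (auto simp: \<alpha>_def \<alpha>'_def)
  have root: "\<alpha> * \<alpha> = q - lam / 2 * \<alpha>" "\<alpha>' * \<alpha>' = q - lam / 2 * \<alpha>'"
    using k(2) by (auto simp: \<alpha>_def \<alpha>'_def algebra_simps power2_eq_square)
  define m where "m = min lam (min \<alpha> (- \<alpha>'))"
  have m: "0 < m" "m \<le> lam" "m \<le> \<alpha>" "m \<le> - \<alpha>'" using lam_pos \<alpha> by (auto simp: m_def)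
  \<comment> \<open>Small enough for the coupling \<open>\<epsilon>\<close> to be at most a quarter of the weakest rate \<open>m\<close>.\<close>
  define \<eta> where "\<eta> = m * (2 * k) / (4 * (\<bar>slope\<bar> + 1))"
  have \<eta>: "0 < \<eta>" "\<eta> \<noteq> 0" using m k by (auto simp: \<eta>_def)
  define \<epsilon> where "\<epsilon> = slope * \<eta> / (2 * k)"
  have \<epsilon>: "\<bar>\<epsilon>\<bar> \<le> m / 4"
  proof -
    have "\<bar>\<epsilon>\<bar> = m / 4 * (\<bar>slope\<bar> / (\<bar>slope\<bar> + 1))"
      using m(1) k by (simp add: \<epsilon>_def \<eta>_def abs_mult)
    also have "\<dots> \<le> m / 4 * 1" using m(1) by (intro mult_left_mono) (auto simp: field_simps)
    finally show ?thesis by simp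
  qed
  define P :: "(real \<times> real) \<times> real \<Rightarrow> real \<times> real \<times> real"
    where "P y = (\<eta> * fst (fst y), snd (fst y) + snd y, \<alpha>' * snd (fst y) + \<alpha> * snd y)" for y
  define R :: "real \<times> real \<times> real \<Rightarrow> (real \<times> real) \<times> real"
    where "R \<xi> = ((fst \<xi> / \<eta>, (\<alpha> * fst (snd \<xi>) - snd (snd \<xi>)) / (2 * k)), (snd (snd \<xi>) - \<alpha>' * fst (snd \<xi>)) / (2 * k))" for \<xi>
  define J :: "real \<times> real \<Rightarrow> state" where "J x = (fst x, snd x, 0, 0)" for x
  define J' :: "state \<Rightarrow> real \<times> real" where "J' x = (fst x, fst (snd x))" for x
  have L: "R (DRed (P ((r, \<sigma>), z))) = ((- lam * r, \<alpha>' * \<sigma> + \<epsilon> * r), \<alpha> * z - \<epsilon> * r)" for r \<sigma> z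
  proof -
    have 1: "- lam / 2 * (\<alpha>' * \<sigma> + \<alpha> * z) + q * (\<sigma> + z) = \<alpha>' * \<alpha>' * \<sigma> + \<alpha> * \<alpha> * z"
      unfolding root by (simp add: algebra_simps)
    define u where "u = \<alpha>' * \<alpha>' * \<sigma> + \<alpha> * \<alpha> * z - slope * (\<eta> * r)"
    have "\<alpha> * (\<alpha>' * \<sigma> + \<alpha> * z) - u = (\<alpha> - \<alpha>') * (\<alpha>' * \<sigma>) + slope * \<eta> * r"
      "u - \<alpha>' * (\<alpha>' * \<sigma> + \<alpha> * z) = (\<alpha> - \<alpha>') * (\<alpha> * z) - slope * \<eta> * r"
      by (simp_all add: u_def algebra_simps)
    then have u: "(\<alpha> * (\<alpha>' * \<sigma> + \<alpha> * z) - u) / (2 * k) = \<alpha>' * \<sigma> + \<epsilon> * r"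
      "(u - \<alpha>' * (\<alpha>' * \<sigma> + \<alpha> * z)) / (2 * k) = \<alpha> * z - \<epsilon> * r"
      using k(3) by (simp_all add: \<epsilon>_def \<alpha>(3) add_divide_distrib diff_divide_distrib)
    have "DRed (P ((r, \<sigma>), z)) = (- lam * (\<eta> * r), \<alpha>' * \<sigma> + \<alpha> * z, u)"
      using 1 by (simp add: DRed_def P_def \<kappa> u_def)
    then show ?thesis using \<eta>(2) by (simp add: R_def u)
  qed
  have "stable_dim (\<lambda>x. s *\<^sub>R X x) S pt DIM(real \<times> real)"
  proof (rule stable_dim_reduced[where P = P and R = R and J = J and J' = J' and d = 0 and c = "m/2"
        and b = "(1, 0, 0, 0)"])
    show "linear P" "linear R" "linear J" "linear J'"
      by (auto intro!: linearI simp: P_def R_def J_def J'_def algebra_simps add_divide_distrib diff_divide_distrib)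
    have RP: "R (P y) = y" for y
    proof -
      have "\<alpha> * (snd (fst y) + snd y) - (\<alpha>' * snd (fst y) + \<alpha> * snd y) = (\<alpha> - \<alpha>') * snd (fst y)"
        "\<alpha>' * snd (fst y) + \<alpha> * snd y - \<alpha>' * (snd (fst y) + snd y) = (\<alpha> - \<alpha>') * snd y"
        by (simp_all add: algebra_simps)
      then show ?thesis using \<eta>(2) k by (simp add: P_def R_def \<alpha>(3))
    qed
    then show "fst (R (P y)) = fst y" "\<bar>snd (R (P y))\<bar> \<le> \<bar>snd y\<bar>" for y by simp_all
    have PR: "P (R \<xi>) = \<xi>" for \<xi>
    proof -
      have "\<alpha> * t - w + (w - \<alpha>' * t) = (\<alpha> - \<alpha>') * t" "\<alpha>' * (\<alpha> * t - w) + \<alpha> * (w - \<alpha>' * t) = (\<alpha> - \<alpha>') * w" for t w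
        by (simp_all add: algebra_simps)
      then show ?thesis using \<eta>(2) k by (simp add: P_def R_def \<alpha>(3) flip: add_divide_distrib)
    qed
    then show "P (R \<xi>) = \<xi>" for \<xi> .
    have "range P = UNIV" using PR by (metis surjI)
    then show "Red (ystar + P y) \<in> range P" "y' t - ystar \<in> range P" for y y' and t :: real by simp_all
    show "P (0, 0 * z) = 0" for z by (simp add: P_def zero_prod_def)
    show "0 * snd (R \<xi>) = 0" for \<xi> by simp
    show "0 < m/2" using m by simp
    show "0 \<le> (1, 0, 0, 0) \<bullet> J (fst y) \<longleftrightarrow> 0 \<le> fst (P y)" for y
      using \<eta> by (simp add: J_def P_def inner_prod_def zero_le_mult_iff)
    show "J' (J x) = x" for x by (simp add: J_def J'_def)
  next
    fix y :: "(real \<times> real) \<times> real"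
    obtain r \<sigma> z where y: "y = ((r, \<sigma>), z)" by (metis prod.collapse)
    have cross: "\<bar>\<epsilon> * (r * x)\<bar> \<le> m / 4 * ((r * r + x * x) / 2)" for x
    proof -
      have "0 \<le> (\<bar>r\<bar> - \<bar>x\<bar>)\<^sup>2" by simp
      then have "\<bar>r\<bar> * \<bar>x\<bar> \<le> (r * r + x * x) / 2" by (simp add: power2_eq_square algebra_simps)
      then show ?thesis unfolding abs_mult using \<epsilon> m(1) by (intro mult_mono) auto
    qed
    have dot: "fst y \<bullet> fst (R (DRed (P y))) = - lam * (r * r) + \<alpha>' * (\<sigma> * \<sigma>) + \<epsilon> * (r * \<sigma>)"
      unfolding y L by (simp add: inner_prod_def algebra_simps)
    have snd: "snd y * (snd (R (DRed (P y))) + 0 * snd y) = \<alpha> * (z * z) - \<epsilon> * (r * z)"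
      unfolding y L by (simp add: algebra_simps)
    define rr ss zz where "rr = m * (r * r)" and "ss = m * (\<sigma> * \<sigma>)" and "zz = m * (z * z)"
    have le: "rr \<le> lam * (r * r)" "ss \<le> - \<alpha>' * (\<sigma> * \<sigma>)" "zz \<le> \<alpha> * (z * z)"
      unfolding rr_def ss_def zz_def using m by (intro mult_right_mono; simp)+
    have pos: "0 \<le> rr" "0 \<le> ss" "0 \<le> zz" using m by (simp_all add: rr_def ss_def zz_def)
    have cross: "\<bar>\<epsilon> * (r * \<sigma>)\<bar> \<le> (rr + ss) / 8" "\<bar>\<epsilon> * (r * z)\<bar> \<le> (rr + zz) / 8"
      using cross[of \<sigma>] cross[of z] by (simp_all add: rr_def ss_def zz_def field_simps)
    have nrm: "m/2 * (norm (fst y))\<^sup>2 = (rr + ss) / 2" "m/2 * (norm y)\<^sup>2 = (rr + ss + zz) / 2"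
      by (simp_all add: y power2_norm_eq_inner inner_prod_def rr_def ss_def zz_def field_simps)
    define \<epsilon>1 \<epsilon>2 l1 l2 l3 where "\<epsilon>1 = \<epsilon> * (r * \<sigma>)" and "\<epsilon>2 = \<epsilon> * (r * z)"
      and "l1 = lam * (r * r)" and "l2 = \<alpha>' * (\<sigma> * \<sigma>)" and "l3 = \<alpha> * (z * z)"
    note defs = \<epsilon>1_def[symmetric] \<epsilon>2_def[symmetric] l1_def[symmetric] l2_def[symmetric] l3_def[symmetric]
    note le = le[unfolded mult_minus_left defs] and cross = cross[unfolded defs]
    show "fst y \<bullet> fst (R (DRed (P y))) \<le> - (m/2) * (norm (fst y))\<^sup>2"
      unfolding dot mult_minus_left nrm defs using le pos abs_le_D1[OF cross(1)] abs_le_D1[OF cross(2)] by (simp add: field_simps)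
    show "m/2 * (norm y)\<^sup>2 \<le> snd y * (snd (R (DRed (P y))) + 0 * snd y) - fst y \<bullet> fst (R (DRed (P y)))"
      unfolding dot snd mult_minus_left nrm defs using le pos abs_le_D1[OF cross(1)] abs_le_D1[OF cross(2)] by (simp add: field_simps)
  qed
  then show ?thesis by (simp add: numeral_2_eq_2)
qed

text \<open>
  For \<open>\<kappa> = - 1\<close> the coordinate \<open>r\<close> expands at least at the rate \<open>lam/2\<close>, so that \<open>r = 0\<close> on every
  trajectory that stays near the equilibrium, and only the \<open>2 \<times> 2\<close> block remains.
\<close>

lemma stable_dim_saddle_1:
  assumes \<kappa>: "\<kappa> = - 1" and q: "0 < q"
  shows "stable_dim (\<lambda>x. s *\<^sub>R X x) S pt 1"
proof -
  define k where "k = sqrt (lam\<^sup>2 / 16 + q)"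
  have "0 < lam\<^sup>2 / 16 + q" using q by (intro add_nonneg_pos) auto
  then have k: "lam / 4 < k" "k * k = lam\<^sup>2 / 16 + q" "k \<noteq> 0" "0 < k"
    using saddle_rate[OF q] by (auto simp: k_def)
  define \<alpha> \<alpha>' where "\<alpha> = lam / 4 + k" and "\<alpha>' = lam / 4 - k"
  have \<alpha>: "0 < \<alpha>" "\<alpha>' < 0" "\<alpha> - \<alpha>' = 2 * k"
    using k lam_pos by (auto simp: \<alpha>_def \<alpha>'_def)
  have root: "\<alpha> * \<alpha> = q + lam / 2 * \<alpha>" "\<alpha>' * \<alpha>' = q + lam / 2 * \<alpha>'"
    using k(2) by (auto simp: \<alpha>_def \<alpha>'_def algebra_simps power2_eq_square)
  define m where "m = min \<alpha> (- \<alpha>')"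
  have m: "0 < m" "m \<le> \<alpha>" "m \<le> - \<alpha>'" using \<alpha> by (auto simp: m_def)
  define P :: "real \<times> real \<Rightarrow> real \<times> real \<times> real"
    where "P y = (0, fst y + snd y, \<alpha>' * fst y + \<alpha> * snd y)" for y
  define R :: "real \<times> real \<times> real \<Rightarrow> real \<times> real"
    where "R \<xi> = ((\<alpha> * fst (snd \<xi>) - snd (snd \<xi>)) / (2 * k), (snd (snd \<xi>) - \<alpha>' * fst (snd \<xi>)) / (2 * k))" for \<xi>
  define J :: "real \<Rightarrow> state" where "J x = (x, 0, 0, 0)" for x
  define J' :: "state \<Rightarrow> real" where "J' x = fst x" for x
  have L: "R (DRed (P (\<sigma>, z))) = (\<alpha>' * \<sigma>, \<alpha> * z)" for \<sigma> z
  proof -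
    have 1: "lam / 2 * (\<alpha>' * \<sigma> + \<alpha> * z) + q * (\<sigma> + z) = \<alpha>' * \<alpha>' * \<sigma> + \<alpha> * \<alpha> * z"
      unfolding root by (simp add: algebra_simps)
    have "\<alpha> * (\<alpha>' * \<sigma> + \<alpha> * z) - (\<alpha>' * \<alpha>' * \<sigma> + \<alpha> * \<alpha> * z) = (\<alpha> - \<alpha>') * (\<alpha>' * \<sigma>)"
      "\<alpha>' * \<alpha>' * \<sigma> + \<alpha> * \<alpha> * z - \<alpha>' * (\<alpha>' * \<sigma> + \<alpha> * z) = (\<alpha> - \<alpha>') * (\<alpha> * z)"
      by (simp_all add: algebra_simps)
    then show ?thesis
      using k 1 by (simp add: R_def DRed_def P_def \<kappa> \<alpha>(3))
  qed
  have PR: "P (R \<xi>) = \<xi>" if "fst \<xi> = 0" for \<xi>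
  proof -
    have "\<alpha> * t - w + (w - \<alpha>' * t) = (\<alpha> - \<alpha>') * t" "\<alpha>' * (\<alpha> * t - w) + \<alpha> * (w - \<alpha>' * t) = (\<alpha> - \<alpha>') * w" for t w
      by (simp_all add: algebra_simps)
    then show ?thesis using k that by (simp add: P_def R_def \<alpha>(3) prod_eq_iff flip: add_divide_distrib)
  qed
  have rangeP: "\<xi> \<in> range P \<longleftrightarrow> fst \<xi> = 0" for \<xi>
    using PR[of \<xi>] by (metis P_def fst_conv rangeE rangeI)
  have "stable_dim (\<lambda>x. s *\<^sub>R X x) S pt DIM(real)"
  proof (rule stable_dim_reduced[where P = P and R = R and J = J and J' = J' and d = 0 and c = m and b = 0])
    show "linear P" "linear R" "linear J" "linear J'"
      by (auto intro!: linearI simp: P_def R_def J_def J'_def algebra_simps add_divide_distrib diff_divide_distrib)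
    have RP: "R (P y) = y" for y
    proof -
      have "\<alpha> * (fst y + snd y) - (\<alpha>' * fst y + \<alpha> * snd y) = (\<alpha> - \<alpha>') * fst y"
        "\<alpha>' * fst y + \<alpha> * snd y - \<alpha>' * (fst y + snd y) = (\<alpha> - \<alpha>') * snd y"
        by (simp_all add: algebra_simps)
      then show ?thesis using k by (simp add: P_def R_def \<alpha>(3))
    qed
    then show "fst (R (P y)) = fst y" "\<bar>snd (R (P y))\<bar> \<le> \<bar>snd y\<bar>" for y by simp_all
    show "P (R \<xi>) = \<xi>" if "\<xi> \<in> range P" for \<xi>
      using PR rangeP that by blast
    show "Red (ystar + P y) \<in> range P" for y
      unfolding rangeP by (simp add: Red_fst ystar_def P_def)
    show "P (0, 0 * z) = 0" for z by (simp add: P_def zero_prod_def)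
    show "0 * snd (R \<xi>) = 0" for \<xi> by simp
    show "0 < m" by (fact m)
    show "0 \<le> 0 \<bullet> J (fst y) \<longleftrightarrow> 0 \<le> fst (P y)" for y by (simp add: P_def)
    show "J' (J x) = x" for x by (simp add: J_def J'_def)
  next
    fix y Good and t :: real
    assume y: "trajectory Red Good {0..} y" and good: "\<And>y. y \<in> Good \<Longrightarrow> good y" and t: "0 \<le> t"
    have g: "good (y u)" "(y has_vector_derivative Red (y u)) (at u within {0..})" if "0 \<le> u" for u
      using y good that unfolding trajectory_def by auto
    let ?b = "\<lambda>u. a (fst (snd (y u))) * sqrt (E (y u))"
    have der: "((\<lambda>u. (fst (y u))\<^sup>2) has_real_derivative 2 * ?b u * (fst (y u))\<^sup>2) (at u within {0..})" if "0 \<le> u" for u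
    proof -
      have "s * \<tau> = 1" using \<kappa> by (simp add: \<kappa>_def)
      then have "((\<lambda>u. fst (y u)) has_real_derivative ?b u * fst (y u)) (at u within {0..})"
        using bounded_linear.has_vector_derivative[OF bounded_linear_fst g(2)[OF that]]
        by (simp add: Red_fst has_real_derivative_iff_has_vector_derivative)
      then show ?thesis by (auto intro!: derivative_eq_intros simp: power2_eq_square)
    qed
    have grow: "lam * (fst (y u))\<^sup>2 \<le> 2 * ?b u * (fst (y u))\<^sup>2" if "0 \<le> u" for u
      using g(1)[OF that] unfolding good_def by (intro mult_right_mono) auto
    have "fst (y t) = 0"
    proof (rule ccontr)
      assume nz: "fst (y t) \<noteq> 0"
      define x where "x = (fst (y t))\<^sup>2"
      have x: "0 < x" using nz by (simp add: x_def)
      \<comment> \<open>After time \<open>T\<close> the lower bound \<open>x (1 + lam T) = x + 1\<close> for \<open>r\<^sup>2\<close> contradicts \<open>|r| < 1\<close>.\<close>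
      define T where "T = 1 / (x * lam)"
      have T: "0 < T" using x lam_pos by (simp add: T_def)
      have "1 + lam * T \<le> exp (lam * T)" by (rule exp_ge_add_one_self)
      then have "x * (1 + lam * T) \<le> x * exp (lam * T)" using x by (intro mult_left_mono) auto
      also have "\<dots> \<le> (fst (y (t + T)))\<^sup>2"
        using exp_growth[OF der grow t, of "t + T"] T by (simp add: x_def)
      also have "\<dots> \<le> 1"
        using g(1)[of "t + T"] t T unfolding good_def by (simp add: abs_square_le_1)
      finally have "x * (1 + lam * T) \<le> 1" .
      moreover have "x * (1 + lam * T) = x + 1" using x lam_pos by (simp add: T_def distrib_left)
      ultimately show False using x by simp
    qed
    then show "y t - ystar \<in> range P" by (simp add: rangeP ystar_def)
  next
    fix y :: "real \<times> real"
    obtain \<sigma> z where y: "y = (\<sigma>, z)" by (metis prod.collapse)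
    have le: "m * (\<sigma> * \<sigma>) \<le> - \<alpha>' * (\<sigma> * \<sigma>)" "m * (z * z) \<le> \<alpha> * (z * z)"
      using m by (intro mult_right_mono; simp)+
    show "fst y \<bullet> fst (R (DRed (P y))) \<le> - m * (norm (fst y))\<^sup>2"
      unfolding y L using le by (simp add: power2_eq_square algebra_simps)
    show "m * (norm y)\<^sup>2 \<le> snd y * (snd (R (DRed (P y))) + 0 * snd y) - fst y \<bullet> fst (R (DRed (P y)))"
      unfolding y L using le by (simp add: power2_norm_eq_inner inner_prod_def algebra_simps)
  qed
  then show ?thesis by simp
qed

end

context critical_point begin

lemma unstable_dim_from_reversed:
  "stable_dim (\<lambda>x. (- 1) *\<^sub>R X x) S p n \<Longrightarrow> unstable_dim X S p n"
  by (simp add: unstable_dim_eq_stable_dim)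

lemma spiral_dims:
  assumes "slope = 0" "q < - lam\<^sup>2 / 16"
  shows "unstable_dim X S (0, v0, \<theta>s, 0) 3" "stable_dim X S (0, - v0, \<theta>s, 0) 3"
proof -
  interpret p: branch A A1 B B1 M m h C \<theta>s "-1" 1 by unfold_locales auto
  show "unstable_dim X S (0, v0, \<theta>s, 0) 3"
    using p.stable_dim_spiral[OF _ assms] unstable_dim_from_reversed by (simp add: p.\<kappa>_def p.pt_def)
  interpret n: branch A A1 B B1 M m h C \<theta>s 1 "-1" by unfold_locales auto
  show "stable_dim X S (0, - v0, \<theta>s, 0) 3"
    using n.stable_dim_spiral[OF _ assms] by (simp add: n.\<kappa>_def n.pt_def)
qed

lemma saddle_dims:
  assumes "0 < q"
  shows "unstable_dim X S (0, v0, \<theta>s, 0) 2" "stable_dim X S (0, v0, \<theta>s, 0) 1"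
    and "stable_dim X S (0, - v0, \<theta>s, 0) 2" "unstable_dim X S (0, - v0, \<theta>s, 0) 1"
proof -
  interpret a: branch A A1 B B1 M m h C \<theta>s "-1" 1 by unfold_locales auto
  show "unstable_dim X S (0, v0, \<theta>s, 0) 2"
    using a.stable_dim_saddle_2[OF _ assms] unstable_dim_from_reversed by (simp add: a.\<kappa>_def a.pt_def)
  interpret b: branch A A1 B B1 M m h C \<theta>s 1 1 by unfold_locales auto
  show "stable_dim X S (0, v0, \<theta>s, 0) 1"
    using b.stable_dim_saddle_1[OF _ assms] by (simp add: b.\<kappa>_def b.pt_def)
  interpret c: branch A A1 B B1 M m h C \<theta>s 1 "-1" by unfold_locales auto
  show "stable_dim X S (0, - v0, \<theta>s, 0) 2"
    using c.stable_dim_saddle_2[OF _ assms] by (simp add: c.\<kappa>_def c.pt_def)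
  interpret d: branch A A1 B B1 M m h C \<theta>s "-1" "-1" by unfold_locales auto
  show "unstable_dim X S (0, - v0, \<theta>s, 0) 1"
    using d.stable_dim_saddle_1[OF _ assms] unstable_dim_from_reversed by (simp add: d.\<kappa>_def d.pt_def)
qed

lemma lam_squared: "lam\<^sup>2 = 2 * cos \<theta>s ^ 3"
proof -
  have "lam\<^sup>2 = (a \<theta>s)\<^sup>2 * (2 * W \<theta>s)" by (simp add: lam_def power_mult_distrib v0)
  also have "(a \<theta>s)\<^sup>2 = (cos \<theta>s ^ 3)\<^sup>2 / U \<theta>s"
    using U_pos[of \<theta>s] cos_pos by (simp add: a_def power_divide)
  also have "(cos \<theta>s ^ 3)\<^sup>2 / U \<theta>s * (2 * W \<theta>s) = 2 * cos \<theta>s ^ 3"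
  proof -
    have "x\<^sup>2 / (y * x) * (2 * y) = 2 * x" if "x \<noteq> 0" "y \<noteq> 0" for x y :: real
      using that by (simp add: power2_eq_square)
    then show ?thesis using W_neq cos_neq by (simp only: U_eq_W power_not_zero not_False_eq_True)
  qed
  finally show ?thesis .
qed

lemma on_collision_manifold:
  assumes "v\<^sup>2 = 2 * W \<theta>s"
  shows "(0, v, \<theta>s, 0) \<in> collision_manifold B B1 M m"
proof -
  have c6: "cos \<theta>s ^ 6 = (cos \<theta>s ^ 3)\<^sup>2" by simp
  have "x\<^sup>2 / (y * x) * (2 * y) = 2 * x" if "x \<noteq> 0" "y \<noteq> 0" for x y :: real
    using that by (simp add: power2_eq_square)
  then have "cos \<theta>s ^ 6 / U \<theta>s * v\<^sup>2 = 2 * cos \<theta>s ^ 3"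
    using W_neq cos_neq unfolding assms c6 by (simp only: U_eq_W power_not_zero not_False_eq_True)
  then show ?thesis
    using \<theta>s by (simp add: collision_manifold_def phase_space_def)
qed

end

section \<open>Critical points of the potential and the classification\<close>

context isosceles begin

lemma W_even: "W (- \<theta>) = W \<theta>" and W'_odd: "W' (- \<theta>) = - W' \<theta>"
  by (simp_all add: W_alt W'_def K_def D_def)

text \<open>
  As \<open>cos \<theta>\<close> increases, \<open>1 / cos\<^sup>5 \<theta>\<close> and \<open>D\<close> both decrease.
\<close>

lemma K_strict_mono:
  assumes "0 < cos x" "cos x < cos y"
  shows "K y < K x"
proof -
  have "cos x ^ 5 < cos y ^ 5" using assms by (intro power_strict_mono) auto
  then have "B / cos y ^ 5 < B / cos x ^ 5"
    using assms pos by (intro divide_strict_left_mono mult_pos_pos) auto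
  moreover have "D y powr (-5/2) \<ge> D x powr (-5/2)"
  proof (rule powr_mono2')
    have "(cos x)\<^sup>2 \<le> (cos y)\<^sup>2" using assms by (intro power_mono) auto
    then show "D y \<le> D x" using nu_pos by (simp add: D_def sin_squared_eq)
  qed (use D_pos in auto)
  then have "16 * B1 * \<nu> * D x powr (-5/2) \<le> 16 * B1 * \<nu> * D y powr (-5/2)"
    using nu_pos pos by (intro mult_left_mono) auto
  ultimately show ?thesis by (simp add: K_def)
qed

lemma W'_deriv_at_zero_of_K:
  assumes "cos x \<noteq> 0" "K x = 0"
  shows "deriv W' x = 3 * k * (sin x)\<^sup>2 * cos x * (5 * B / cos x ^ 6 + 80 * B1 * \<nu>\<^sup>2 * cos x * D x powr (-7/2))"
proof -
  have dK: "(K has_real_derivative sin x * (5 * B / cos x ^ 6 + 80 * B1 * \<nu>\<^sup>2 * cos x * D x powr (-7/2))) (at x)"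
    unfolding K_def[abs_def]
    by (rule derivative_eq_intros D_powr_deriv refl | simp add: assms)+
       (use assms in \<open>simp add: field_simps eval_nat_numeral\<close>)
  have "((\<lambda>x. 3 * k * sin x * cos x) has_real_derivative deriv (\<lambda>x. 3 * k * sin x * cos x) x) (at x)"
    by (intro strictly_differentiableD(1) strictly_differentiable_intros)
  from DERIV_mult[OF this dK] show ?thesis
    unfolding W'_def[abs_def] using assms
    by (intro DERIV_imp_deriv) (simp add: power2_eq_square algebra_simps)
qed

lemma W'_deriv_at_0: "deriv W' 0 = 3 * k * (B - 16 * B1 * \<nu>)"
proof -
  have "((\<lambda>x. 3 * k * sin x * cos x) has_real_derivative 3 * k) (at 0)"
    by (auto intro!: derivative_eq_intros)
  moreover have "strictly_differentiable K 0"
    unfolding K_def[abs_def] using D_pos[of 0]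
    by (auto intro!: strictly_differentiable_intros strictly_differentiable_D)
  ultimately have "((\<lambda>x. 3 * k * sin x * cos x * K x) has_real_derivative 3 * k * K 0 + deriv K 0 * (3 * k * sin 0 * cos 0)) (at 0)"
    by (intro DERIV_mult strictly_differentiableD)
  then show ?thesis
    unfolding W'_def[abs_def] by (intro DERIV_imp_deriv) (simp add: K_def D_def)
qed

end

locale isosceles_large_mu = isosceles +
  assumes large: "1 + B / (16 * B1) < mu M m"
begin

abbreviation "\<theta>w \<equiv> theta_w B B1 M m"

lemma \<theta>w: "0 < \<theta>w" "\<theta>w < pi/2" "0 < cos \<theta>w" "0 < sin \<theta>w"
  using theta_w(1,2)[OF pos(5,6,3,4) large] by (auto intro!: cos_gt_zero_pi sin_gt_zero)

text \<open>
  \<open>\<theta>\<^sub>w\<close> is defined so that \<open>D = \<kappa> cos\<^sup>2\<close> there, with \<open>\<kappa>\<^sup>5 = (\<nu> 16 B1 / B)\<^sup>2\<close>.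
\<close>

lemma K_\<theta>w: "K \<theta>w = 0"
proof -
  define c where "c = cos \<theta>w"
  define \<kappa> where "\<kappa> = \<nu> powr (2/5) * (16 * B1 / B) powr (2/5)"
  have \<kappa>: "0 < \<kappa>" using nu_pos pos by (simp add: \<kappa>_def)
  have c: "0 < c" using \<theta>w by (simp add: c_def)
  have mu: "mu M m = 1 + \<nu>" by (simp add: \<nu>_def)
  have "c = sqrt ((1 + \<nu>) / (\<nu> + \<kappa>))"
    unfolding c_def theta_w(3)[OF pos(5,6,3,4) large] \<kappa>_def mu by simp
  then have c2: "c\<^sup>2 = (1 + \<nu>) / (\<nu> + \<kappa>)" using nu_pos \<kappa> by simp
  have "D \<theta>w = 1 + \<nu> - \<nu> * c\<^sup>2" by (simp add: D_def c_def sin_squared_eq algebra_simps)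
  also have "\<dots> = \<kappa> * c\<^sup>2" unfolding c2 using nu_pos \<kappa> by (simp add: field_simps)
  finally have D: "D \<theta>w = \<kappa> * c\<^sup>2" .
  have "\<kappa> powr (5/2) = \<nu> * (16 * B1 / B)"
    unfolding \<kappa>_def using nu_pos pos by (simp add: powr_mult powr_powr)
  moreover have "(c\<^sup>2) powr (5/2) = c ^ 5"
    using c by (simp add: powr_powr flip: powr_numeral powr_realpow)
  ultimately have "D \<theta>w powr (5/2) = \<nu> * (16 * B1 / B) * c ^ 5"
    unfolding D using \<kappa> by (simp add: powr_mult)
  then have "D \<theta>w powr (-5/2) = 1 / (\<nu> * (16 * B1 / B) * c ^ 5)"
    by (simp add: powr_minus_divide)
  then show ?thesis
    unfolding K_def c_def[symmetric] using nu_pos pos c by (simp add: field_simps)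
qed

lemma critical_points:
  assumes "- (pi/2) < \<theta>" "\<theta> < pi/2"
  shows "W' \<theta> = 0 \<longleftrightarrow> \<theta> \<in> {0, \<theta>w, - \<theta>w}"
proof
  have c: "0 < cos \<theta>" using assms by (intro cos_gt_zero_pi) auto
  assume "W' \<theta> = 0"
  then consider "sin \<theta> = 0" | "K \<theta> = 0" using c k_pos by (auto simp: W'_def)
  then show "\<theta> \<in> {0, \<theta>w, - \<theta>w}"
  proof cases
    case 1
    have "0 < sin \<theta>" if "0 < \<theta>" using that assms by (intro sin_gt_zero) auto
    moreover have "0 < sin (- \<theta>)" if "\<theta> < 0" using that assms by (intro sin_gt_zero) auto
    ultimately show ?thesis using 1 by (cases "\<theta> = 0") (auto simp: neq_iff)
  next
    case 2
    have "cos \<theta> = cos \<theta>w"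
      using K_strict_mono[OF c, of \<theta>w] K_strict_mono[OF \<theta>w(3), of \<theta>] 2 K_\<theta>w
      by (cases "cos \<theta>" "cos \<theta>w" rule: linorder_cases) auto
    then have cos: "cos \<bar>\<theta>\<bar> = cos \<theta>w" by (simp only: cos_abs_real)
    have "\<bar>\<theta>\<bar> \<le> pi" "0 \<le> \<theta>w" "\<theta>w \<le> pi"
      using assms \<theta>w(1,2) pi_gt_zero unfolding abs_le_iff by linarith+
    from cos_inj_pi[OF abs_ge_zero this cos] have "\<bar>\<theta>\<bar> = \<theta>w" .
    then have "\<theta> = \<theta>w \<or> \<theta> = - \<theta>w" unfolding abs_if by (simp split: if_splits)
    then show ?thesis by simp
  qed
next
  assume "\<theta> \<in> {0, \<theta>w, - \<theta>w}"
  then show "W' \<theta> = 0" using K_\<theta>w by (auto simp: W'_odd) (simp_all add: W'_def)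
qed

sublocale Q: critical_point A A1 B B1 M m h C 0
  using critical_points[of 0] by unfold_locales auto

lemma critical_point_\<theta>w: "\<sigma> \<in> {1, -1} \<Longrightarrow> critical_point A A1 B B1 M m (\<sigma> * \<theta>w)"
  using critical_points[of "\<sigma> * \<theta>w"] \<theta>w by unfold_locales auto

text \<open>
  At \<open>\<theta> = \<plusminus>\<pi>/2\<close> there is no equilibrium, since \<open>v' = - sqrt U \<noteq> 0\<close> there.
\<close>

lemma equilibria:
  "{p \<in> collision_manifold B B1 M m. X p = 0} =
    {(0, sqrt (2 * W 0), 0, 0), (0, - sqrt (2 * W 0), 0, 0),
     (0, sqrt (2 * W \<theta>w), 1 * \<theta>w, 0), (0, sqrt (2 * W \<theta>w), -1 * \<theta>w, 0),
     (0, - sqrt (2 * W \<theta>w), 1 * \<theta>w, 0), (0, - sqrt (2 * W \<theta>w), -1 * \<theta>w, 0)}" (is "?A = ?B")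
proof (intro equalityI subsetI)
  fix p assume "p \<in> ?A"
  then have p: "p \<in> collision_manifold B B1 M m" "X p = 0" by auto
  then obtain v \<theta> w where p_eq: "p = (0, v, \<theta>, w)" and \<theta>: "- (pi/2) \<le> \<theta>" "\<theta> \<le> pi/2"
    by (auto simp: collision_manifold_def phase_space_def)
  note X0 = p(2)[unfolded p_eq X_eq Let_def zero_prod_def]
  have w: "w = 0" using X0 by simp
  have cn: "0 \<le> cos \<theta>" using \<theta> by (intro cos_ge_zero) auto
  have U: "0 < U \<theta>" by (rule U_pos[OF cn])
  have av: "a \<theta> * (v * v) = 2 * sU \<theta>" using X0 by simp
  have "cos \<theta> \<noteq> 0" using av U by (auto simp: a_def sU_def)
  then have c: "0 < cos \<theta>" using cn by simp
  have "\<theta> \<noteq> pi/2" "\<theta> \<noteq> - (pi/2)" using c cos_pi_half by fastforce+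
  then have \<theta>': "- (pi/2) < \<theta>" "\<theta> < pi/2" using \<theta> by auto
  have "a \<theta> * (v * v) = a \<theta> * (2 * W \<theta>)" using av a_W[OF c] by simp
  moreover have "a \<theta> \<noteq> 0" using c U by (simp add: a_def)
  ultimately have v: "v * v = 2 * W \<theta>" by simp
  have "e \<theta> + g2 \<theta> * (v * v) = 0" using X0 w by simp
  then have "W' \<theta> * (cos \<theta> ^ 3 / W \<theta>) = 0" using e_g2_W[OF c] v by (simp add: mult.assoc mult.left_commute)
  then have "W' \<theta> = 0" using c W_pos[OF c] by simp
  then have "\<theta> \<in> {0, \<theta>w, - \<theta>w}" using critical_points[OF \<theta>'] by simp
  moreover have "v = sqrt (2 * W \<theta>) \<or> v = - sqrt (2 * W \<theta>)"
    unfolding v[symmetric] by auto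
  ultimately show "p \<in> ?B" using w by (auto simp: p_eq W_even)
next
  fix p assume "p \<in> ?B"
  have eq: "(0, v, \<theta>, 0) \<in> ?A" if "critical_point A A1 B B1 M m \<theta>" "v\<^sup>2 = 2 * W \<theta>" for v \<theta>
    using critical_point.on_collision_manifold[OF that] critical_point.X_equilibrium[OF that] by simp
  have W: "0 < W 0" "0 < W \<theta>w" using W_pos \<theta>w by auto
  have "\<exists>v \<theta>. p = (0, v, \<theta>, 0) \<and> \<theta> \<in> {0, 1 * \<theta>w, -1 * \<theta>w} \<and> v\<^sup>2 = 2 * W \<theta>"
    using \<open>p \<in> ?B\<close> W by (auto simp: W_even)
  then obtain v \<theta> where p: "p = (0, v, \<theta>, 0)" "\<theta> \<in> {0, 1 * \<theta>w, -1 * \<theta>w}" "v\<^sup>2 = 2 * W \<theta>"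
    by blast
  have "critical_point A A1 B B1 M m \<theta>"
    using p(2) Q.critical_point_axioms critical_point_\<theta>w[of 1] critical_point_\<theta>w[of "-1"] by fastforce
  then show "p \<in> ?A" unfolding p(1) using p(3) by (rule eq)
qed

text \<open>
  The assumption is the inequality \<open>q < - 1/8\<close> at \<open>\<theta> = 0\<close>, cleared of denominators.
\<close>

lemma classification:
  assumes \<nu>: "25 * B + 16 * B1 < 384 * B1 * \<nu>"
  shows "let Q = (0, sqrt (2 * W 0), 0, 0);
         Q' = (0, - sqrt (2 * W 0), 0, 0);
         E = (\<lambda>\<sigma>. (0, sqrt (2 * W \<theta>w), \<sigma> * \<theta>w, 0));
         E' = (\<lambda>\<sigma>. (0, - sqrt (2 * W \<theta>w), \<sigma> * \<theta>w, 0))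
     in {p \<in> collision_manifold B B1 M m. X p = 0} = {Q, Q', E 1, E (-1), E' 1, E' (-1)} \<and>
        spiral_source X F Q \<and> unstable_dim X S Q 3 \<and>
        spiral_sink X F Q' \<and> stable_dim X S Q' 3 \<and>
        (\<forall>\<sigma> \<in> {1, -1}.
           saddle X F (E \<sigma>) \<and> unstable_dim X S (E \<sigma>) 2 \<and> stable_dim X S (E \<sigma>) 1 \<and>
           saddle X F (E' \<sigma>) \<and> stable_dim X S (E' \<sigma>) 2 \<and> unstable_dim X S (E' \<sigma>) 1)"
proof -
  have v0: "Q.v0\<^sup>2 = 2 * W 0" "(- Q.v0)\<^sup>2 = 2 * W 0" "0 < Q.v0" "- Q.v0 < 0"
    using Q.v0 by simp_all
  have slope: "Q.slope = 0" by (simp add: Q.slope_def g3_def)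
  have q: "Q.q < - Q.lam\<^sup>2 / 16"
  proof -
    have "W 0 = k * (B + 16 * B1)" by (simp add: W_alt D_def)
    then have "Q.q = 3 * (B - 16 * B1 * \<nu>) / (B + 16 * B1)"
      using k_pos by (simp add: Q.q_def W'_deriv_at_0)
    moreover have "3 * (B - 16 * B1 * \<nu>) < - 1 / 8 * (B + 16 * B1)"
      using \<nu> by (simp add: algebra_simps)
    then have "3 * (B - 16 * B1 * \<nu>) / (B + 16 * B1) < - 1 / 8"
      using pos by (subst pos_divide_less_eq) auto
    ultimately show ?thesis
      unfolding Q.lam_squared by simp
  qed
  have lam: "(a 0 * Q.v0)\<^sup>2 = Q.lam\<^sup>2" "(a 0 * - Q.v0)\<^sup>2 = Q.lam\<^sup>2"
    by (simp_all add: Q.lam_def)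
  have Q: "spiral_source X F (0, Q.v0, 0, 0)" "spiral_sink X F (0, - Q.v0, 0, 0)"
    by (rule Q.spiral_source_if[OF v0(1,3)] Q.spiral_sink_if[OF v0(2,4)], simp only: lam q)+
  have E: "saddle X F (0, sqrt (2 * W \<theta>w), \<sigma> * \<theta>w, 0) \<and>
      unstable_dim X S (0, sqrt (2 * W \<theta>w), \<sigma> * \<theta>w, 0) 2 \<and>
      stable_dim X S (0, sqrt (2 * W \<theta>w), \<sigma> * \<theta>w, 0) 1 \<and>
      saddle X F (0, - sqrt (2 * W \<theta>w), \<sigma> * \<theta>w, 0) \<and>
      stable_dim X S (0, - sqrt (2 * W \<theta>w), \<sigma> * \<theta>w, 0) 2 \<and>
      unstable_dim X S (0, - sqrt (2 * W \<theta>w), \<sigma> * \<theta>w, 0) 1" if \<sigma>: "\<sigma> \<in> {1, -1}" for \<sigma>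
  proof -
    interpret E: critical_point A A1 B B1 M m h C "\<sigma> * \<theta>w" by (rule critical_point_\<theta>w[OF \<sigma>])
    have "W (\<sigma> * \<theta>w) = W \<theta>w" using \<sigma> by (auto simp: W_even)
    then have v0: "E.v0 = sqrt (2 * W \<theta>w)" by (simp add: E.v0_def)
    have v2: "E.v0\<^sup>2 = 2 * W (\<sigma> * \<theta>w)" "(- E.v0)\<^sup>2 = 2 * W (\<sigma> * \<theta>w)" using E.v0(2) by simp_all
    have K: "K (\<sigma> * \<theta>w) = 0" and "sin (\<sigma> * \<theta>w) \<noteq> 0" using \<sigma> K_\<theta>w \<theta>w by (auto simp: K_def D_def)
    then have "0 < deriv W' (\<sigma> * \<theta>w)"
      unfolding W'_deriv_at_zero_of_K[OF E.cos_neq K]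
      using k_pos E.cos_pos pos by (intro mult_pos_pos add_pos_nonneg) auto
    then have q: "0 < E.q"
      unfolding E.q_def using E.cos_pos W_pos[OF E.cos_pos] by simp
    show ?thesis
      using E.saddle_if[OF v2(1) q] E.saddle_if[OF v2(2) q] E.saddle_dims[OF q] unfolding v0 by blast
  qed
  show ?thesis
    unfolding Let_def
    using equilibria Q Q.spiral_dims[OF slope q] E unfolding Q.v0_def by blast
qed

end

theorem proposition4:
  fixes A A1 B B1 :: real
  assumes "A > 0" and "A1 > 0" and "B > 0" and "B1 > 0"
  shows "\<exists>\<mu>0>1. \<forall>M m h C.
    M > 0 \<longrightarrow> m > 0 \<longrightarrow>
    mu M m > \<mu>0 \<longrightarrow>
    mu M m > 1 + A / (4 * A1) \<longrightarrow>
    mu M m > 1 + B / (16 * B1) \<longrightarrow>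
    (mu M m - 1) powr (4/15) * (4 * A1 / A) powr (2/3) \<noteq> (16 * B1 / B) powr (2/5) \<longrightarrow>
    (let X = vector_field A A1 B B1 M m h C;
         F = energy_fun A A1 B B1 M m h C;
         S = energy_level A A1 B B1 M m h C;
         W = potW B B1 M m;
         \<theta>w = theta_w B B1 M m;
         Q = (0, sqrt (2 * W 0), 0, 0);
         Q' = (0, - sqrt (2 * W 0), 0, 0);
         E = (\<lambda>\<sigma>. (0, sqrt (2 * W \<theta>w), \<sigma> * \<theta>w, 0));
         E' = (\<lambda>\<sigma>. (0, - sqrt (2 * W \<theta>w), \<sigma> * \<theta>w, 0))
     in {p \<in> collision_manifold B B1 M m. X p = 0} = {Q, Q', E 1, E (-1), E' 1, E' (-1)} \<and>
        spiral_source X F Q \<and> unstable_dim X S Q 3 \<and>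
        spiral_sink X F Q' \<and> stable_dim X S Q' 3 \<and>
        (\<forall>\<sigma> \<in> {1, -1}.
           saddle X F (E \<sigma>) \<and> unstable_dim X S (E \<sigma>) 2 \<and> stable_dim X S (E \<sigma>) 1 \<and>
           saddle X F (E' \<sigma>) \<and> stable_dim X S (E' \<sigma>) 2 \<and> unstable_dim X S (E' \<sigma>) 1))"
proof -
  \<comment> \<open>The bound on \<open>\<nu> = \<mu> - 1\<close> that makes \<open>q < - 1/8\<close> at \<open>\<theta> = 0\<close>.\<close>
  define \<mu>0 where "\<mu>0 = 1 + (25 * B + 16 * B1) / (384 * B1)"
  have "1 < \<mu>0" using assms by (simp add: \<mu>0_def)
  show ?thesis
    unfolding Let_def
  proof (intro exI[of _ \<mu>0] conjI[OF \<open>1 < \<mu>0\<close>] allI impI, goal_cases)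
    case (1 M m h C)
    interpret isosceles_large_mu A A1 B B1 M m h C
      using assms 1 by unfold_locales
    have "(25 * B + 16 * B1) / (384 * B1) < \<nu>"
      using 1(3) by (simp add: \<mu>0_def \<nu>_def)
    then have "25 * B + 16 * B1 < 384 * B1 * \<nu>"
      using assms by (simp add: field_simps)
    from classification[OF this] show ?case unfolding Let_def .
  qed
qed

end
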